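(* Suppose that $G$ is a finite solvable group and $A$ is a finite group acting on $G$ by automorphisms. Then: (i) $\Gamma(G,A)$ is disconnected if and only if $G$ is a Frobenius group or a $2$-Frobenius group. In either case, the number of connected components of $\Gamma(G,A)$ is $m+1$, where $m$ is the number of $A$-orbits on the set of Frobenius complements of the lower Frobenius subgroup of $G$. (ii) If $\Gamma(G,A)$ is connected, then its diameter is at most $8$.
   Context: All groups are finite. Let $A$ be a finite group acting by automorphisms on the finite group $G$. The commuting graph $\Gamma(G,A)$ of this action is the simple graph whose vertex set is the set of all $A$-orbits $x^{A}$ of elements $x\in G\setminus\{1\}$, where two distinct vertices $\mathcal{O}$ and $\mathcal{O}'$ are joined by an edge if and only if there exist $x\in\mathcal{O}$ and $y\in\mathcal{O}'$ with $xy=yx$. A $2$-Frobenius group is a group $G=KLM$ with $K\trianglelefteq G$, $KL\trianglelefteq G$, such that $KL$ (with kernel $K$, complement $L$) and $LM$ (with kernel $L$, complement $M$) are both Frobenius groups. The lower Frobenius subgroup of $G$ means $G$ itself when $G=KL$ is Frobenius, and the Frobenius subgroup $KL$ when $G=KLM$ is $2$-Frobenius. *)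

theory Defs
  imports "HOL-Algebra.Algebra"
begin

definition frobenius_with :: "('a, 'c) monoid_scheme \<Rightarrow> 'a set \<Rightarrow> 'a set \<Rightarrow> bool" where
  "frobenius_with G K H \<longleftrightarrow>
     subgroup H G \<and> H \<noteq> {\<one>\<^bsub>G\<^esub>} \<and> H \<noteq> carrier G \<and>
     (\<forall>g \<in> carrier G - H. H \<inter> (g <#\<^bsub>G\<^esub> (H #>\<^bsub>G\<^esub> inv\<^bsub>G\<^esub> g)) = {\<one>\<^bsub>G\<^esub>}) \<and>
     K = (carrier G - (\<Union>g \<in> carrier G. g <#\<^bsub>G\<^esub> (H #>\<^bsub>G\<^esub> inv\<^bsub>G\<^esub> g))) \<union> {\<one>\<^bsub>G\<^esub>}"

definition frobenius_group :: "('a, 'c) monoid_scheme \<Rightarrow> bool" where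
  "frobenius_group G \<longleftrightarrow> (\<exists>K H. frobenius_with G K H)"

definition two_frobenius :: "('a, 'c) monoid_scheme \<Rightarrow> 'a set \<Rightarrow> 'a set \<Rightarrow> 'a set \<Rightarrow> bool" where
  "two_frobenius G K L M \<longleftrightarrow>
     K \<lhd> G \<and> (K <#>\<^bsub>G\<^esub> L) \<lhd> G \<and> subgroup L G \<and> subgroup M G \<and>
     subgroup (L <#>\<^bsub>G\<^esub> M) G \<and>
     carrier G = (K <#>\<^bsub>G\<^esub> L) <#>\<^bsub>G\<^esub> M \<and>
     frobenius_with (G\<lparr>carrier := K <#>\<^bsub>G\<^esub> L\<rparr>) K L \<and>
     frobenius_with (G\<lparr>carrier := L <#>\<^bsub>G\<^esub> M\<rparr>) L M"

definition two_frobenius_group :: "('a, 'c) monoid_scheme \<Rightarrow> bool" where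
  "two_frobenius_group G \<longleftrightarrow> (\<exists>K L M. two_frobenius G K L M)"

definition acts_by_automorphisms ::
  "('b, 'd) monoid_scheme \<Rightarrow> ('a, 'c) monoid_scheme \<Rightarrow> ('b \<Rightarrow> 'a \<Rightarrow> 'a) \<Rightarrow> bool" where
  "acts_by_automorphisms A G \<phi> \<longleftrightarrow>
     group_action A (carrier G) \<phi> \<and> (\<forall>a \<in> carrier A. \<phi> a \<in> hom G G)"

definition compl_orbit_count ::
  "('b, 'd) monoid_scheme \<Rightarrow> ('a, 'c) monoid_scheme \<Rightarrow> ('b \<Rightarrow> 'a \<Rightarrow> 'a) \<Rightarrow> 'a set \<Rightarrow> nat" where
  "compl_orbit_count A G \<phi> S =
     card ((\<lambda>H. (\<lambda>a. \<phi> a ` H) ` carrier A) ` {H. \<exists>K. frobenius_with (G\<lparr>carrier := S\<rparr>) K H})"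

definition cg_vertices ::
  "('b, 'd) monoid_scheme \<Rightarrow> ('a, 'c) monoid_scheme \<Rightarrow> ('b \<Rightarrow> 'a \<Rightarrow> 'a) \<Rightarrow> 'a set set" where
  "cg_vertices A G \<phi> = {orbit A \<phi> x | x. x \<in> carrier G - {\<one>\<^bsub>G\<^esub>}}"

definition cg_adj ::
  "('b, 'd) monoid_scheme \<Rightarrow> ('a, 'c) monoid_scheme \<Rightarrow> ('b \<Rightarrow> 'a \<Rightarrow> 'a) \<Rightarrow> 'a set \<Rightarrow> 'a set \<Rightarrow> bool" where
  "cg_adj A G \<phi> O1 O2 \<longleftrightarrow>
     O1 \<in> cg_vertices A G \<phi> \<and> O2 \<in> cg_vertices A G \<phi> \<and> O1 \<noteq> O2 \<and>
     (\<exists>x \<in> O1. \<exists>y \<in> O2. x \<otimes>\<^bsub>G\<^esub> y = y \<otimes>\<^bsub>G\<^esub> x)"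

definition cg_connected ::
  "('b, 'd) monoid_scheme \<Rightarrow> ('a, 'c) monoid_scheme \<Rightarrow> ('b \<Rightarrow> 'a \<Rightarrow> 'a) \<Rightarrow> bool" where
  "cg_connected A G \<phi> \<longleftrightarrow>
     (\<forall>u \<in> cg_vertices A G \<phi>. \<forall>v \<in> cg_vertices A G \<phi>. (cg_adj A G \<phi>)\<^sup>*\<^sup>* u v)"

definition cg_num_components ::
  "('b, 'd) monoid_scheme \<Rightarrow> ('a, 'c) monoid_scheme \<Rightarrow> ('b \<Rightarrow> 'a \<Rightarrow> 'a) \<Rightarrow> nat" where
  "cg_num_components A G \<phi> =
     card (cg_vertices A G \<phi> //
           {(u, v). u \<in> cg_vertices A G \<phi> \<and> v \<in> cg_vertices A G \<phi> \<and> (cg_adj A G \<phi>)\<^sup>*\<^sup>* u v})"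

definition cg_dist ::
  "('b, 'd) monoid_scheme \<Rightarrow> ('a, 'c) monoid_scheme \<Rightarrow> ('b \<Rightarrow> 'a \<Rightarrow> 'a) \<Rightarrow> 'a set \<Rightarrow> 'a set \<Rightarrow> nat" where
  "cg_dist A G \<phi> u v = (LEAST n. (cg_adj A G \<phi> ^^ n) u v)"

definition cg_diameter ::
  "('b, 'd) monoid_scheme \<Rightarrow> ('a, 'c) monoid_scheme \<Rightarrow> ('b \<Rightarrow> 'a \<Rightarrow> 'a) \<Rightarrow> nat" where
  "cg_diameter A G \<phi> =
     Max (insert 0 {cg_dist A G \<phi> u v | u v. u \<in> cg_vertices A G \<phi> \<and> v \<in> cg_vertices A G \<phi>})"

end

theory Submission
  imports Defs
begin

text \<open>
  The map sending an element to its orbit sends the commuting graph on \<open>G - {1}\<close> onto \<open>\<Gamma>(G, A)\<close>, so everything reduces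
  to the trivial action: components of \<open>\<Gamma>(G, A)\<close> are \<open>A\<close>-orbits of components, and distances can only shrink.

  Let \<open>V\<close> be a minimal normal subgroup, \<open>F\<close> its centraliser and \<open>E/F\<close> an elementary abelian normal section, of order
  prime to \<open>|V|\<close>. If \<open>x\<close> has prime order and every nontrivial element of its centraliser acts without fixed points on
  \<open>F\<close>, then \<open>x\<close> centralises \<open>E/F\<close>, fixed points can be lifted from the cosets of \<open>F\<close>, and \<open>E = F\<langle>t\<rangle>\<close> with \<open>t\<close> of
  prime order commuting with \<open>x\<close>. A Frattini argument gives \<open>G = F N(\<langle>t\<rangle>)\<close>.

  In a Frobenius group this applies to the elements of a complement \<open>H\<close>: it shows that the kernel is \<open>F\<close>, that
  \<open>G = F H\<close>, and that \<open>t\<close> connects \<open>H - {1}\<close>; the kernel is connected through \<open>V\<close>.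

  In general, an element at distance at most \<open>3\<close> from \<open>F - {1}\<close> is at distance at most \<open>4\<close> from every element of \<open>V - {1}\<close>.
  If some \<open>w\<close> is farther away, its powers of prime order are elements \<open>x\<close> as above. Either there are commuting
  \<open>c\<close>, \<open>y\<close> and \<open>v \<in> V\<close> such that \<open>w, x, c, y, v\<close> is a path, where up to conjugation by \<open>F\<close>, which fixes \<open>v\<close>, the choice does
  not depend on \<open>w\<close>; or \<open>N(\<langle>t\<rangle>)\<close> acts without fixed points on \<open>F\<close> and \<open>G\<close> is a Frobenius group; or a maximal cyclic
  normal subgroup \<open>A\<close> of \<open>N(\<langle>t\<rangle>)\<close> is the kernel of a Frobenius group \<open>N(\<langle>t\<rangle>)\<close> and \<open>G\<close> is a \<open>2\<close>-Frobenius group. Hence otherwise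
  all elements are at distance at most \<open>4\<close> from a common \<open>v\<close>.
\<close>

text \<open>Commuting elements come mainly from three sources: counting the fixed points of a map of
  prime period, the norm \<open>1 + x + ... + x^(p-1)\<close> of an operator without fixed points,
  and the bijection \<open>k |-> [k, s]\<close> of \<open>F\<close> when \<open>s\<close> acts on
  \<open>F\<close> without fixed points. These replace the conjugacy of complements and the
  structure theory of Frobenius complements, and they explain why elements of prime order are used
  throughout. The order of \<open>E/F\<close> is prime to \<open>|V|\<close> because
  \<open>V\<close> is minimal: otherwise the common fixed points of \<open>E\<close> on
  \<open>V\<close> would form a proper nontrivial normal subgroup. Automorphisms may fuse
  components, but never the component of the kernel with that of a complement. Only cardinality
  rules this out: a complement is smaller than the kernel. The maximal cyclic normal subgroup is
  split by parity. In even order its involution is central in the normaliser. In odd order it is its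
  own centraliser there, so that the quotient acts on it as an abelian group; quaternion groups are
  the reason why this needs odd order.\<close>

hide_const (open) Divisibility.prime

section \<open>Periodic maps, conjugation and linear actions\<close>

text \<open>The moved points split into cycles of \<open>f\<close>. A cycle length divides the prime
  \<open>p\<close>, so the cycle of a moved point has exactly \<open>p\<close> elements.\<close>

lemma dvd_card_moved_points:
  assumes "finite S" and "prime (p::nat)" and "f ` S \<subseteq> S" and period: "\<And>x. x \<in> S \<Longrightarrow> (f ^^ p) x = x"
  shows "p dvd card {x \<in> S. f x \<noteq> x}"
proof -
  define D where "D = {x \<in> S. f x \<noteq> x}"
  define orb where "orb x = (\<lambda>i. (f ^^ i) x) ` {..<p}" for x
  have p: "p > 0" using assms(2) prime_gt_0_nat by blast
  have inS: "(f ^^ i) x \<in> S" if "x \<in> S" for i x using that assms(3) by (induction i) auto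
  have mult: "(f ^^ (d * k)) x = x" if "(f ^^ d) x = x" for d k x
    using that by (induction k) (auto simp: funpow_add)
  have red: "(f ^^ i) x = (f ^^ (i mod p)) x" if "x \<in> S" for i x
  proof -
    have "(f ^^ i) x = (f ^^ (i mod p + p * (i div p))) x" by simp
    also have "\<dots> = (f ^^ (i mod p)) x" using mult[OF period[OF that]] by (simp only: funpow_add comp_apply)
    finally show ?thesis .
  qed
  \<comment> \<open>A return time \<open>d\<close> prime to \<open>p\<close> combines with
    \<open>p\<close> by Bezout to the return time 1.\<close>
  have fixd: "f x = x" if x: "x \<in> S" and d: "(f ^^ d) x = x" "0 < d" "d < p" for x d
  proof -
    have "coprime d p" using d assms(2)
      by (metis coprime_commute prime_imp_coprime nat_dvd_not_less)
    then obtain k m where "d * k = p * m + 1" using bezout_nat[of d p] d(2) by auto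
    then have "x = (f ^^ 1) ((f ^^ (p * m)) x)" using mult[OF d(1), of k]
      by (metis add.commute comp_apply funpow_add)
    then show ?thesis using mult[OF period[OF x]] by simp
  qed
  have inj: "inj_on (\<lambda>i. (f ^^ i) x) {..<p}" if x: "x \<in> D" for x
  proof (rule linorder_inj_onI)
    fix i j assume ij: "i < j" "i \<in> {..<p}" "j \<in> {..<p}"
    show "(f ^^ i) x \<noteq> (f ^^ j) x"
    proof
      assume eq: "(f ^^ i) x = (f ^^ j) x"
      have "x = (f ^^ (p - i + i)) x" using x period ij by (simp add: D_def)
      also have "\<dots> = (f ^^ (p - i + j)) x" by (simp only: funpow_add comp_apply eq)
      also have "p - i + j = (j - i) + p" using ij by auto
      also have "(f ^^ (j - i + p)) x = (f ^^ (j - i)) x" using x period by (simp add: D_def funpow_add)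
      finally have "(f ^^ (j - i)) x = x" by simp
      then show False using fixd[of x "j - i"] x ij by (simp add: D_def less_imp_diff_less)
    qed
  qed auto
  have card_orb: "card (orb x) = p" if "x \<in> D" for x
    using inj[OF that] by (simp add: orb_def card_image)
  have self: "x \<in> orb x" for x using p by (auto simp: orb_def intro!: image_eqI[of _ _ 0])
  have orb_back: "x \<in> orb y \<and> orb y \<subseteq> orb x \<and> y \<in> D" if x: "x \<in> D" and y: "y \<in> orb x" for x y
  proof -
    obtain i where i: "i < p" "y = (f ^^ i) x" using y by (auto simp: orb_def)
    have "(f ^^ (p - i + i)) x = x" using i x period[of x] by (simp add: D_def)
    then have xi: "x = (f ^^ (p - i)) y" using i by (simp only: funpow_add comp_apply)
    have "y \<in> S" using i inS x by (auto simp: D_def)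
    then have "x = (f ^^ ((p - i) mod p)) y" using red xi by metis
    then have "x \<in> orb y" unfolding orb_def by (rule image_eqI) (use p in auto)
    moreover have "orb y \<subseteq> orb x"
    proof
      fix z assume "z \<in> orb y"
      then obtain j where "z = (f ^^ j) y" by (auto simp: orb_def)
      then have "z = (f ^^ ((j + i) mod p)) x" using i red[of x "j + i"] x by (simp add: D_def funpow_add)
      then show "z \<in> orb x" using p by (auto simp: orb_def)
    qed
    moreover have "f y \<noteq> y"
    proof
      assume fy: "f y = y"
      have "(f ^^ k) y = y" for k by (induction k) (auto simp: fy)
      then show False using xi fy x by (simp add: D_def)
    qed
    ultimately show ?thesis using i inS x by (auto simp: D_def)
  qed
  have "p * card (orb ` D) = card (\<Union> (orb ` D))"
  proof (rule card_partition)
    show "finite (orb ` D)" "finite (\<Union> (orb ` D))" using assms(1) by (auto simp: D_def orb_def)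
    show "card c = p" if "c \<in> orb ` D" for c using that card_orb by auto
    show "c1 \<inter> c2 = {}" if "c1 \<in> orb ` D" "c2 \<in> orb ` D" "c1 \<noteq> c2" for c1 c2
      using that orb_back by blast
  qed
  moreover have "\<Union> (orb ` D) = D" using self orb_back by blast
  ultimately have "card {x \<in> S. f x \<noteq> x} = p * card (orb ` D)" by (simp add: D_def)
  then show ?thesis by simp
qed

text \<open>All points except \<open>a\<close> are moved, so \<open>card S\<close> is 1 modulo
  \<open>p\<close>.\<close>

lemma unique_fixed_point_coprime:
  assumes "finite S" "prime (p::nat)" "f ` S \<subseteq> S" "\<And>x. x \<in> S \<Longrightarrow> (f ^^ p) x = x"
    and "{x \<in> S. f x = x} = {a}"
  shows "\<not> p dvd card S"
proof
  assume "p dvd card S"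
  have "S = {x \<in> S. f x \<noteq> x} \<union> {a}" "a \<notin> {x \<in> S. f x \<noteq> x}" using assms(5) by blast+
  then have "card S = card {x \<in> S. f x \<noteq> x} + 1" using assms(1)
    by (metis (no_types, lifting) Suc_eq_plus1 Un_insert_right card_insert_disjoint finite_Un sup_bot_right)
  then have "p dvd 1" using \<open>p dvd card S\<close> dvd_card_moved_points[OF assms(1-4)]
    by (metis dvd_add_right_iff)
  then show False using assms(2) by auto
qed

lemma exists_fixed_point:
  assumes "finite S" "prime (p::nat)" "f ` S \<subseteq> S" "\<And>x. x \<in> S \<Longrightarrow> (f ^^ p) x = x"
    and "\<not> p dvd card S"
  shows "\<exists>x \<in> S. f x = x"
proof (rule ccontr)
  assume "\<not> ?thesis"
  then have "{x \<in> S. f x \<noteq> x} = S" by blast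
  then show False using dvd_card_moved_points[OF assms(1-4)] assms(5) by simp
qed

text \<open>Used with \<open>a\<close> the identity: the trivial fixed point of a conjugation does
  not come alone when \<open>p\<close> divides the number of points.\<close>

lemma exists_other_fixed_point:
  assumes "finite S" "prime (p::nat)" "f ` S \<subseteq> S" "\<And>x. x \<in> S \<Longrightarrow> (f ^^ p) x = x"
    and "p dvd card S" "a \<in> S" "f a = a"
  shows "\<exists>x \<in> S. x \<noteq> a \<and> f x = x"
  using unique_fixed_point_coprime[OF assms(1-4), of a] assms(5-7) by blast

section \<open>Conjugation and actions without fixed points\<close>

context group
begin

lemma cancel_l_inv [simp]: "x \<in> carrier G \<Longrightarrow> y \<in> carrier G \<Longrightarrow> inv x \<otimes> (x \<otimes> y) = y"
  by (simp flip: m_assoc)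

lemma cancel_r_inv [simp]: "x \<in> carrier G \<Longrightarrow> y \<in> carrier G \<Longrightarrow> x \<otimes> (inv x \<otimes> y) = y"
  by (simp flip: m_assoc)

definition cj :: "'a \<Rightarrow> 'a \<Rightarrow> 'a" where
  "cj g x = g \<otimes> x \<otimes> inv g"

lemma cj_closed [simp, intro]: "g \<in> carrier G \<Longrightarrow> x \<in> carrier G \<Longrightarrow> cj g x \<in> carrier G"
  by (simp add: cj_def)

lemma cj_one_left [simp]: "x \<in> carrier G \<Longrightarrow> cj \<one> x = x"
  by (simp add: cj_def)

lemma cj_one_right [simp]: "g \<in> carrier G \<Longrightarrow> cj g \<one> = \<one>"
  by (simp add: cj_def)

lemma cj_mult: "g \<in> carrier G \<Longrightarrow> x \<in> carrier G \<Longrightarrow> y \<in> carrier G \<Longrightarrow> cj g (x \<otimes> y) = cj g x \<otimes> cj g y"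
  by (simp add: cj_def m_assoc)

lemma cj_cj: "g \<in> carrier G \<Longrightarrow> h \<in> carrier G \<Longrightarrow> x \<in> carrier G \<Longrightarrow> cj g (cj h x) = cj (g \<otimes> h) x"
  by (simp add: cj_def m_assoc inv_mult_group)

lemma cj_inv: "g \<in> carrier G \<Longrightarrow> x \<in> carrier G \<Longrightarrow> cj g (inv x) = inv (cj g x)"
  by (simp add: cj_def m_assoc inv_mult_group)

lemma cj_inv_cj [simp]: "g \<in> carrier G \<Longrightarrow> x \<in> carrier G \<Longrightarrow> cj (inv g) (cj g x) = x"
  by (simp add: cj_cj)

lemma cj_cj_inv [simp]: "g \<in> carrier G \<Longrightarrow> x \<in> carrier G \<Longrightarrow> cj g (cj (inv g) x) = x"
  by (simp add: cj_cj)

lemma cj_inj [simp]: "g \<in> carrier G \<Longrightarrow> x \<in> carrier G \<Longrightarrow> y \<in> carrier G \<Longrightarrow> cj g x = cj g y \<longleftrightarrow> x = y"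
  by (metis cj_inv_cj)

lemma cj_eq_one_iff [simp]: "g \<in> carrier G \<Longrightarrow> x \<in> carrier G \<Longrightarrow> cj g x = \<one> \<longleftrightarrow> x = \<one>"
  by (metis cj_inj cj_one_right one_closed)

lemma cj_pow: "g \<in> carrier G \<Longrightarrow> x \<in> carrier G \<Longrightarrow> cj g (x [^] (n::nat)) = cj g x [^] n"
  by (induction n) (auto simp: cj_mult)

lemma cj_fix_iff: "g \<in> carrier G \<Longrightarrow> x \<in> carrier G \<Longrightarrow> cj g x = x \<longleftrightarrow> g \<otimes> x = x \<otimes> g"
  by (metis cj_def inv_closed inv_solve_right m_closed)

lemma cj_funpow: "g \<in> carrier G \<Longrightarrow> x \<in> carrier G \<Longrightarrow> (cj g ^^ n) x = cj (g [^] n) x"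
  by (induction n) (auto simp: cj_cj simp flip: nat_pow_Suc2)

lemma cj_comm_iff:
  "g \<in> carrier G \<Longrightarrow> x \<in> carrier G \<Longrightarrow> y \<in> carrier G \<Longrightarrow>
    cj g x \<otimes> cj g y = cj g y \<otimes> cj g x \<longleftrightarrow> x \<otimes> y = y \<otimes> x"
  by (metis cj_mult cj_inj m_closed)

lemma comm_inv: "x \<in> carrier G \<Longrightarrow> y \<in> carrier G \<Longrightarrow> x \<otimes> y = y \<otimes> x \<Longrightarrow> inv x \<otimes> y = y \<otimes> inv x"
  by (metis inv_closed inv_solve_left inv_solve_right m_assoc m_closed)

lemma comm_mult:
  "x \<in> carrier G \<Longrightarrow> y \<in> carrier G \<Longrightarrow> z \<in> carrier G \<Longrightarrow> x \<otimes> z = z \<otimes> x \<Longrightarrow> y \<otimes> z = z \<otimes> y \<Longrightarrow>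
    (x \<otimes> y) \<otimes> z = z \<otimes> (x \<otimes> y)"
  by (metis m_assoc)

lemma comm_pow: "x \<in> carrier G \<Longrightarrow> y \<in> carrier G \<Longrightarrow> x \<otimes> y = y \<otimes> x \<Longrightarrow> x [^] (n::nat) \<otimes> y = y \<otimes> x [^] n"
  by (simp add: group_commutes_pow)

text \<open>Phrased by commuting elements, so it makes sense before \<open>Q\<close> is known to
  normalise \<open>V\<close>. The case \<open>z = v\<close> shows that \<open>Q\<close> and
  \<open>V\<close> share at most the identity.\<close>

definition fpf :: "'a set \<Rightarrow> 'a set \<Rightarrow> bool" where
  "fpf Q V \<longleftrightarrow> (\<forall>z \<in> Q. \<forall>v \<in> V. z \<noteq> \<one> \<longrightarrow> z \<otimes> v = v \<otimes> z \<longrightarrow> v = \<one>)"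

lemma fpfD: "fpf Q V \<Longrightarrow> z \<in> Q \<Longrightarrow> v \<in> V \<Longrightarrow> z \<noteq> \<one> \<Longrightarrow> z \<otimes> v = v \<otimes> z \<Longrightarrow> v = \<one>"
  by (auto simp: fpf_def)

lemma fpf_mono: "fpf Q V \<Longrightarrow> Q' \<subseteq> Q \<Longrightarrow> V' \<subseteq> V \<Longrightarrow> fpf Q' V'"
  by (auto simp: fpf_def)

end

text \<open>A module in multiplicative notation, with \<open>finprod\<close> as the sum.
  \<open>H\<close> will be \<open>G\<close> acting by \<open>cj\<close>, or a quotient
  \<open>G Mod F\<close> acting through representatives.\<close>

locale linear_action = H: group H + V: comm_group V
  for H :: "('h, 'x) monoid_scheme" and V :: "('v, 'y) monoid_scheme" +
  fixes act :: "'h \<Rightarrow> 'v \<Rightarrow> 'v"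
  assumes act_closed [simp]: "h \<in> carrier H \<Longrightarrow> v \<in> carrier V \<Longrightarrow> act h v \<in> carrier V"
    and act_add: "h \<in> carrier H \<Longrightarrow> v \<in> carrier V \<Longrightarrow> w \<in> carrier V \<Longrightarrow> act h (v \<otimes>\<^bsub>V\<^esub> w) = act h v \<otimes>\<^bsub>V\<^esub> act h w"
    and act_mult: "h \<in> carrier H \<Longrightarrow> k \<in> carrier H \<Longrightarrow> v \<in> carrier V \<Longrightarrow> act (h \<otimes>\<^bsub>H\<^esub> k) v = act h (act k v)"
    and act_one [simp]: "v \<in> carrier V \<Longrightarrow> act \<one>\<^bsub>H\<^esub> v = v"
begin

lemma act_zero [simp]: "h \<in> carrier H \<Longrightarrow> act h \<one>\<^bsub>V\<^esub> = \<one>\<^bsub>V\<^esub>"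
  by (metis V.l_one V.one_closed V.r_cancel_one act_add act_closed)

lemma act_finprod:
  assumes "h \<in> carrier H" "g \<in> A \<rightarrow> carrier V"
  shows "act h (finprod V g A) = finprod V (\<lambda>a. act h (g a)) A"
  using assms(2)
proof (induction A rule: infinite_finite_induct)
  case (insert a A)
  then have "g a \<in> carrier V" "g \<in> A \<rightarrow> carrier V" "(\<lambda>a. act h (g a)) \<in> A \<rightarrow> carrier V" "act h (g a) \<in> carrier V" 
    using assms(1) by (auto simp: Pi_iff)
  with insert show ?case using assms(1) by (simp add: act_add)
qed (use assms(1) in auto)

lemma finprod_swap:
  assumes "finite A" "finite B" "\<And>a b. a \<in> A \<Longrightarrow> b \<in> B \<Longrightarrow> g a b \<in> carrier V"
  shows "finprod V (\<lambda>a. finprod V (g a) B) A = finprod V (\<lambda>b. finprod V (\<lambda>a. g a b) A) B"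
  using assms(1,3)
proof (induction A)
  case empty
  then show ?case by simp
next
  case (insert a A)
  have *: "(\<lambda>a. finprod V (g a) B) \<in> A \<rightarrow> carrier V" "finprod V (g a) B \<in> carrier V"
    "g a \<in> B \<rightarrow> carrier V" "(\<lambda>b. finprod V (\<lambda>a. g a b) A) \<in> B \<rightarrow> carrier V"
    using insert.prems by (auto intro!: V.finprod_closed)
  have "finprod V (\<lambda>a. finprod V (g a) B) (insert a A) =
      finprod V (g a) B \<otimes>\<^bsub>V\<^esub> finprod V (\<lambda>b. finprod V (\<lambda>a. g a b) A) B"
    using insert * by simp
  also have "\<dots> = finprod V (\<lambda>b. g a b \<otimes>\<^bsub>V\<^esub> finprod V (\<lambda>a. g a b) A) B"
    using * by (simp add: V.finprod_multf)
  also have "\<dots> = finprod V (\<lambda>b. finprod V (\<lambda>a. g a b) (insert a A)) B"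
    using insert by (intro V.finprod_cong') (auto simp: Pi_iff intro!: V.finprod_closed)
  finally show ?case .
qed

definition fixfree :: "'h \<Rightarrow> bool" where
  "fixfree h \<longleftrightarrow> (\<forall>v \<in> carrier V. act h v = v \<longrightarrow> v = \<one>\<^bsub>V\<^esub>)"

text \<open>Applying \<open>x\<close> permutes the factors cyclically, so the norm is a fixed point
  of \<open>x\<close>.\<close>

lemma norm_trivial:
  assumes x: "x \<in> carrier H" "x [^]\<^bsub>H\<^esub> p = \<one>\<^bsub>H\<^esub>" "fixfree x" and v: "v \<in> carrier V" and p: "(p::nat) > 0"
  shows "finprod V (\<lambda>i. act (x [^]\<^bsub>H\<^esub> i) v) {..<p} = \<one>\<^bsub>V\<^esub>"
proof -
  let ?f = "\<lambda>i::nat. act (x [^]\<^bsub>H\<^esub> i) v"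
  have cl: "?f \<in> A \<rightarrow> carrier V" for A using x v by (auto intro!: act_closed H.nat_pow_closed)
  \<comment> \<open>The shift of exponents modulo \<open>p\<close>; it wraps around correctly
    because the \<open>p\<close>-th power of \<open>x\<close> is the identity.\<close>
  define b where "b i = Suc i mod p" for i
  have bij: "b ` {..<p} = {..<p}"
  proof (rule endo_inj_surj)
    show "b ` {..<p} \<subseteq> {..<p}" using p by (auto simp: b_def)
    show "inj_on b {..<p}"
      by (rule inj_onI) (auto simp: b_def mod_Suc split: if_splits)
  qed auto
  have inj: "inj_on b {..<p}" using bij by (intro eq_card_imp_inj_on) auto
  have "act x (finprod V ?f {..<p}) = finprod V (\<lambda>i. act x (?f i)) {..<p}"
    using act_finprod[OF x(1) cl] .
  also have "\<dots> = finprod V (\<lambda>i. ?f (b i)) {..<p}"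
  proof (intro V.finprod_cong' refl)
    fix i assume "i \<in> {..<p}"
    then have "x [^]\<^bsub>H\<^esub> b i = x [^]\<^bsub>H\<^esub> Suc i"
      using x by (auto simp: b_def mod_Suc Suc_lessI)
    then show "act x (?f i) = ?f (b i)"
      using x v by (simp add: act_mult[symmetric] H.nat_pow_Suc2 del: H.nat_pow_Suc Group.nat_pow_Suc)
  qed (use x v in auto)
  also have "\<dots> = finprod V ?f (b ` {..<p})"
    by (rule V.finprod_reindex[symmetric]) (use cl inj in auto)
  finally show ?thesis using x(3) V.finprod_closed[OF cl] by (simp add: fixfree_def bij)
qed

end

section \<open>Fixed points of coprime actions\<close>

context linear_action
begin

lemma act_pow: "h \<in> carrier H \<Longrightarrow> v \<in> carrier V \<Longrightarrow> act h (v [^]\<^bsub>V\<^esub> (n::nat)) = act h v [^]\<^bsub>V\<^esub> n"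
  by (induction n) (auto simp: act_add)

text \<open>The idea: if \<open>x\<close> has no fixed points, then neither have its conjugates by elements \<open>e\<close> of \<open>E\<close>, so their
  norms \<open>1 + x\<^sup>e + \<dots> + (x\<^sup>e)\<^sup>p\<^sup>-\<^sup>1\<close> vanish. Summing the norms over \<open>e\<close> yields \<open>|E|\<close> times the identity plus
  terms with values in the fixed points of \<open>[E, x]\<close>.\<close>
lemma coprime_commutator_acts_trivially:
  assumes E: "subgroup E H" "finite E" "\<And>e e'. e \<in> E \<Longrightarrow> e' \<in> E \<Longrightarrow> e \<otimes>\<^bsub>H\<^esub> e' = e' \<otimes>\<^bsub>H\<^esub> e"
    and cop: "\<And>w. w \<in> carrier V \<Longrightarrow> w [^]\<^bsub>V\<^esub> card E = \<one>\<^bsub>V\<^esub> \<Longrightarrow> w = \<one>\<^bsub>V\<^esub>"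
    and x: "x \<in> carrier H" "x [^]\<^bsub>H\<^esub> p = \<one>\<^bsub>H\<^esub>" "prime (p::nat)" "fixfree x"
    and norm: "\<And>e. e \<in> E \<Longrightarrow> H.cj x e \<in> E"
    and e: "e0 \<in> E" and v: "v \<in> carrier V"
  shows "act (e0 \<otimes>\<^bsub>H\<^esub> H.cj x (inv\<^bsub>H\<^esub> e0)) v = v"
proof -
  have p: "p > 0" "p > 1" using x(3) prime_gt_0_nat prime_gt_1_nat by blast+
  have Ec: "e \<in> carrier H" if "e \<in> E" for e using that E(1) subgroup.mem_carrier by fast
  have Ei: "inv\<^bsub>H\<^esub> e \<in> E" if "e \<in> E" for e using that E(1) subgroup.m_inv_closed by fast
  have Em: "e \<otimes>\<^bsub>H\<^esub> e' \<in> E" if "e \<in> E" "e' \<in> E" for e e' using that E(1) subgroup.m_closed by fast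
  \<comment> \<open>\<open>c y e\<close> is the commutator \<open>[e, y]\<close>, so
    \<open>c (x^i) e\<close> times \<open>x^i\<close> is the conjugate of \<open>x^i\<close> by
    \<open>e\<close>.\<close>
  define c where "c y e = e \<otimes>\<^bsub>H\<^esub> H.cj y (inv\<^bsub>H\<^esub> e)" for y e
  have normpow: "H.cj (x [^]\<^bsub>H\<^esub> (i::nat)) e \<in> E" if "e \<in> E" for i e
    using that
  proof (induction i)
    case (Suc i)
    then show ?case using norm[OF Suc.IH[OF Suc.prems]] x Ec[OF Suc.prems]
      by (simp add: H.cj_cj H.nat_pow_Suc2 del: H.nat_pow_Suc Group.nat_pow_Suc)
  qed (simp add: Ec)
  have cE: "c (x [^]\<^bsub>H\<^esub> (i::nat)) e \<in> E" if "e \<in> E" for i e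
    using that normpow Ei Em by (simp add: c_def)
  \<comment> \<open>\<open>E\<close> is abelian and normalised by \<open>x\<close>, so commutation
    with a power of \<open>x\<close> is a homomorphism on \<open>E\<close>.\<close>
  have chom: "c (x [^]\<^bsub>H\<^esub> (i::nat)) (e \<otimes>\<^bsub>H\<^esub> e') = c (x [^]\<^bsub>H\<^esub> i) e \<otimes>\<^bsub>H\<^esub> c (x [^]\<^bsub>H\<^esub> i) e'" if "e \<in> E" "e' \<in> E" for i e e'
  proof -
    let ?y = "x [^]\<^bsub>H\<^esub> i"
    have "c ?y (e \<otimes>\<^bsub>H\<^esub> e') = e \<otimes>\<^bsub>H\<^esub> (c ?y e' \<otimes>\<^bsub>H\<^esub> H.cj ?y (inv\<^bsub>H\<^esub> e))"
      using that Ec x by (simp add: c_def H.inv_mult_group H.cj_mult H.m_assoc)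
    also have "c ?y e' \<otimes>\<^bsub>H\<^esub> H.cj ?y (inv\<^bsub>H\<^esub> e) = H.cj ?y (inv\<^bsub>H\<^esub> e) \<otimes>\<^bsub>H\<^esub> c ?y e'"
      using that by (intro E(3)) (auto simp: cE normpow Ei)
    finally show ?thesis using that Ec x by (simp add: c_def H.m_assoc)
  qed
  \<comment> \<open>\<open>[e, y^(j+1)] = [e, y] y [e, y^j] y^-1\<close> keeps commutators with
    powers of \<open>y\<close> in the image of \<open>[_, y]\<close>.\<close>
  have cpow: "\<exists>e1 \<in> E. c ((x [^]\<^bsub>H\<^esub> (i::nat)) [^]\<^bsub>H\<^esub> (j::nat)) e = c (x [^]\<^bsub>H\<^esub> i) e1" if "e \<in> E" for i j e
  proof (induction j)
    case 0
    have "c \<one>\<^bsub>H\<^esub> e = \<one>\<^bsub>H\<^esub>" "c (x [^]\<^bsub>H\<^esub> i) \<one>\<^bsub>H\<^esub> = \<one>\<^bsub>H\<^esub>" using that Ec x by (auto simp: c_def)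
    then show ?case using E(1) subgroup.one_closed by (metis H.nat_pow_0)
  next
    case (Suc j)
    let ?y = "x [^]\<^bsub>H\<^esub> i"
    have y: "?y \<in> carrier H" using x by simp
    obtain e1 where e1: "e1 \<in> E" "c (?y [^]\<^bsub>H\<^esub> j) e = c ?y e1" using Suc by blast
    have "c (?y [^]\<^bsub>H\<^esub> Suc j) e = c ?y e \<otimes>\<^bsub>H\<^esub> H.cj ?y (c (?y [^]\<^bsub>H\<^esub> j) e)"
      using y that Ec by (simp add: c_def H.cj_mult H.m_assoc H.cj_cj H.cj_inv H.nat_pow_Suc2 del: H.nat_pow_Suc Group.nat_pow_Suc)
    also have "\<dots> = c ?y e \<otimes>\<^bsub>H\<^esub> c ?y (H.cj ?y e1)"
      using y e1 that Ec by (simp add: c_def H.cj_mult H.cj_inv)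
    also have "\<dots> = c ?y (e \<otimes>\<^bsub>H\<^esub> H.cj ?y e1)" using chom[of e "H.cj ?y e1"] that e1 normpow by simp
    finally show ?case using that e1 normpow Em by blast
  qed
  \<comment> \<open>\<open>x\<close> is itself a power of \<open>x^i\<close>, so
    \<open>[e0, x]\<close> lies in the image of the homomorphism belonging to \<open>x^i\<close>,
    for every such \<open>i\<close>.\<close>
  have cx: "\<exists>e1 \<in> E. c x e0 = c (x [^]\<^bsub>H\<^esub> i) e1" if "i \<in> {1..<p}" for i
  proof -
    have "\<not> p dvd i" using that by (auto dest: dvd_imp_le)
    then have "coprime i p" using x(3) prime_imp_coprime coprime_commute by blast
    moreover have "i \<noteq> 0" using that by simp
    from bezout_nat[OF this, of p] obtain k m where "i * k = p * m + gcd i p" by blast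
    ultimately have km: "i * k = p * m + 1" by simp
    have "(x [^]\<^bsub>H\<^esub> i) [^]\<^bsub>H\<^esub> k = x [^]\<^bsub>H\<^esub> (p * m + 1)" using x km by (simp add: H.nat_pow_pow)
    also have "\<dots> = x [^]\<^bsub>H\<^esub> (p * m) \<otimes>\<^bsub>H\<^esub> x [^]\<^bsub>H\<^esub> (1::nat)" using x by (simp add: H.nat_pow_mult)
    also have "\<dots> = x" using x by (simp flip: H.nat_pow_pow)
    finally show ?thesis using cpow[OF e, of i k] by simp
  qed
  define S where "S i = finprod V (\<lambda>e. act (c (x [^]\<^bsub>H\<^esub> i) e) (act (x [^]\<^bsub>H\<^esub> i) v)) E" for i :: nat
  have Scl: "S i \<in> carrier V" for i
    using x v cE Ec by (auto simp: S_def intro!: V.finprod_closed)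
  \<comment> \<open>\<open>S i\<close> sums over the image of a homomorphism on \<open>E\<close>, so
    an element of that image only reindexes the sum.\<close>
  have S_fixed: "act (c x e0) (S i) = S i" if i: "i \<in> {1..<p}" for i
  proof -
    let ?y = "x [^]\<^bsub>H\<^esub> i"
    obtain e1 where e1: "e1 \<in> E" "c x e0 = c ?y e1" using cx i by blast
    have inj: "inj_on (\<lambda>e. e1 \<otimes>\<^bsub>H\<^esub> e) E" using Ec e1 by (auto simp: inj_on_def)
    have img: "(\<lambda>e. e1 \<otimes>\<^bsub>H\<^esub> e) ` E = E" using e1 Em E(2) inj by (intro endo_inj_surj) auto
    have "act (c ?y e1) (S i) = finprod V (\<lambda>e. act (c ?y e1) (act (c ?y e) (act ?y v))) E"
      unfolding S_def using x v cE Ec e1 by (intro act_finprod) auto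
    also have "\<dots> = finprod V (\<lambda>e. act (c ?y (e1 \<otimes>\<^bsub>H\<^esub> e)) (act ?y v)) E"
      using x v cE Ec e1 chom Em by (intro V.finprod_cong') (auto simp: act_mult)
    also have "\<dots> = finprod V (\<lambda>e. act (c ?y e) (act ?y v)) ((\<lambda>e. e1 \<otimes>\<^bsub>H\<^esub> e) ` E)"
      using x v cE Ec e1 Em inj by (intro V.finprod_reindex[symmetric]) auto
    finally show ?thesis using e1 by (simp add: S_def img)
  qed
  have S0: "S 0 = v [^]\<^bsub>V\<^esub> card E"
  proof -
    have "S 0 = finprod V (\<lambda>e. v) E" unfolding S_def
      using x v Ec by (intro V.finprod_cong') (auto simp: c_def)
    then show ?thesis using v by (simp add: V.finprod_const)
  qed
  \<comment> \<open>For fixed \<open>e\<close> the factors now form \<open>e\<close> applied to a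
    norm of \<open>x\<close>; exchanging the two products makes all of them vanish.\<close>
  have "finprod V S {..<p} = finprod V (\<lambda>i. finprod V (\<lambda>e. act e (act (x [^]\<^bsub>H\<^esub> i) (act (inv\<^bsub>H\<^esub> e) v))) E) {..<p}"
    unfolding S_def
  proof (intro V.finprod_cong' refl)
    fix i :: nat and e assume "e \<in> E"
    then show "act (c (x [^]\<^bsub>H\<^esub> i) e) (act (x [^]\<^bsub>H\<^esub> i) v) = act e (act (x [^]\<^bsub>H\<^esub> i) (act (inv\<^bsub>H\<^esub> e) v))"
      using x v Ec by (simp add: c_def H.cj_def H.m_assoc flip: act_mult)
  qed (use x v Ec in \<open>auto intro!: V.finprod_closed\<close>)
  also have "\<dots> = finprod V (\<lambda>e. finprod V (\<lambda>i. act e (act (x [^]\<^bsub>H\<^esub> i) (act (inv\<^bsub>H\<^esub> e) v))) {..<p}) E"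
    using x v Ec E(2) by (intro finprod_swap) auto
  also have "\<dots> = finprod V (\<lambda>e. \<one>\<^bsub>V\<^esub>) E"
  proof (intro V.finprod_cong' refl)
    fix e assume e: "e \<in> E"
    have "finprod V (\<lambda>i. act e (act (x [^]\<^bsub>H\<^esub> i) (act (inv\<^bsub>H\<^esub> e) v))) {..<p}
        = act e (finprod V (\<lambda>i. act (x [^]\<^bsub>H\<^esub> i) (act (inv\<^bsub>H\<^esub> e) v)) {..<p})"
      using x v Ec e by (intro act_finprod[symmetric]) auto
    also have "\<dots> = \<one>\<^bsub>V\<^esub>" using norm_trivial[OF x(1,2,4)] p e Ec v by simp
    finally show "finprod V (\<lambda>i. act e (act (x [^]\<^bsub>H\<^esub> i) (act (inv\<^bsub>H\<^esub> e) v))) {..<p} = \<one>\<^bsub>V\<^esub>" .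
  qed auto
  finally have total: "finprod V S {..<p} = \<one>\<^bsub>V\<^esub>" by simp
  define R where "R = finprod V S {1..<p}"
  have Rcl: "R \<in> carrier V" unfolding R_def using Scl by (auto intro!: V.finprod_closed)
  have "{..<p} = insert 0 {1..<p}" using p by auto
  moreover have "finprod V S (insert 0 {1..<p}) = S 0 \<otimes>\<^bsub>V\<^esub> finprod V S {1..<p}"
    using Scl by (intro V.finprod_insert) auto
  ultimately have "v [^]\<^bsub>V\<^esub> card E \<otimes>\<^bsub>V\<^esub> R = \<one>\<^bsub>V\<^esub>"
    using total S0 by (simp add: R_def)
  \<comment> \<open>The term of exponent 0 is isolated: \<open>card E\<close> times \<open>v\<close>
    is minus the sum of terms fixed by \<open>[e0, x]\<close>, hence fixed as well, and coprimality
    cancels \<open>card E\<close>.\<close>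
  then have vR: "v [^]\<^bsub>V\<^esub> card E = inv\<^bsub>V\<^esub> R" using Rcl v by (metis V.inv_equality V.nat_pow_closed)
  define g where "g = c x e0"
  have g: "g \<in> carrier H" using cE[OF e, of 1] x Ec by (simp add: g_def)
  have "act g R = finprod V (\<lambda>i. act g (S i)) {1..<p}"
    unfolding R_def using g Scl by (intro act_finprod) auto
  also have "\<dots> = R"
    unfolding R_def using S_fixed Scl by (intro V.finprod_cong') (auto simp: g_def)
  finally have gR: "act g R = R" .
  have "act g (inv\<^bsub>V\<^esub> R) \<otimes>\<^bsub>V\<^esub> R = \<one>\<^bsub>V\<^esub>"
    using act_add[OF g, of "inv\<^bsub>V\<^esub> R" R] g gR Rcl by simp
  then have "act g (inv\<^bsub>V\<^esub> R) = inv\<^bsub>V\<^esub> R"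
    using g Rcl by (metis V.inv_closed V.inv_equality act_closed)
  then have "act g v [^]\<^bsub>V\<^esub> card E = v [^]\<^bsub>V\<^esub> card E" using vR g v by (simp flip: act_pow)
  then have "(act g v \<otimes>\<^bsub>V\<^esub> inv\<^bsub>V\<^esub> v) [^]\<^bsub>V\<^esub> card E = \<one>\<^bsub>V\<^esub>"
    using g v by (simp add: V.nat_pow_distrib V.nat_pow_inv)
  then have "act g v \<otimes>\<^bsub>V\<^esub> inv\<^bsub>V\<^esub> v = \<one>\<^bsub>V\<^esub>" using cop g v by simp
  then show ?thesis using g v unfolding g_def c_def by (metis V.inv_closed V.inv_equality V.inv_inv act_closed)
qed

text \<open>Add up the norms of the \<open>l\<close> elements \<open>x^i y\<close>, all of which
  vanish. After exchanging the sums, \<open>j = 0\<close> contributes \<open>l\<close> times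
  \<open>v\<close>, and each \<open>0 < j < l\<close> contributes the norm of \<open>x^j\<close> at
  \<open>y^j v\<close>, which vanishes too. So an elementary abelian group of rank two cannot act
  without fixed points on a nontrivial module of coprime order.\<close>

lemma trivial_module_if_rank_two_fixfree:
  assumes x: "x \<in> carrier H" "x [^]\<^bsub>H\<^esub> l = \<one>\<^bsub>H\<^esub>" and y: "y \<in> carrier H" "y [^]\<^bsub>H\<^esub> l = \<one>\<^bsub>H\<^esub>"
    and comm: "x \<otimes>\<^bsub>H\<^esub> y = y \<otimes>\<^bsub>H\<^esub> x" and l: "(l::nat) > 0"
    and cop: "\<And>w. w \<in> carrier V \<Longrightarrow> w [^]\<^bsub>V\<^esub> l = \<one>\<^bsub>V\<^esub> \<Longrightarrow> w = \<one>\<^bsub>V\<^esub>"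
    and fx: "\<And>j::nat. 0 < j \<Longrightarrow> j < l \<Longrightarrow> fixfree (x [^]\<^bsub>H\<^esub> j)"
    and fxy: "\<And>i::nat. i < l \<Longrightarrow> fixfree (x [^]\<^bsub>H\<^esub> i \<otimes>\<^bsub>H\<^esub> y)"
    and v: "v \<in> carrier V"
  shows "v = \<one>\<^bsub>V\<^esub>"
proof -
  have xy: "(x [^]\<^bsub>H\<^esub> i \<otimes>\<^bsub>H\<^esub> y) [^]\<^bsub>H\<^esub> j = (x [^]\<^bsub>H\<^esub> j) [^]\<^bsub>H\<^esub> i \<otimes>\<^bsub>H\<^esub> y [^]\<^bsub>H\<^esub> j" for i j :: nat
  proof -
    have "x [^]\<^bsub>H\<^esub> i \<otimes>\<^bsub>H\<^esub> y = y \<otimes>\<^bsub>H\<^esub> x [^]\<^bsub>H\<^esub> i" using H.comm_pow[OF x(1) y(1) comm] .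
    then have "(x [^]\<^bsub>H\<^esub> i \<otimes>\<^bsub>H\<^esub> y) [^]\<^bsub>H\<^esub> j = (x [^]\<^bsub>H\<^esub> i) [^]\<^bsub>H\<^esub> j \<otimes>\<^bsub>H\<^esub> y [^]\<^bsub>H\<^esub> j"
      using x y by (intro H.pow_mult_distrib) auto
    moreover have "(x [^]\<^bsub>H\<^esub> i) [^]\<^bsub>H\<^esub> j = (x [^]\<^bsub>H\<^esub> j) [^]\<^bsub>H\<^esub> i"
      using x H.nat_pow_pow[of x i j] H.nat_pow_pow[of x j i] by (simp add: mult.commute)
    ultimately show ?thesis by simp
  qed
  have pw: "(x [^]\<^bsub>H\<^esub> j) [^]\<^bsub>H\<^esub> l = \<one>\<^bsub>H\<^esub>" for j :: nat
    using x by (metis H.nat_pow_one H.nat_pow_pow mult.commute)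
  have "finprod V (\<lambda>i. finprod V (\<lambda>j. act ((x [^]\<^bsub>H\<^esub> i \<otimes>\<^bsub>H\<^esub> y) [^]\<^bsub>H\<^esub> j) v) {..<l}) {..<l} = \<one>\<^bsub>V\<^esub>"
  proof (rule V.finprod_one_eqI)
    fix i assume "i \<in> {..<l}"
    then show "finprod V (\<lambda>j. act ((x [^]\<^bsub>H\<^esub> i \<otimes>\<^bsub>H\<^esub> y) [^]\<^bsub>H\<^esub> j) v) {..<l} = \<one>\<^bsub>V\<^esub>"
      using x y l v fxy pw by (intro norm_trivial) (auto simp: xy)
  qed
  then have "finprod V (\<lambda>j. finprod V (\<lambda>i. act ((x [^]\<^bsub>H\<^esub> i \<otimes>\<^bsub>H\<^esub> y) [^]\<^bsub>H\<^esub> j) v) {..<l}) {..<l} = \<one>\<^bsub>V\<^esub>"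
    using x y v by (subst finprod_swap) auto
  moreover have "finprod V (\<lambda>j. finprod V (\<lambda>i. act ((x [^]\<^bsub>H\<^esub> i \<otimes>\<^bsub>H\<^esub> y) [^]\<^bsub>H\<^esub> j) v) {..<l}) {..<l}
     = finprod V (\<lambda>j. if 0 = j then v [^]\<^bsub>V\<^esub> l else \<one>\<^bsub>V\<^esub>) {..<l}"
  proof (intro V.finprod_cong' refl)
    fix j assume j: "j \<in> {..<l}"
    show "finprod V (\<lambda>i. act ((x [^]\<^bsub>H\<^esub> i \<otimes>\<^bsub>H\<^esub> y) [^]\<^bsub>H\<^esub> j) v) {..<l} = (if 0 = j then v [^]\<^bsub>V\<^esub> l else \<one>\<^bsub>V\<^esub>)"
    proof (cases "j = 0")
      case True
      then show ?thesis using v V.finprod_const[OF v, of "{..<l}"] by simp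
    next
      case False
      have "finprod V (\<lambda>i. act ((x [^]\<^bsub>H\<^esub> i \<otimes>\<^bsub>H\<^esub> y) [^]\<^bsub>H\<^esub> j) v) {..<l}
          = finprod V (\<lambda>i. act ((x [^]\<^bsub>H\<^esub> j) [^]\<^bsub>H\<^esub> i) (act (y [^]\<^bsub>H\<^esub> j) v)) {..<l}"
        using x y v by (intro V.finprod_cong') (auto simp: xy act_mult)
      also have "\<dots> = \<one>\<^bsub>V\<^esub>" using False j x y v pw fx l by (intro norm_trivial) auto
      finally show ?thesis using False by simp
    qed
  qed (use v in auto)
  ultimately have "v [^]\<^bsub>V\<^esub> l = \<one>\<^bsub>V\<^esub>"
    using V.finprod_singleton[of 0 "{..<l}" "\<lambda>_. v [^]\<^bsub>V\<^esub> l"] l v by simp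
  then show ?thesis using cop v by blast
qed

end

section \<open>Elements of prime order in finite groups\<close>

locale fin_group = group +
  assumes fin: "finite (carrier G)"
begin

lemma finite_sub: "S \<subseteq> carrier G \<Longrightarrow> finite S"
  using fin finite_subset by blast

lemma finite_subgroup: "subgroup S G \<Longrightarrow> finite S"
  using finite_sub subgroup.subset by blast

lemma cauchy:
  assumes Q: "subgroup Q G" and p: "prime (p::nat)" "p dvd card Q"
  shows "\<exists>x \<in> Q. x \<noteq> \<one> \<and> x [^] p = \<one>"
proof -
  interpret Q: group "G\<lparr>carrier := Q\<rparr>" using Q subgroup_imp_group by blast
  have fQ: "finite Q" using finite_subgroup Q by blast
  obtain m where "order (G\<lparr>carrier := Q\<rparr>) = p ^ 1 * m" using p by (auto simp: order_def)
  then obtain P where P: "subgroup P (G\<lparr>carrier := Q\<rparr>)" "card P = p"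
    using sylow_thm[OF p(1) Q.is_group, of 1 m] fQ by auto
  have PG: "subgroup P G" using P Q incl_subgroup by blast
  have "card P > 1" using P p prime_gt_1_nat by simp
  then have "\<not> P \<subseteq> {\<one>}" using card_mono[of "{\<one>}" P] by auto
  then obtain x where x: "x \<in> P" "x \<noteq> \<one>" by blast
  interpret P: group "G\<lparr>carrier := P\<rparr>" using PG subgroup_imp_group by blast
  have "x [^] card P = \<one>" using P.pow_order_eq_1[of x] x by (simp add: order_def nat_pow_consistent[symmetric])
  moreover have "x \<in> Q" using P x subgroup.subset by fastforce
  ultimately show ?thesis using x P by auto
qed

lemma pow_card_one:
  assumes "subgroup Q G" "x \<in> Q"
  shows "x [^] card Q = \<one>"
proof -
  interpret Q: group "G\<lparr>carrier := Q\<rparr>" using assms(1) subgroup_imp_group by blast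
  show ?thesis using Q.pow_order_eq_1[of x] assms by (simp add: order_def nat_pow_consistent[symmetric])
qed

lemma eq_one_if_coprime_pows:
  assumes "x \<in> carrier G" "x [^] (m::nat) = \<one>" "x [^] (n::nat) = \<one>" "coprime m n"
  shows "x = \<one>"
proof -
  have "ord x dvd m" "ord x dvd n" using assms pow_eq_id by auto
  then have "ord x dvd 1" using assms(4) by (metis coprime_def dvd_refl is_unit_gcd gcd_greatest)
  then show ?thesis using assms ord_eq_1 by (metis nat_dvd_1_iff_1)
qed

lemma prime_power_exists:
  assumes "x \<in> carrier G" "x \<noteq> \<one>"
  shows "\<exists>(p::nat) k::nat. prime p \<and> x [^] k \<noteq> \<one> \<and> (x [^] k) [^] p = \<one>"
proof -
  have "ord x \<noteq> 1" "ord x > 0" using assms ord_eq_1 ord_ge_1[OF fin] by (auto simp: Suc_le_eq)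
  then obtain p where p: "prime p" "p dvd ord x" using prime_factor_nat by blast
  then obtain k where k: "ord x = p * k" by blast
  have "k < ord x" "k > 0" using k \<open>ord x > 0\<close> p prime_gt_1_nat[of p] by auto
  then have "x [^] k \<noteq> \<one>" using assms pow_eq_id by (auto dest: nat_dvd_not_less)
  moreover have "(x [^] k) [^] p = \<one>" using assms k pow_ord_eq_1[of x] by (simp add: nat_pow_pow mult.commute del: pow_ord_eq_1)
  ultimately show ?thesis using p by blast
qed

text \<open>Conjugation by \<open>x\<close> has period \<open>p\<close> on \<open>V\<close> and
  fixes only the identity, so \<open>card V\<close> is 1 modulo \<open>p\<close>.\<close>

lemma cj_act_coprime:
  assumes V: "finite V" "V \<subseteq> carrier G" "\<one> \<in> V" and x: "x \<in> carrier G" "x [^] p = \<one>" "prime (p::nat)"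
    and norm: "\<And>v. v \<in> V \<Longrightarrow> cj x v \<in> V" and free: "\<And>v. v \<in> V \<Longrightarrow> x \<otimes> v = v \<otimes> x \<Longrightarrow> v = \<one>"
  shows "\<not> p dvd card V"
proof (rule unique_fixed_point_coprime[where f = "cj x" and a = \<one>])
  show "(cj x ^^ p) v = v" if "v \<in> V" for v using that V x by (auto simp: cj_funpow)
  show "{v \<in> V. cj x v = v} = {\<one>}" 
  proof (intro equalityI subsetI)
    fix v assume "v \<in> {v \<in> V. cj x v = v}"
    then show "v \<in> {\<one>}" using free[of v] cj_fix_iff[of x v] V x by blast
  qed (use V x in simp)
qed (use V x norm in auto)

text \<open>A common prime divisor would give an element of that order in \<open>Q\<close>, and
  counting would give it a nontrivial fixed point in \<open>V\<close>.\<close>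

lemma fpf_coprime_card:
  assumes Q: "subgroup Q G" and V: "subgroup V G" and norm: "\<And>x v. x \<in> Q \<Longrightarrow> v \<in> V \<Longrightarrow> cj x v \<in> V"
    and fpf: "fpf Q V"
  shows "coprime (card Q) (card V)"
proof (rule ccontr)
  assume "\<not> ?thesis"
  then obtain l where l: "prime l" "l dvd card Q" "l dvd card V"
    by (metis gcd_nat.boundedE coprime_iff_gcd_eq_1 prime_factor_nat)
  then obtain x where x: "x \<in> Q" "x \<noteq> \<one>" "x [^] l = \<one>" using cauchy[OF Q] by blast
  have "\<not> l dvd card V"
    by (rule cj_act_coprime[of V x])
      (use x l Q V norm fpf finite_subgroup in \<open>auto simp: fpf_def subgroup.mem_carrier subgroup.one_closed dest: subgroup.subset\<close>)
  then show False using l by blast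
qed

end

section \<open>Centralisers, a Frattini argument, Frobenius complements\<close>

context group
begin

definition cent :: "'a set \<Rightarrow> 'a set" where
  "cent V = {g \<in> carrier G. \<forall>v \<in> V. g \<otimes> v = v \<otimes> g}"

lemma cent_subgroup: "V \<subseteq> carrier G \<Longrightarrow> subgroup (cent V) G"
proof (rule subgroupI)
  assume V: "V \<subseteq> carrier G"
  show "cent V \<noteq> {}" using V by (auto simp: cent_def intro!: exI[of _ \<one>])
  show "inv a \<in> cent V" if "a \<in> cent V" for a using that V by (auto simp: cent_def intro!: comm_inv)
  show "a \<otimes> b \<in> cent V" if "a \<in> cent V" "b \<in> cent V" for a b
    using that V comm_mult unfolding cent_def by blast
qed (auto simp: cent_def)

lemma cj_cent:
  assumes V: "V \<subseteq> carrier G" and g: "g \<in> carrier G" "\<And>v. v \<in> V \<Longrightarrow> cj (inv g) v \<in> V" and z: "z \<in> cent V"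
  shows "cj g z \<in> cent V"
proof -
  have "cj g z \<otimes> v = v \<otimes> cj g z" if v: "v \<in> V" for v
  proof -
    have "z \<otimes> cj (inv g) v = cj (inv g) v \<otimes> z" using z g v by (auto simp: cent_def)
    moreover have "v \<in> carrier G" "z \<in> carrier G" using V v z by (auto simp: cent_def)
    ultimately have "cj g z \<otimes> cj g (cj (inv g) v) = cj g (cj (inv g) v) \<otimes> cj g z"
      using g(1) by (intro cj_comm_iff[THEN iffD2]) auto
    then show ?thesis using g v V by (simp add: subset_iff)
  qed
  then show ?thesis using g z by (auto simp: cent_def)
qed

lemma cj_normal: "V \<lhd> G \<Longrightarrow> g \<in> carrier G \<Longrightarrow> v \<in> V \<Longrightarrow> cj g v \<in> V"
  by (simp add: cj_def normal_invE(2))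

lemma cent_normal: "V \<lhd> G \<Longrightarrow> cent V \<lhd> G"
proof (rule normal_invI)
  assume V: "V \<lhd> G"
  then have sub: "V \<subseteq> carrier G" by (simp add: normal_imp_subgroup subgroup.subset)
  show "subgroup (cent V) G" using cent_subgroup sub .
  show "x \<otimes> h \<otimes> inv x \<in> cent V" if "x \<in> carrier G" "h \<in> cent V" for x h
    using cj_cent[OF sub that(1) _ that(2)] cj_normal[OF V, of "inv x"] that(1) by (simp flip: cj_def)
qed

lemma cj_linear_action:
  assumes "V \<lhd> G" and ab: "\<And>v w. v \<in> V \<Longrightarrow> w \<in> V \<Longrightarrow> v \<otimes> w = w \<otimes> v"
  shows "linear_action G (G\<lparr>carrier := V\<rparr>) cj"
proof -
  have V: "subgroup V G" using assms normal_imp_subgroup by blast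
  interpret V: group "G\<lparr>carrier := V\<rparr>" using V subgroup_imp_group by blast
  have c: "v \<in> carrier G" if "v \<in> V" for v using that subgroup.mem_carrier[OF V] by simp
  interpret comm_group "G\<lparr>carrier := V\<rparr>" by (rule V.group_comm_groupI) (simp add: ab)
  show ?thesis by unfold_locales (use c cj_normal[OF assms(1)] in \<open>auto simp: cj_mult cj_cj\<close>)
qed

lemma prime_order_generator:
  assumes "x \<in> carrier G" "x [^] p = \<one>" "prime (p::nat)" "x [^] (i::nat) \<noteq> \<one>"
  shows "\<exists>j::nat. (x [^] i) [^] j = x"
proof -
  have "\<not> p dvd i"
  proof
    assume "p dvd i"
    then obtain k where "i = p * k" by blast
    then have "x [^] i = (x [^] p) [^] k" using assms(1) by (simp add: nat_pow_pow)
    then show False using assms by simp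
  qed
  then have "coprime i p" using assms(3) prime_imp_coprime coprime_commute by blast
  moreover have "i \<noteq> 0" using assms by (metis nat_pow_0)
  from bezout_nat[OF this, of p] obtain k m where "i * k = p * m + gcd i p" by blast
  ultimately have km: "i * k = p * m + 1" by simp
  have "(x [^] i) [^] k = x [^] (p * m) \<otimes> x" using assms km by (simp add: nat_pow_pow)
  also have "x [^] (p * m) = \<one>" using assms by (simp flip: nat_pow_pow)
  finally show ?thesis using assms by auto
qed

text \<open>A nontrivial power of an element of prime order generates the same subgroup, so both
  have the same centraliser.\<close>

lemma fpf_pow:
  assumes x: "x \<in> carrier G" "x [^] p = \<one>" "prime (p::nat)" "x [^] (i::nat) \<noteq> \<one>"
    and v: "v \<in> carrier G" "x [^] i \<otimes> v = v \<otimes> x [^] i"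
  shows "x \<otimes> v = v \<otimes> x"
proof -
  obtain j :: nat where "(x [^] i) [^] j = x" using prime_order_generator[OF x] by blast
  then show ?thesis using comm_pow[of "x [^] i" v j] x v by simp
qed

end

context fin_group
begin

text \<open>The map \<open>k |-> [k, s]\<close> is injective on the finite set \<open>F\<close>,
  hence onto. Thus the coset \<open>F s\<close> is a single class under conjugation by
  \<open>F\<close>, which stands in for the conjugacy of complements.\<close>

lemma coset_conjugate:
  assumes F: "subgroup F G" and s: "s \<in> carrier G" "\<And>f. f \<in> F \<Longrightarrow> cj s f \<in> F"
    and free: "\<And>f. f \<in> F \<Longrightarrow> s \<otimes> f = f \<otimes> s \<Longrightarrow> f = \<one>" and f: "f \<in> F"
  shows "\<exists>k \<in> F. f \<otimes> s = cj k s"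
proof -
  define c where "c k = k \<otimes> cj s (inv k)" for k
  have F_carrier: "k \<in> carrier G" if "k \<in> F" for k using that subgroup.mem_carrier[OF F] by simp
  have Fi: "inv k \<in> F" if "k \<in> F" for k using that F subgroup.m_inv_closed by fast
  have Fm: "k \<otimes> l \<in> F" if "k \<in> F" "l \<in> F" for k l using that F subgroup.m_closed by fast
  have "inj_on c F"
  proof (rule inj_onI)
    fix k l assume kl: "k \<in> F" "l \<in> F" "c k = c l"
    have "inv l \<otimes> c k \<otimes> cj s k = inv l \<otimes> k" using kl(1,2) F_carrier s by (simp add: c_def m_assoc flip: cj_mult)
    moreover have "inv l \<otimes> c l \<otimes> cj s k = cj s (inv l \<otimes> k)" using kl(1,2) F_carrier s by (simp add: c_def cj_mult m_assoc)
    ultimately have "cj s (inv l \<otimes> k) = inv l \<otimes> k" using kl(3) by metis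
    then have "inv l \<otimes> k = \<one>" using free[of "inv l \<otimes> k"] kl F_carrier Fi Fm s by (simp add: cj_fix_iff)
    then show "k = l" using kl F_carrier by (metis inv_equality inv_inv inv_closed)
  qed
  moreover have "c ` F \<subseteq> F" using Fi Fm s by (auto simp: c_def)
  ultimately have "c ` F = F" using finite_subgroup[OF F] by (intro endo_inj_surj)
  then obtain k where k: "k \<in> F" "f = c k" using f by blast
  then have "f \<otimes> s = cj k s" using F_carrier s by (simp add: c_def cj_def m_assoc)
  then show ?thesis using k by blast
qed

text \<open>A nontrivial \<open>t^i\<close> has no more fixed points on \<open>F\<close> than
  \<open>t\<close>, so all elements of the coset \<open>F t^i\<close> are conjugates of
  \<open>t^i\<close> under \<open>F\<close>.\<close>

lemma frattini_prime_order:
  assumes N: "subgroup N G" and F: "subgroup F G" "F \<subseteq> N" "\<And>n f. n \<in> N \<Longrightarrow> f \<in> F \<Longrightarrow> cj n f \<in> F"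
    and t: "t \<in> N" "t [^] q = \<one>" "prime (q::nat)" "t \<noteq> \<one>"
    and free: "\<And>f. f \<in> F \<Longrightarrow> t \<otimes> f = f \<otimes> t \<Longrightarrow> f = \<one>"
    and n: "n \<in> N" and conj: "cj n t = f \<otimes> t [^] (i::nat)" "f \<in> F"
  shows "\<exists>k \<in> F. cj n t = cj k (t [^] i) \<and> t [^] i \<noteq> \<one>"
proof -
  have N_carrier: "k \<in> carrier G" if "k \<in> N" for k using that subgroup.mem_carrier[OF N] by simp
  have tn: "t \<notin> F" using free[of t] t(4) by auto
  have ti: "t [^] i \<noteq> \<one>"
  proof
    assume "t [^] i = \<one>"
    then have "cj n t \<in> F" using conj F N_carrier by auto
    then have "cj (inv n) (cj n t) \<in> F" using F(3)[of "inv n"] n N subgroup.m_inv_closed by fast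
    then show False using tn n t N_carrier by simp
  qed
  have "\<exists>k \<in> F. f \<otimes> t [^] i = cj k (t [^] i)"
  proof (rule coset_conjugate[OF F(1)])
    show "g = \<one>" if "g \<in> F" "t [^] i \<otimes> g = g \<otimes> t [^] i" for g
      using fpf_pow[of t q i g] that free t ti N_carrier F(2) by auto
    show "cj (t [^] i) g \<in> F" if "g \<in> F" for g
    proof -
      have "t [^] i \<in> N" using N t(1) by (induction i) (auto simp: subgroup.one_closed subgroup.m_closed)
      then show ?thesis using that F(3) by blast
    qed
  qed (use t N_carrier conj in auto)
  then show ?thesis using ti conj by auto
qed

lemma set_conj_eq: "g \<in> carrier G \<Longrightarrow> H \<subseteq> carrier G \<Longrightarrow> g <# (H #> inv g) = cj g ` H"
  by (auto simp: l_coset_def r_coset_def cj_def m_assoc subset_iff image_iff) 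

text \<open>Replaces translates in the restricted group by malnormality expressed with
  \<open>cj\<close> in the ambient group, the form in which the definition is used below.\<close>

lemma frobenius_with_iff:
  assumes S: "subgroup S G"
  shows "frobenius_with (G\<lparr>carrier := S\<rparr>) K H \<longleftrightarrow>
    subgroup H G \<and> H \<subseteq> S \<and> H \<noteq> {\<one>} \<and> H \<noteq> S \<and> (\<forall>g \<in> S. \<forall>h \<in> H. h \<noteq> \<one> \<longrightarrow> cj g h \<in> H \<longrightarrow> g \<in> H) \<and>
    K = (S - (\<Union>g \<in> S. cj g ` H)) \<union> {\<one>}"
proof (cases "subgroup H G \<and> H \<subseteq> S")
  case False
  have "\<not> subgroup H (G\<lparr>carrier := S\<rparr>)"
  proof
    assume H: "subgroup H (G\<lparr>carrier := S\<rparr>)"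
    then have "H \<subseteq> S" using subgroup.subset by fastforce
    then show False using False incl_subgroup[OF S H] by blast
  qed
  then show ?thesis using False by (auto simp: frobenius_with_def)
next
  case True
  have HS: "subgroup H (G\<lparr>carrier := S\<rparr>)" using True S subgroup_incl by blast
  have H_carrier: "H \<subseteq> carrier G" using True subgroup.subset by blast
  have eq: "g <#\<^bsub>G\<lparr>carrier := S\<rparr>\<^esub> (H #>\<^bsub>G\<lparr>carrier := S\<rparr>\<^esub> inv\<^bsub>G\<lparr>carrier := S\<rparr>\<^esub> g) = cj g ` H" if "g \<in> S" for g
    using that S H_carrier set_conj_eq subgroup.mem_carrier[OF S] by simp
  have one: "\<one> \<in> H \<inter> cj g ` H" if "g \<in> S" for g
    using True subgroup.one_closed[of H G] subgroup.mem_carrier[OF S] that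
    by (auto intro!: image_eqI[of _ _ \<one>])
  have mal: "(H \<inter> cj g ` H = {\<one>}) \<longleftrightarrow> (\<forall>h \<in> H. h \<noteq> \<one> \<longrightarrow> cj g h \<notin> H)" if "g \<in> S" for g
  proof -
    have "cj g h = \<one> \<longleftrightarrow> h = \<one>" if "h \<in> H" for h
      using that \<open>g \<in> S\<close> subgroup.mem_carrier[OF S] H_carrier by auto
    then show ?thesis using one[OF that] by blast
  qed
  show ?thesis unfolding frobenius_with_def
    using HS True eq mal by (simp cong: SUP_cong_simp) blast
qed

text \<open>If \<open>k\<close> conjugates a nontrivial element of \<open>H\<close> into
  \<open>H\<close>, the commutator lies in both \<open>K\<close> and \<open>H\<close>, so it is
  trivial and \<open>k\<close> is a fixed point. The kernel, defined as what the conjugates of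
  \<open>H\<close> leave over, is \<open>K\<close> because every \<open>k h\<close> with nontrivial
  \<open>h\<close> is conjugate to \<open>h\<close>.\<close>

lemma frobenius_with_complement:
  assumes K: "subgroup K G" and H: "subgroup H G" and norm: "\<And>h k. h \<in> H \<Longrightarrow> k \<in> K \<Longrightarrow> cj h k \<in> K"
    and triv: "K \<inter> H = {\<one>}" and non: "K \<noteq> {\<one>}" "H \<noteq> {\<one>}" and fpf: "fpf H K" and S: "subgroup (K <#> H) G"
  shows "frobenius_with (G\<lparr>carrier := K <#> H\<rparr>) K H"
proof -
  have Kc: "k \<in> carrier G" if "k \<in> K" for k using that subgroup.mem_carrier[OF K] by simp
  have H_carrier: "k \<in> carrier G" if "k \<in> H" for k using that subgroup.mem_carrier[OF H] by simp
  have S_carrier: "k \<in> carrier G" if "k \<in> K <#> H" for k using that subgroup.mem_carrier[OF S] by simp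
  have K1: "\<one> \<in> K" "\<one> \<in> H" using K H subgroup.one_closed by auto
  have Ki: "inv k \<in> K" if "k \<in> K" for k using that K subgroup.m_inv_closed by fast
  have Hi: "inv k \<in> H" if "k \<in> H" for k using that H subgroup.m_inv_closed by fast
  have Km: "k \<otimes> l \<in> K" if "k \<in> K" "l \<in> K" for k l using that K subgroup.m_closed by fast
  have Hm: "k \<otimes> l \<in> H" if "k \<in> H" "l \<in> H" for k l using that H subgroup.m_closed by fast
  have SI: "k \<otimes> h \<in> K <#> H" if "k \<in> K" "h \<in> H" for k h using that by (auto simp: set_mult_def)
  have HS: "H \<subseteq> K <#> H" using SI[OF K1(1)] H_carrier by auto
  have KS: "K \<subseteq> K <#> H" using SI[OF _ K1(2)] Kc by auto
  have "H \<noteq> K <#> H" using KS non triv by auto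
  moreover have mal: "g \<in> H" if g: "g \<in> K <#> H" and h: "h \<in> H" "h \<noteq> \<one>" "cj g h \<in> H" for g h
  proof -
    obtain k h0 where kh: "k \<in> K" "h0 \<in> H" "g = k \<otimes> h0" using g by (auto simp: set_mult_def)
    let ?h = "cj h0 h"
    have h': "?h \<in> H" "?h \<noteq> \<one>" using h kh H_carrier Hm Hi by (simp_all add: cj_def[of h0 h]) (simp flip: cj_def)
    have "cj g h = cj k ?h" using kh Kc H_carrier h by (simp add: cj_cj)
    also have "\<dots> = (k \<otimes> cj ?h (inv k)) \<otimes> ?h" using kh Kc H_carrier[OF h'(1)] by (simp add: cj_def m_assoc)
    finally have "k \<otimes> cj ?h (inv k) = cj g h \<otimes> inv ?h"
      using kh Kc H_carrier h' h by (metis S_carrier cj_closed g inv_closed inv_solve_right m_closed)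
    then have "k \<otimes> cj ?h (inv k) \<in> H" using h h' Hm Hi by (simp only:)
    moreover have "k \<otimes> cj ?h (inv k) \<in> K" using h' kh Km Ki norm by (simp only:)
    ultimately have "k \<otimes> cj ?h (inv k) = \<one>" using triv by blast
    then have "cj ?h k = k" using kh Kc H_carrier[OF h'(1)] cj_inv by (metis cj_closed inv_closed inv_equality inv_inv)
    then have "k = \<one>" using fpfD[OF fpf h'(1) kh(1) h'(2)] cj_fix_iff Kc[OF kh(1)] H_carrier[OF h'(1)] by blast
    then show ?thesis using kh H_carrier by simp
  qed
  moreover have "K = ((K <#> H) - (\<Union>g \<in> K <#> H. cj g ` H)) \<union> {\<one>}"
  proof (intro equalityI subsetI)
    fix k assume k: "k \<in> K"
    have "k = \<one>" if gh: "g \<in> K <#> H" "h \<in> H" "k = cj g h" for g h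
    proof -
      obtain k0 h0 where kh: "k0 \<in> K" "h0 \<in> H" "g = k0 \<otimes> h0" using gh by (auto simp: set_mult_def)
      have "cj h0 h = cj (inv k0) k" using kh gh Kc H_carrier by (simp add: cj_cj m_assoc)
      moreover have "cj (inv k0) k \<in> K" using kh k Km Ki by (simp add: cj_def)
      moreover have "cj h0 h \<in> H" using kh gh Hm Hi by (simp add: cj_def)
      ultimately have "cj h0 h = \<one>" using triv by auto
      then have "h = \<one>" using kh gh H_carrier by simp
      then show ?thesis using gh S_carrier by simp
    qed
    then have "k \<notin> (\<Union>g \<in> K <#> H. cj g ` H) \<or> k = \<one>" unfolding UN_iff image_iff by metis
    moreover have "k \<in> K <#> H" using k KS by blast
    ultimately show "k \<in> ((K <#> H) - (\<Union>g \<in> K <#> H. cj g ` H)) \<union> {\<one>}" by blast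
  next
    fix g assume g: "g \<in> ((K <#> H) - (\<Union>g \<in> K <#> H. cj g ` H)) \<union> {\<one>}"
    show "g \<in> K"
    proof (cases "g = \<one>")
      case False
      then obtain k h where kh: "k \<in> K" "h \<in> H" "g = k \<otimes> h" using g by (auto simp: set_mult_def)
      have "h = \<one>"
      proof (rule ccontr)
        assume "h \<noteq> \<one>"
        then have "\<exists>l \<in> K. k \<otimes> h = cj l h"
          using coset_conjugate[OF K, of h k] kh H_carrier norm fpfD[OF fpf] by blast
        then show False using g kh KS False by auto
      qed
      then show ?thesis using kh Kc by simp
    qed (use K1 in simp)
  qed
  ultimately show ?thesis unfolding frobenius_with_iff[OF S] using H HS non by blast
qed

end

section \<open>Coprime action on a section\<close>

context group
begin

lemma coset_eq_iff:
  assumes "subgroup F G" "a \<in> carrier G" "b \<in> carrier G"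
  shows "F #> a = F #> b \<longleftrightarrow> a \<otimes> inv b \<in> F"
proof
  assume "F #> a = F #> b"
  then have "a \<in> F #> b" using rcos_self[OF assms(2,1)] by simp
  then obtain f where "f \<in> F" "a = f \<otimes> b" by (auto simp: r_coset_def)
  moreover have "f \<in> carrier G" using subgroup.mem_carrier[OF assms(1)] \<open>f \<in> F\<close> .
  ultimately show "a \<otimes> inv b \<in> F" using assms by (simp add: m_assoc)
next
  assume "a \<otimes> inv b \<in> F"
  then have "a \<in> F #> b" using assms by (auto simp: r_coset_def m_assoc intro!: bexI[of _ "a \<otimes> inv b"])
  then show "F #> a = F #> b" using repr_independence[of a F b] assms by simp
qed

lemma pow_closed_subgroup: "subgroup S G \<Longrightarrow> x \<in> S \<Longrightarrow> x [^] (n::nat) \<in> S"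
  by (induction n) (auto simp: subgroup.one_closed subgroup.m_closed)

lemma cj_closed_subgroup: "subgroup S G \<Longrightarrow> x \<in> S \<Longrightarrow> y \<in> S \<Longrightarrow> cj x y \<in> S"
  by (simp add: cj_def subgroup.m_closed subgroup.m_inv_closed)

lemma inv_eq_pow:
  assumes "x \<in> carrier G" "x [^] l = \<one>" "(l::nat) > 0"
  shows "inv x = x [^] (l - 1)"
proof -
  have "x [^] (l - 1) \<otimes> x = \<one>" using assms by (metis Suc_diff_1 nat_pow_Suc)
  then show ?thesis using assms inv_equality by simp
qed

end

context fin_group
begin

lemma prime_order:
  assumes "x \<in> carrier G" "x [^] l = \<one>" "prime (l::nat)" "x \<noteq> \<one>"
  shows "ord x = l"
proof -
  have "ord x dvd l" using assms pow_eq_id by simp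
  moreover have "ord x \<noteq> 1" using assms ord_eq_1 by blast
  ultimately show ?thesis using assms(3) prime_nat_iff by blast
qed

lemma coprime_pow_cancel:
  assumes V: "subgroup V G" and w: "w \<in> V" "w [^] n = \<one>" and c: "coprime n (card V)"
  shows "w = \<one>"
  using eq_one_if_coprime_pows[OF _ w(2) pow_card_one[OF V w(1)] c] subgroup.mem_carrier[OF V w(1)] by simp

context
  fixes V
  assumes V: "V \<lhd> G" and ab: "\<And>v w. v \<in> V \<Longrightarrow> w \<in> V \<Longrightarrow> v \<otimes> w = w \<otimes> v" and V1: "V \<noteq> {\<one>}"
begin

lemma V_subgroup: "subgroup V G"
  using V normal_imp_subgroup by blast

lemma V_carrier: "v \<in> V \<Longrightarrow> v \<in> carrier G"
  using subgroup.mem_carrier[OF V_subgroup] .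

text \<open>\<open>[e, x]\<close> acts trivially on \<open>V\<close> by the norm argument, yet lies
  in \<open>Q\<close>, whose nontrivial elements fix nothing in \<open>V\<close> but the
  identity.\<close>

lemma commutes_if_fixed_point_free:
  assumes Q: "subgroup Q G" "\<And>d e. d \<in> Q \<Longrightarrow> e \<in> Q \<Longrightarrow> d \<otimes> e = e \<otimes> d" "fpf Q V"
    and x: "x \<in> carrier G" "x [^] p = \<one>" "prime (p::nat)" "\<And>v. v \<in> V \<Longrightarrow> x \<otimes> v = v \<otimes> x \<Longrightarrow> v = \<one>"
    and norm: "\<And>e. e \<in> Q \<Longrightarrow> cj x e \<in> Q" and e: "e \<in> Q"
  shows "x \<otimes> e = e \<otimes> x"
proof -
  interpret L: linear_action G "G\<lparr>carrier := V\<rparr>" cj using cj_linear_action[OF V ab] .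
  have Qc: "z \<in> carrier G" if "z \<in> Q" for z using subgroup.mem_carrier[OF Q(1) that] .
  have cop: "coprime (card Q) (card V)"
    using fpf_coprime_card[OF Q(1) V_subgroup _ Q(3)] cj_normal[OF V] Qc by blast
  let ?z = "e \<otimes> cj x (inv e)"
  have z: "?z \<in> Q" using e norm Q(1) by (simp add: subgroup.m_closed subgroup.m_inv_closed)
  have "cj ?z v = v" if "v \<in> V" for v
  proof (rule L.coprime_commutator_acts_trivially[OF Q(1) finite_subgroup[OF Q(1)] Q(2) _ x(1-3) _ norm e])
    show "w = \<one>\<^bsub>G\<lparr>carrier := V\<rparr>\<^esub>" if "w \<in> carrier (G\<lparr>carrier := V\<rparr>)" "w [^]\<^bsub>G\<lparr>carrier := V\<rparr>\<^esub> card Q = \<one>\<^bsub>G\<lparr>carrier := V\<rparr>\<^esub>" for w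
      using coprime_pow_cancel[OF V_subgroup _ _ cop] that by (simp flip: nat_pow_consistent)
    show "L.fixfree x" unfolding L.fixfree_def using x(1,4) cj_fix_iff V_carrier by simp
  qed (use that in auto)
  moreover obtain v where v: "v \<in> V" "v \<noteq> \<one>" using V1 subgroup.one_closed[OF V_subgroup] by blast
  ultimately have "?z = \<one>"
    using fpfD[OF Q(3) z, of v] cj_fix_iff[OF Qc[OF z] V_carrier] by blast
  then have "cj x e = e" using Qc[OF e] x(1) cj_inv by (metis cj_closed inv_closed inv_equality inv_inv)
  then show ?thesis using cj_fix_iff Qc[OF e] x(1) by blast
qed

text \<open>Otherwise \<open>x\<close> and \<open>y\<close> span a group of rank two that acts on
  \<open>V\<close> without fixed points, while \<open>l\<close> is prime to \<open>card V\<close>;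
  this forces \<open>V\<close> to be trivial.\<close>

lemma power_if_fpf:
  assumes S: "subgroup S G" "fpf S V" and xy: "x \<in> S" "y \<in> S" "x \<otimes> y = y \<otimes> x"
    and l: "x [^] l = \<one>" "y [^] l = \<one>" "prime (l::nat)" "x \<noteq> \<one>"
  shows "\<exists>i::nat. y = x [^] i"
proof (rule ccontr)
  assume none: "\<not> ?thesis"
  interpret L: linear_action G "G\<lparr>carrier := V\<rparr>" cj using cj_linear_action[OF V ab] .
  have S_carrier: "z \<in> carrier G" if "z \<in> S" for z using subgroup.mem_carrier[OF S(1) that] .
  have l0: "l > 0" using l(3) prime_gt_0_nat by blast
  have "\<not> l dvd card V"
  proof (rule cj_act_coprime[where x = x])
    show "v = \<one>" if "v \<in> V" "x \<otimes> v = v \<otimes> x" for v using fpfD[OF S(2) xy(1) that(1) l(4) that(2)] .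
  qed (use finite_subgroup[OF V_subgroup] V_carrier xy S_carrier l cj_normal[OF V] subgroup.one_closed[OF V_subgroup] in auto)
  then have cop: "coprime l (card V)" using l(3) prime_imp_coprime by blast
  have ff: "L.fixfree z" if "z \<in> S" "z \<noteq> \<one>" for z
    unfolding L.fixfree_def using fpfD[OF S(2) that(1) _ that(2)] cj_fix_iff[OF S_carrier[OF that(1)] V_carrier] by simp
  obtain v where v: "v \<in> V" "v \<noteq> \<one>" using V1 subgroup.one_closed[OF V_subgroup] by blast
  have "v = \<one>\<^bsub>G\<lparr>carrier := V\<rparr>\<^esub>"
  proof (rule L.trivial_module_if_rank_two_fixfree[of x l y])
    show "w = \<one>\<^bsub>G\<lparr>carrier := V\<rparr>\<^esub>" if "w \<in> carrier (G\<lparr>carrier := V\<rparr>)" "w [^]\<^bsub>G\<lparr>carrier := V\<rparr>\<^esub> l = \<one>\<^bsub>G\<lparr>carrier := V\<rparr>\<^esub>" for w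
      using coprime_pow_cancel[OF V_subgroup _ _ cop] that by (simp flip: nat_pow_consistent)
    show "L.fixfree (x [^] j)" if "0 < j" "j < l" for j :: nat
    proof (rule ff)
      show "x [^] j \<noteq> \<one>" using that pow_eq_id[OF S_carrier[OF xy(1)]] prime_order[OF S_carrier[OF xy(1)] l(1,3,4)] by (auto dest: nat_dvd_not_less)
    qed (use pow_closed_subgroup S xy in blast)
    show "L.fixfree (x [^] i \<otimes> y)" if "i < l" for i :: nat
    proof (rule ff)
      show "x [^] i \<otimes> y \<noteq> \<one>"
      proof
        assume "x [^] i \<otimes> y = \<one>"
        then have "y = inv (x [^] i)" using S_carrier xy by (metis inv_equality inv_inv nat_pow_closed)
        also have "\<dots> = (x [^] i) [^] (l - 1)"
        proof (rule inv_eq_pow)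
          show "(x [^] i) [^] l = \<one>" using S_carrier[OF xy(1)] l(1) by (metis nat_pow_one nat_pow_pow mult.commute)
        qed (use S_carrier xy l0 in auto)
        also have "\<dots> = x [^] (i * (l - 1))" using S_carrier xy by (simp add: nat_pow_pow)
        finally show False using none by blast
      qed
      show "x [^] i \<otimes> y \<in> S" using pow_closed_subgroup[OF S(1) xy(1)] xy S subgroup.m_closed by metis
    qed
  qed (use xy S_carrier l l0 v in auto)
  then show False using v by simp
qed

text \<open>\<open>F\<close> centralises \<open>V\<close>, so the quotient by \<open>F\<close> still
  acts on \<open>V\<close>, and there the image of \<open>E\<close> is abelian: the norm argument
  applies to the quotient.\<close>

lemma section_commutator_trivial:
  assumes F: "F \<lhd> G" "F \<subseteq> cent V"
    and E: "subgroup E G" "F \<subseteq> E" "\<And>d e. d \<in> E \<Longrightarrow> e \<in> E \<Longrightarrow> d \<otimes> e \<otimes> inv (e \<otimes> d) \<in> F"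
    and q: "prime (q::nat)" "\<And>e. e \<in> E \<Longrightarrow> e [^] q \<in> F" "\<not> q dvd card V"
    and x: "x \<in> carrier G" "x [^] p = \<one>" "prime (p::nat)" "\<And>v. v \<in> V \<Longrightarrow> x \<otimes> v = v \<otimes> x \<Longrightarrow> v = \<one>"
    and norm: "\<And>e. e \<in> E \<Longrightarrow> cj x e \<in> E" and e: "e \<in> E"
  shows "e \<otimes> cj x (inv e) \<in> cent V"
proof -
  interpret N: normal F G using F(1) .
  interpret Q: fin_group "G Mod F"
  proof (intro fin_group.intro fin_group_axioms.intro N.factorgroup_is_group)
    show "finite (carrier (G Mod F))" using fin by (simp add: carrier_FactGroup)
  qed
  interpret pi: group_hom G "G Mod F" "\<lambda>a. F #> a"
    by unfold_locales (rule N.r_coset_hom_Mod)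
  have Fs: "subgroup F G" by (rule N.subgroup_axioms)
  have Ec: "z \<in> carrier G" if "z \<in> E" for z using subgroup.mem_carrier[OF E(1) that] .
  \<comment> \<open>Any representative of the coset will do, since two of them differ by an element
    of \<open>F\<close>.\<close>
  define act where "act C v = cj (SOME c. c \<in> C) v" for C v
  have act: "act (F #> g) v = cj g v" if g: "g \<in> carrier G" and v: "v \<in> V" for g v
  proof -
    have "(SOME c. c \<in> F #> g) \<in> F #> g" using rcos_self[OF g Fs] by (rule someI)
    then obtain f where f: "f \<in> F" "(SOME c. c \<in> F #> g) = f \<otimes> g" by (auto simp: r_coset_def)
    then have "f \<in> cent V" using F(2) by blast
    then have "cj f (cj g v) = cj g v"
      using cj_fix_iff[of f "cj g v"] g v V_carrier cj_normal[OF V g v] by (simp add: cent_def)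
    then show ?thesis using f g v V_carrier by (simp add: act_def cj_cj)
  qed
  interpret V: comm_group "G\<lparr>carrier := V\<rparr>"
    using cj_linear_action[OF V ab] linear_action.axioms(2) by blast
  interpret L: linear_action "G Mod F" "G\<lparr>carrier := V\<rparr>" act
  proof
    fix h v assume "h \<in> carrier (G Mod F)" "v \<in> carrier (G\<lparr>carrier := V\<rparr>)"
    then show "act h v \<in> carrier (G\<lparr>carrier := V\<rparr>)" using cj_normal[OF V] by (auto simp: carrier_FactGroup act)
  next
    fix h v w assume "h \<in> carrier (G Mod F)" "v \<in> carrier (G\<lparr>carrier := V\<rparr>)" "w \<in> carrier (G\<lparr>carrier := V\<rparr>)"
    then show "act h (v \<otimes>\<^bsub>G\<lparr>carrier := V\<rparr>\<^esub> w) = act h v \<otimes>\<^bsub>G\<lparr>carrier := V\<rparr>\<^esub> act h w"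
      using V_carrier subgroup.m_closed[OF V_subgroup] by (auto simp: carrier_FactGroup act cj_mult)
  next
    fix h k v assume "h \<in> carrier (G Mod F)" "k \<in> carrier (G Mod F)" "v \<in> carrier (G\<lparr>carrier := V\<rparr>)"
    then obtain g g' where g: "g \<in> carrier G" "g' \<in> carrier G" "h = F #> g" "k = F #> g'" "v \<in> V" by (auto simp: carrier_FactGroup)
    have "h \<otimes>\<^bsub>G Mod F\<^esub> k = F #> (g \<otimes> g')" using g pi.hom_mult[OF g(1,2)] by (simp only:)
    then have "act (h \<otimes>\<^bsub>G Mod F\<^esub> k) v = cj g (cj g' v)" using g V_carrier by (simp only: act m_closed cj_cj)
    also have "\<dots> = act h (act k v)" using g by (simp only: act cj_normal[OF V])
    finally show "act (h \<otimes>\<^bsub>G Mod F\<^esub> k) v = act h (act k v)" .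
  next
    fix v assume "v \<in> carrier (G\<lparr>carrier := V\<rparr>)"
    then show "act \<one>\<^bsub>G Mod F\<^esub> v = v" using act[of \<one> v] V_carrier N.subset by simp
  qed
  let ?E = "(\<lambda>a. F #> a) ` E"
  have Es: "subgroup ?E (G Mod F)" using pi.subgroup_img_is_subgroup[OF E(1)] .
  \<comment> \<open>Each element of \<open>E/F\<close> has order dividing \<open>q\<close>, so no
    other prime divides the order of \<open>E/F\<close>.\<close>
  have cop: "coprime (card ?E) (card V)"
  proof (rule ccontr)
    assume "\<not> ?thesis"
    then have "gcd (card ?E) (card V) \<noteq> 1" by (simp add: coprime_iff_gcd_eq_1)
    then obtain l where "prime l" "l dvd gcd (card ?E) (card V)" using prime_factor_nat by blast
    then have l: "prime l" "l dvd card ?E" "l dvd card V" by auto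
    then obtain C where C: "C \<in> ?E" "C \<noteq> \<one>\<^bsub>G Mod F\<^esub>" "C [^]\<^bsub>G Mod F\<^esub> l = \<one>\<^bsub>G Mod F\<^esub>"
      using Q.cauchy[OF Es] by blast
    then obtain d where d: "d \<in> E" "C = F #> d" by blast
    then have "C [^]\<^bsub>G Mod F\<^esub> q = \<one>\<^bsub>G Mod F\<^esub>"
      using N.FactGroup_pow[of d q] Ec q(2)[of d] coset_join2[OF _ Fs] by simp
    moreover have "coprime q l" using q l by (metis primes_coprime)
    moreover have "C \<in> carrier (G Mod F)" using C(1) Es subgroup.mem_carrier by metis
    ultimately show False using Q.eq_one_if_coprime_pows[of C q l] C by blast
  qed
  have pix: "Q.cj (F #> x) (F #> d) = F #> cj x d" if "d \<in> E" for d
    using x(1) Ec[OF that] unfolding Q.cj_def cj_def by (metis inv_closed m_closed pi.hom_inv pi.hom_mult)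
  let ?z = "e \<otimes> cj x (inv e)"
  have z: "?z \<in> carrier G" using Ec[OF e] x by simp
  have ei: "inv e \<in> E" using e E(1) subgroup.m_inv_closed by metis
  have zz: "(F #> e) \<otimes>\<^bsub>G Mod F\<^esub> Q.cj (F #> x) (inv\<^bsub>G Mod F\<^esub> (F #> e)) = F #> ?z"
    using pix[OF ei] Ec[OF e] x(1) by (metis inv_closed cj_closed pi.hom_inv pi.hom_mult)
  have "cj ?z v = v" if v: "v \<in> V" for v
  proof -
    have "act ((F #> e) \<otimes>\<^bsub>G Mod F\<^esub> Q.cj (F #> x) (inv\<^bsub>G Mod F\<^esub> (F #> e))) v = v"
    proof (rule L.coprime_commutator_acts_trivially[OF Es, of "F #> x" p])
      show "a \<otimes>\<^bsub>G Mod F\<^esub> b = b \<otimes>\<^bsub>G Mod F\<^esub> a" if ab: "a \<in> ?E" "b \<in> ?E" for a b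
      proof -
        obtain c d where "c \<in> E" "a = F #> c" "d \<in> E" "b = F #> d" using ab by blast
        then show ?thesis using E(3)[of c d] coset_eq_iff[OF Fs, of "c \<otimes> d" "d \<otimes> c"] Ec
          by (metis m_closed pi.hom_mult)
      qed
      show "w = \<one>\<^bsub>G\<lparr>carrier := V\<rparr>\<^esub>" if "w \<in> carrier (G\<lparr>carrier := V\<rparr>)" "w [^]\<^bsub>G\<lparr>carrier := V\<rparr>\<^esub> card ?E = \<one>\<^bsub>G\<lparr>carrier := V\<rparr>\<^esub>" for w
        using coprime_pow_cancel[OF V_subgroup _ _ cop] that by (simp flip: nat_pow_consistent)
      show "L.fixfree (F #> x)" unfolding L.fixfree_def using x(1,4) cj_fix_iff V_carrier by (simp add: act)
      show "Q.cj (F #> x) d \<in> ?E" if "d \<in> ?E" for d using that pix norm by auto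
      show "(F #> x) [^]\<^bsub>G Mod F\<^esub> p = \<one>\<^bsub>G Mod F\<^esub>"
        using N.FactGroup_pow[OF x(1), of p] x(2) N.subset by simp
    qed (use x e v E(1) finite_subgroup in auto)
    then show ?thesis using zz act[OF z v] by simp
  qed
  then show ?thesis using z cj_fix_iff[OF z V_carrier] by (auto simp: cent_def)
qed

text \<open>The centraliser of \<open>x\<close> in \<open>E\<close> meets \<open>cent V\<close>
  trivially and hits every coset of it, so it is a copy of the section. It is abelian of exponent
  \<open>q\<close> and acts on \<open>V\<close> without fixed points, so rank two is
  impossible.\<close>

lemma cyclic_section:
  assumes E: "subgroup E G" "cent V \<subseteq> E" "E \<noteq> cent V"
      "\<And>d e. d \<in> E \<Longrightarrow> e \<in> E \<Longrightarrow> d \<otimes> e \<otimes> inv (e \<otimes> d) \<in> cent V"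
    and q: "prime (q::nat)" "\<And>e. e \<in> E \<Longrightarrow> e [^] q \<in> cent V" "\<not> q dvd card V"
    and x: "x \<in> carrier G" "x [^] p = \<one>" "prime (p::nat)" "\<And>f. f \<in> cent V \<Longrightarrow> x \<otimes> f = f \<otimes> x \<Longrightarrow> f = \<one>"
    and norm: "\<And>e. e \<in> E \<Longrightarrow> cj x e \<in> E"
    and free: "fpf {z \<in> E. z \<otimes> x = x \<otimes> z} (cent V)"
  obtains t where "t \<in> E" "t \<notin> cent V" "t [^] q = \<one>" "t \<otimes> x = x \<otimes> t"
    "\<And>z. z \<in> E \<Longrightarrow> z \<otimes> x = x \<otimes> z \<Longrightarrow> \<exists>i::nat. z = t [^] i"
    "\<And>e. e \<in> E \<Longrightarrow> \<exists>f \<in> cent V. \<exists>i::nat. e = f \<otimes> t [^] i"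
proof -
  let ?F = "cent V"
  have Fn: "?F \<lhd> G" using cent_normal[OF V] .
  have Fs: "subgroup ?F G" using Fn normal_imp_subgroup by blast
  have F_carrier: "f \<in> carrier G" if "f \<in> ?F" for f using subgroup.mem_carrier[OF Fs that] .
  have VF: "V \<subseteq> ?F" using ab V_carrier by (auto simp: cent_def)
  have Ec: "z \<in> carrier G" if "z \<in> E" for z using subgroup.mem_carrier[OF E(1) that] .
  define C where "C = {z \<in> E. z \<otimes> x = x \<otimes> z}"
  have Cs: "subgroup C G"
  proof (rule subgroupI)
    show "inv a \<in> C" if "a \<in> C" for a using that E(1) Ec x(1) comm_inv by (auto simp: C_def subgroup.m_inv_closed)
    show "a \<otimes> b \<in> C" if "a \<in> C" "b \<in> C" for a b
      using that E(1) Ec x(1) comm_mult[of a b x] by (auto simp: C_def subgroup.m_closed)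
    show "C \<noteq> {}" using subgroup.one_closed[OF E(1)] x by (auto simp: C_def intro!: exI[of _ \<one>])
  qed (auto simp: C_def Ec)
  have CF: "z = \<one>" if "z \<in> C" "z \<in> ?F" for z using x(4)[of z] that by (auto simp: C_def)
  have pF: "\<not> p dvd card ?F"
  proof (rule cj_act_coprime[where x = x])
    show "f = \<one>" if "f \<in> ?F" "x \<otimes> f = f \<otimes> x" for f using x(4) that .
    show "cj x f \<in> ?F" if "f \<in> ?F" for f using cj_normal[OF Fn x(1) that] .
  qed (use finite_subgroup[OF Fs] F_carrier x(1-3) subgroup.one_closed[OF Fs] in auto)
  have lift: "\<exists>f \<in> ?F. \<exists>z \<in> C. e = f \<otimes> z" if e: "e \<in> E" for e
  proof -
    have u: "e \<otimes> cj x (inv e) \<in> ?F"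
      using section_commutator_trivial[OF Fn order_refl E(1,2,4) q x(1-3) _ norm e] x(4) VF by blast
    have ex: "cj x e = inv (e \<otimes> cj x (inv e)) \<otimes> e"
      using Ec[OF e] x(1) by (simp add: inv_mult_group m_assoc flip: cj_inv)
    \<comment> \<open>Conjugation by \<open>x\<close> permutes the coset of \<open>e\<close>,
      because \<open>[e, x]\<close> lies in \<open>?F\<close>. The coset has \<open>card ?F\<close>
      elements, a number not divisible by \<open>p\<close>, so one of them commutes with
      \<open>x\<close>.\<close>
    let ?S = "(\<lambda>f. f \<otimes> e) ` ?F"
    have "\<exists>s \<in> ?S. cj x s = s"
    proof (rule exists_fixed_point)
      have "inj_on (\<lambda>f. f \<otimes> e) ?F" using F_carrier Ec[OF e] by (auto simp: inj_on_def)
      then show "\<not> p dvd card ?S" using pF by (simp add: card_image)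
      show "cj x ` ?S \<subseteq> ?S"
      proof clarify
        fix f assume f: "f \<in> ?F"
        let ?g = "cj x f \<otimes> inv (e \<otimes> cj x (inv e))"
        have "?g \<in> ?F" using f u cj_normal[OF Fn x(1)] Fs by (simp add: subgroup.m_closed subgroup.m_inv_closed)
        moreover have "cj x (f \<otimes> e) = ?g \<otimes> e"
          using ex x(1) F_carrier[OF f] Ec[OF e] by (simp add: cj_mult m_assoc)
        ultimately show "cj x (f \<otimes> e) \<in> ?S" by blast
      qed
      show "(cj x ^^ p) s = s" if "s \<in> ?S" for s using that F_carrier Ec[OF e] x by (auto simp: cj_funpow)
    qed (use x finite_subgroup[OF Fs] in auto)
    then obtain f where f: "f \<in> ?F" "cj x (f \<otimes> e) = f \<otimes> e" by blast
    have "f \<otimes> e \<in> E" using f E e by (auto intro: subgroup.m_closed)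
    then have "f \<otimes> e \<in> C" using f(2) cj_fix_iff[of x "f \<otimes> e"] x Ec by (auto simp: C_def)
    moreover have "e = inv f \<otimes> (f \<otimes> e)" using F_carrier[OF f(1)] Ec[OF e] by simp
    ultimately show ?thesis using f(1) Fs subgroup.m_inv_closed by metis
  qed
  obtain e where e: "e \<in> E" "e \<notin> ?F" using E by blast
  obtain f t where ft: "f \<in> ?F" "t \<in> C" "e = f \<otimes> t" using lift[OF e(1)] by blast
  have tF: "t \<notin> ?F" using ft e Fs subgroup.m_closed by metis
  \<comment> \<open>The \<open>q\<close>-th power lies in \<open>?F\<close> and commutes with
    \<open>x\<close>, so it is trivial. Commutators of elements of \<open>C\<close> are removed in
    the same way below.\<close>
  have Cq: "z [^] q = \<one>" if "z \<in> C" for z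
    using CF[of "z [^] q"] pow_closed_subgroup[OF Cs that] q(2)[of z] that by (simp add: C_def)
  have gen: "\<exists>i::nat. z = t [^] i" if z: "z \<in> C" for z
  proof (rule power_if_fpf[OF Cs _ ft(2) z _ Cq Cq q(1)])
    show "fpf C V" using free fpf_mono[OF _ _ VF] unfolding C_def by blast
    have "t \<otimes> z \<otimes> inv (z \<otimes> t) \<in> C" using ft z Cs by (simp add: subgroup.m_closed subgroup.m_inv_closed)
    moreover have "t \<otimes> z \<otimes> inv (z \<otimes> t) \<in> ?F" using ft z E(4) by (auto simp: C_def)
    ultimately have "t \<otimes> z \<otimes> inv (z \<otimes> t) = \<one>" using CF by blast
    moreover have "t \<in> carrier G" "z \<in> carrier G" using ft z Ec by (auto simp: C_def)
    ultimately show "t \<otimes> z = z \<otimes> t" by (metis inv_closed inv_equality inv_inv m_closed)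
    show "t \<noteq> \<one>" using tF subgroup.one_closed[OF Fs] by auto
  qed (use ft z in auto)
  show ?thesis
  proof (rule that[of t])
    show "\<exists>f \<in> ?F. \<exists>i::nat. e = f \<otimes> t [^] i" if "e \<in> E" for e using lift[OF that] gen by blast
    show "\<exists>i::nat. z = t [^] i" if "z \<in> E" "z \<otimes> x = x \<otimes> z" for z using gen that by (auto simp: C_def)
  qed (use ft tF Cq in \<open>auto simp: C_def\<close>)
qed

end

end

section \<open>Abelian sections and minimal normal subgroups\<close>

context group
begin

lemma commutator_in_derived:
  assumes D: "D \<subseteq> carrier G" and ab: "a \<in> D" "b \<in> D"
  shows "a \<otimes> b \<otimes> inv (b \<otimes> a) \<in> derived G D"
proof -
  have "a \<otimes> b \<otimes> inv (b \<otimes> a) = a \<otimes> b \<otimes> inv a \<otimes> inv b"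
    using assms by (simp add: inv_mult_group m_assoc subset_iff)
  moreover have "a \<otimes> b \<otimes> inv a \<otimes> inv b \<in> derived G D"
    unfolding derived_def by (rule generate.incl) (use ab in blast)
  ultimately show ?thesis by (simp only:)
qed

text \<open>The derived series ends in the identity, so some first term meets \<open>W\<close>
  inside \<open>F\<close>; \<open>D\<close> is the term before it.\<close>

lemma last_derived_term_outside:
  assumes sol: "solvable G" and F: "\<one> \<in> F" "\<not> W \<subseteq> F" and W: "W \<subseteq> carrier G"
  shows "\<exists>D. D \<lhd> G \<and> \<not> W \<inter> D \<subseteq> F \<and> W \<inter> derived G D \<subseteq> F"
proof -
  define D where "D i = (derived G ^^ i) (carrier G)" for i
  obtain n where "D n = {\<one>}" using sol solvable_iff_trivial_derived_seq by (auto simp: D_def)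
  then have "W \<inter> D n \<subseteq> F" using F by auto
  define m where "m = (LEAST n. W \<inter> D n \<subseteq> F)"
  have m: "W \<inter> D m \<subseteq> F" unfolding m_def using \<open>W \<inter> D n \<subseteq> F\<close> by (rule LeastI)
  have "m \<noteq> 0"
  proof
    assume "m = 0"
    then have "W \<inter> carrier G \<subseteq> F" using m by (simp add: D_def)
    then show False using F W by blast
  qed
  then obtain i where i: "m = Suc i" using not0_implies_Suc by blast
  have "\<not> W \<inter> D i \<subseteq> F" using not_less_Least[of i "\<lambda>n. W \<inter> D n \<subseteq> F"] i by (simp add: m_def)
  moreover have "D j \<lhd> G" for j
    by (induction j) (auto simp: D_def derived_is_normal normal_self)
  moreover have "W \<inter> derived G (D i) \<subseteq> F" using m i by (simp add: D_def)
  ultimately show ?thesis by blast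
qed

text \<open>Intersecting \<open>W\<close> with a term of the derived series of \<open>G\<close>, not
  of \<open>W\<close>, gives the invariance: the term is normal in \<open>G\<close>, so whatever
  conjugates \<open>W\<close> into itself preserves the intersection. With trivial \<open>F\<close>
  the result is an abelian subgroup.\<close>

lemma abelian_section_of_normalised:
  assumes sol: "solvable G" and W: "subgroup W G" and F: "\<one> \<in> F" "\<not> W \<subseteq> F"
  obtains D where "subgroup D G" "D \<subseteq> W" "\<not> D \<subseteq> F" "\<And>a b. a \<in> D \<Longrightarrow> b \<in> D \<Longrightarrow> a \<otimes> b \<otimes> inv (b \<otimes> a) \<in> F"
    "\<And>n d. n \<in> carrier G \<Longrightarrow> cj n ` W \<subseteq> W \<Longrightarrow> d \<in> D \<Longrightarrow> cj n d \<in> D"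
proof -
  obtain D where D: "D \<lhd> G" "\<not> W \<inter> D \<subseteq> F" "W \<inter> derived G D \<subseteq> F"
    using last_derived_term_outside[OF sol F subgroup.subset[OF W]] by blast
  have Ds: "subgroup D G" using D normal_imp_subgroup by blast
  show ?thesis
  proof (rule that[of "W \<inter> D"])
    show "subgroup (W \<inter> D) G" using subgroups_Inter_pair W Ds by blast
    show "a \<otimes> b \<otimes> inv (b \<otimes> a) \<in> F" if "a \<in> W \<inter> D" "b \<in> W \<inter> D" for a b
    proof -
      have "a \<otimes> b \<otimes> inv (b \<otimes> a) \<in> W" using that W by (simp add: subgroup.m_closed subgroup.m_inv_closed)
      moreover have "a \<otimes> b \<otimes> inv (b \<otimes> a) \<in> derived G D"
        using commutator_in_derived[OF subgroup.subset[OF Ds]] that by blast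
      ultimately show ?thesis using D by blast
    qed
    show "cj n d \<in> W \<inter> D" if "n \<in> carrier G" "cj n ` W \<subseteq> W" "d \<in> W \<inter> D" for n d
      using that cj_normal[OF D(1)] by blast
  qed (use D in auto)
qed

end

context fin_group
begin

text \<open>\<open>E\<close> is the preimage of the elements of order dividing \<open>q\<close> in
  the abelian group \<open>D F / F\<close>. That set is a subgroup invariant under \<open>N\<close>,
  and \<open>q\<close> is chosen so that it is not trivial.\<close>

lemma elementary_abelian_section:
  assumes sol: "solvable G" and N: "subgroup N G" and F: "subgroup F G" and W: "subgroup W G"
    and sub: "F \<subseteq> W" "W \<subseteq> N" "F \<noteq> W"
    and nF: "\<And>n f. n \<in> N \<Longrightarrow> f \<in> F \<Longrightarrow> cj n f \<in> F" and nW: "\<And>n w. n \<in> N \<Longrightarrow> w \<in> W \<Longrightarrow> cj n w \<in> W"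
  obtains E q where "subgroup E G" "F \<subseteq> E" "E \<subseteq> W" "E \<noteq> F" "\<And>n e. n \<in> N \<Longrightarrow> e \<in> E \<Longrightarrow> cj n e \<in> E"
    "prime (q::nat)" "\<And>e. e \<in> E \<Longrightarrow> e [^] q \<in> F" "\<And>d e. d \<in> E \<Longrightarrow> e \<in> E \<Longrightarrow> d \<otimes> e \<otimes> inv (e \<otimes> d) \<in> F"
proof -
  let ?N = "G\<lparr>carrier := N\<rparr>"
  interpret N: group ?N using subgroup_imp_group[OF N] .
  have N_carrier: "n \<in> carrier G" if "n \<in> N" for n using subgroup.mem_carrier[OF N that] .
  have FN: "subgroup F ?N" using subgroup_incl[OF F N] sub by blast
  have Fn: "F \<lhd> ?N"
    using N.normal_inv_iff FN nF N by (simp add: cj_def)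
  interpret F: normal F ?N using Fn .
  interpret Q: group "?N Mod F" by (rule F.factorgroup_is_group)
  interpret pi: group_hom ?N "?N Mod F" "\<lambda>a. F #> a"
    by unfold_locales (use F.r_coset_hom_Mod in simp)
  have pi_eq: "F #> a = F #> b \<longleftrightarrow> a \<otimes> inv b \<in> F" if "a \<in> N" "b \<in> N" for a b
    using coset_eq_iff[OF F N_carrier N_carrier, OF that] .
  have pi_mult: "F #> (a \<otimes> b) = (F #> a) \<otimes>\<^bsub>?N Mod F\<^esub> (F #> b)" if "a \<in> N" "b \<in> N" for a b
    using pi.hom_mult[of a b] that by simp
  obtain D where D: "subgroup D G" "D \<subseteq> W" "\<not> D \<subseteq> F" "\<And>a b. a \<in> D \<Longrightarrow> b \<in> D \<Longrightarrow> a \<otimes> b \<otimes> inv (b \<otimes> a) \<in> F"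
    "\<And>n d. n \<in> carrier G \<Longrightarrow> cj n ` W \<subseteq> W \<Longrightarrow> d \<in> D \<Longrightarrow> cj n d \<in> D"
    using abelian_section_of_normalised[OF sol W subgroup.one_closed[OF F]] sub by (metis subset_antisym)
  have DN: "d \<in> N" if "d \<in> D" for d using that D sub by blast
  have nD: "cj n d \<in> D" if "n \<in> N" "d \<in> D" for n d using D(5)[OF N_carrier _ that(2)] that nW by blast
  have picomm: "(F #> a) \<otimes>\<^bsub>?N Mod F\<^esub> (F #> b) = (F #> b) \<otimes>\<^bsub>?N Mod F\<^esub> (F #> a)" if "a \<in> D" "b \<in> D" for a b
  proof -
    have "F #> (a \<otimes> b) = F #> (b \<otimes> a)"
      using pi_eq[of "a \<otimes> b" "b \<otimes> a"] D(4)[OF that] DN that subgroup.m_closed[OF N] by metis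
    then show ?thesis using pi_mult that DN by metis
  qed
  obtain e0 where e0: "e0 \<in> D" "e0 \<notin> F" using D by blast
  have "\<exists>m::nat. m > 0 \<and> e0 [^] m \<in> F"
    using e0 DN N_carrier subgroup.one_closed[OF F] ord_ge_1[OF fin] by (intro exI[of _ "ord e0"]) (auto simp: Suc_le_eq)
  \<comment> \<open>\<open>m\<close> is the order of \<open>e0\<close> modulo \<open>F\<close>. For
    a prime divisor \<open>q\<close> of \<open>m\<close>, the power of \<open>e0\<close> with
    exponent \<open>m / q\<close> is outside \<open>F\<close>, but its \<open>q\<close>-th power is
    inside.\<close>
  define m where "m = (LEAST m::nat. m > 0 \<and> e0 [^] m \<in> F)"
  have m: "m > 0" "e0 [^] m \<in> F" using LeastI_ex[OF \<open>\<exists>m::nat. m > 0 \<and> e0 [^] m \<in> F\<close>] by (simp_all add: m_def)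
  have "m \<noteq> 1" using m e0 DN N_carrier by (metis nat_pow_eone)
  then obtain q where q: "prime q" "q dvd m" using prime_factor_nat by blast
  then obtain k where k: "m = k * q" by (metis dvd_def mult.commute)
  have "k > 0" "k < m" using k m prime_gt_1_nat[OF q(1)] by auto
  then have ek: "e0 [^] k \<notin> F" using not_less_Least[of k "\<lambda>m. m > 0 \<and> e0 [^] m \<in> F"] by (simp add: m_def)
  have ekq: "(e0 [^] k) [^] q \<in> F" using m k e0 DN N_carrier by (simp add: nat_pow_pow)
  define E where "E = {w \<in> N. F #> w \<in> (\<lambda>a. F #> a) ` D \<and> w [^] q \<in> F}"
  have piq: "w [^] q \<in> F \<longleftrightarrow> (F #> w) [^]\<^bsub>?N Mod F\<^esub> q = \<one>\<^bsub>?N Mod F\<^esub>" if "w \<in> N" for w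
  proof -
    have wq: "w [^] q \<in> N" using pow_closed_subgroup[OF N that] .
    have "(F #> w) [^]\<^bsub>?N Mod F\<^esub> q = F #> (w [^] q)" using F.FactGroup_pow[of w q] that by (simp flip: nat_pow_consistent)
    moreover have "F #> (w [^] q) = F \<longleftrightarrow> w [^] q \<in> F"
      using coset_join2[OF N_carrier F] coset_join1[OF _ N_carrier F] wq by blast
    ultimately show ?thesis by simp
  qed
  have FE: "F \<subseteq> E"
  proof
    fix f assume f: "f \<in> F"
    have "F #> f = F #> \<one>" using f F N_carrier sub pi_eq[of f \<one>] subgroup.one_closed[OF N] by auto
    then show "f \<in> E" using f F sub subgroup.one_closed[OF D(1)] pow_closed_subgroup by (auto simp: E_def)
  qed
  have EW: "E \<subseteq> W"
  proof
    fix w assume w: "w \<in> E"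
    then obtain d where d: "d \<in> D" "F #> w = F #> d" by (auto simp: E_def)
    then have "w \<otimes> inv d \<in> F" using pi_eq w DN by (simp add: E_def)
    then have "w \<otimes> inv d \<otimes> d \<in> W" using d D sub W by (metis subgroup.m_closed subset_iff)
    then show "w \<in> W" using w d DN N_carrier by (simp add: E_def m_assoc)
  qed
  have Es: "subgroup E G"
  proof (rule subgroupI)
    show "E \<noteq> {}" using FE subgroup.one_closed[OF F] by blast
    show "E \<subseteq> carrier G" using N_carrier by (auto simp: E_def)
    fix a b assume ab: "a \<in> E" "b \<in> E"
    then have abN: "a \<in> N" "b \<in> N" by (auto simp: E_def)
    obtain c d where cd: "c \<in> D" "F #> a = F #> c" "d \<in> D" "F #> b = F #> d" using ab by (auto simp: E_def)
    have "F #> (a \<otimes> b) = F #> (c \<otimes> d)" using cd abN DN by (simp only: pi_mult)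
    moreover have "c \<otimes> d \<in> D" using cd D(1) subgroup.m_closed by metis
    moreover have "(F #> (a \<otimes> b)) [^]\<^bsub>?N Mod F\<^esub> q = \<one>\<^bsub>?N Mod F\<^esub>"
    proof -
      have "F #> a \<in> carrier (?N Mod F)" "F #> b \<in> carrier (?N Mod F)" using abN pi.hom_closed by auto
      moreover have "(F #> a) \<otimes>\<^bsub>?N Mod F\<^esub> (F #> b) = (F #> b) \<otimes>\<^bsub>?N Mod F\<^esub> (F #> a)"
        using picomm cd by simp
      ultimately have "((F #> a) \<otimes>\<^bsub>?N Mod F\<^esub> (F #> b)) [^]\<^bsub>?N Mod F\<^esub> q
          = (F #> a) [^]\<^bsub>?N Mod F\<^esub> q \<otimes>\<^bsub>?N Mod F\<^esub> (F #> b) [^]\<^bsub>?N Mod F\<^esub> q"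
        using Q.pow_mult_distrib by blast
      also have "\<dots> = \<one>\<^bsub>?N Mod F\<^esub>" using ab piq abN by (simp only: E_def mem_Collect_eq Q.l_one Q.one_closed)
      finally show ?thesis using pi_mult abN by simp
    qed
    ultimately show "a \<otimes> b \<in> E" using piq[of "a \<otimes> b"] abN subgroup.m_closed[OF N] by (auto simp: E_def)
  next
    fix a assume a: "a \<in> E"
    then obtain c where c: "c \<in> D" "F #> a = F #> c" "a \<in> N" "a [^] q \<in> F" by (auto simp: E_def)
    have i: "inv a \<in> N" "inv c \<in> D" "inv c \<in> N" using c N D DN subgroup.m_inv_closed by metis+
    have "F #> (inv a) = F #> (inv c)"
      using pi.hom_inv[of a] pi.hom_inv[of c] c DN N by simp
    moreover have "(inv a) [^] q \<in> F" using c N_carrier F by (simp add: nat_pow_inv subgroup.m_inv_closed)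
    ultimately show "inv a \<in> E" using i by (auto simp: E_def)
  qed
  show ?thesis
  proof (rule that[OF Es FE EW _ _ q(1)])
    have "e0 [^] k \<in> E" using e0 DN pow_closed_subgroup[OF D(1)] ekq by (auto simp: E_def)
    then show "E \<noteq> F" using ek by blast
    show "e [^] q \<in> F" if "e \<in> E" for e using that by (simp add: E_def)
    fix n e assume n: "n \<in> N" and e: "e \<in> E"
    then obtain d where d: "d \<in> D" "F #> e = F #> d" "e \<in> N" "e [^] q \<in> F" by (auto simp: E_def)
    have "e \<otimes> inv d \<in> F" using pi_eq d DN by simp
    then have "cj n (e \<otimes> inv d) \<in> F" using nF n by blast
    then have "cj n e \<otimes> inv (cj n d) \<in> F" using n d DN N_carrier by (simp add: cj_mult cj_inv)
    then have "F #> cj n e = F #> cj n d"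
      using pi_eq[of "cj n e" "cj n d"] cj_closed_subgroup[OF N] n d DN by simp
    moreover have "cj n e [^] q \<in> F" using nF[OF n d(4)] n d N_carrier by (simp add: cj_pow)
    ultimately show "cj n e \<in> E" using cj_closed_subgroup[OF N] n d nD by (auto simp: E_def)
  next
    fix a b assume ab: "a \<in> E" "b \<in> E"
    then have abN: "a \<in> N" "b \<in> N" by (auto simp: E_def)
    obtain c d where cd: "c \<in> D" "F #> a = F #> c" "d \<in> D" "F #> b = F #> d" using ab by (auto simp: E_def)
    have "F #> (a \<otimes> b) = F #> (b \<otimes> a)" using picomm cd abN by (simp only: pi_mult)
    then show "a \<otimes> b \<otimes> inv (b \<otimes> a) \<in> F" using pi_eq abN subgroup.m_closed[OF N] by simp
  qed
qed

lemma commutator_one_iff: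
  "a \<in> carrier G \<Longrightarrow> b \<in> carrier G \<Longrightarrow> a \<otimes> b \<otimes> inv (b \<otimes> a) = \<one> \<longleftrightarrow> a \<otimes> b = b \<otimes> a"
  by (metis inv_closed inv_equality inv_inv m_closed r_inv)

section \<open>Minimal normal subgroups\<close>

definition min_normal :: "'a set \<Rightarrow> nat \<Rightarrow> bool" where
  "min_normal V r \<longleftrightarrow> V \<lhd> G \<and> V \<noteq> {\<one>} \<and> (\<forall>v \<in> V. \<forall>w \<in> V. v \<otimes> w = w \<otimes> v) \<and> prime r \<and> (\<forall>v \<in> V. v [^] r = \<one>) \<and>
    (\<forall>U. U \<lhd> G \<longrightarrow> U \<subseteq> V \<longrightarrow> U \<noteq> {\<one>} \<longrightarrow> U = V)"

text \<open>Take a smallest nontrivial normal subgroup that is abelian of prime exponent. These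
  properties pass to every nontrivial normal subgroup inside it, so it is minimal among all of
  them.\<close>

lemma min_normal_exists:
  assumes sol: "solvable G" and non: "carrier G \<noteq> {\<one>}"
  obtains V r where "min_normal V r"
proof -
  define P where "P V \<longleftrightarrow> V \<lhd> G \<and> V \<noteq> {\<one>} \<and> (\<exists>r::nat. prime r \<and> (\<forall>v \<in> V. v [^] r = \<one>)) \<and> (\<forall>v \<in> V. \<forall>w \<in> V. v \<otimes> w = w \<otimes> v)" for V
  obtain E q where E: "subgroup E G" "{\<one>} \<subseteq> E" "E \<subseteq> carrier G" "E \<noteq> {\<one>}" "\<And>n e. n \<in> carrier G \<Longrightarrow> e \<in> E \<Longrightarrow> cj n e \<in> E"
    "prime (q::nat)" "\<And>e. e \<in> E \<Longrightarrow> e [^] q \<in> {\<one>}" "\<And>d e. d \<in> E \<Longrightarrow> e \<in> E \<Longrightarrow> d \<otimes> e \<otimes> inv (e \<otimes> d) \<in> {\<one>}"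
    by (rule elementary_abelian_section[OF sol subgroup_self triv_subgroup subgroup_self]) (use non in auto)
  have "P E" unfolding P_def
  proof (intro conjI ballI)
    show "E \<lhd> G" using normal_invI[OF E(1)] E(5) by (simp add: cj_def)
    show "\<exists>r::nat. prime r \<and> (\<forall>v \<in> E. v [^] r = \<one>)" using E(6,7) by (intro exI[of _ q]) auto
    show "v \<otimes> w = w \<otimes> v" if "v \<in> E" "w \<in> E" for v w
      using E(8)[OF that] commutator_one_iff that E(3) by blast
  qed (rule E(4))
  then obtain V where V: "P V" "\<And>U. P U \<Longrightarrow> card V \<le> card U"
    using ex_has_least_nat[of P E card] by blast
  then obtain r :: nat where r: "prime r" "\<forall>v \<in> V. v [^] r = \<one>" by (auto simp: P_def)
  have "min_normal V r"
    unfolding min_normal_def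
  proof (intro conjI allI impI)
    fix U assume U: "U \<lhd> G" "U \<subseteq> V" "U \<noteq> {\<one>}"
    then have "P U" using V r unfolding P_def by (meson subsetD)
    then have "card V \<le> card U" using V by blast
    then show "U = V" using U V finite_subgroup normal_imp_subgroup by (metis P_def card_seteq)
  qed (use V r in \<open>auto simp: P_def\<close>)
  then show ?thesis using that by blast
qed

text \<open>If \<open>q\<close> divided \<open>card V\<close>, it would be the exponent of
  \<open>V\<close>, and \<open>E\<close> would act on \<open>V\<close> as an abelian group of
  exponent \<open>q\<close>. Such a group has common nontrivial fixed points. They form a normal
  subgroup, by minimality all of \<open>V\<close>, so \<open>E\<close> would centralise
  \<open>V\<close>.\<close>

lemma min_normal_section_coprime:
  assumes V: "min_normal V r" and E: "E \<lhd> G" "\<not> E \<subseteq> cent V" and q: "prime q" "\<And>e. e \<in> E \<Longrightarrow> e [^] q \<in> cent V"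
    and comm: "\<And>d e. d \<in> E \<Longrightarrow> e \<in> E \<Longrightarrow> d \<otimes> e \<otimes> inv (e \<otimes> d) \<in> cent V"
  shows "\<not> q dvd card V"
proof
  assume qV: "q dvd card V"
  have Vn: "V \<lhd> G" and V1: "V \<noteq> {\<one>}" and r: "prime r" "\<And>v. v \<in> V \<Longrightarrow> v [^] r = \<one>"
    using V by (auto simp: min_normal_def)
  have Vs: "subgroup V G" using Vn normal_imp_subgroup by blast
  have V_carrier: "v \<in> carrier G" if "v \<in> V" for v using subgroup.mem_carrier[OF Vs that] .
  have Es: "subgroup E G" using E normal_imp_subgroup by blast
  have Ec: "e \<in> carrier G" if "e \<in> E" for e using subgroup.mem_carrier[OF Es that] .
  obtain v where v: "v \<in> V" "v \<noteq> \<one>" "v [^] q = \<one>" using cauchy[OF Vs q(1) qV] by blast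
  have qr: "q = r" using prime_order[OF V_carrier[OF v(1)] v(3) q(1) v(2)] prime_order[OF V_carrier[OF v(1)] r(2)[OF v(1)] r(1) v(2)] by simp
  \<comment> \<open>A smallest \<open>W\<close> with this property is fixed pointwise: the fixed
    points in \<open>W\<close> of a single \<open>e\<close> are nontrivial by counting and again
    invariant under \<open>E\<close>, so they exhaust \<open>W\<close>.\<close>
  define P where "P U \<longleftrightarrow> subgroup U G \<and> U \<subseteq> V \<and> U \<noteq> {\<one>} \<and> (\<forall>e \<in> E. \<forall>u \<in> U. cj e u \<in> U)" for U
  have "P V" using Vs V1 cj_normal[OF Vn] Ec by (auto simp: P_def)
  then obtain W where W: "P W" "\<And>U. P U \<Longrightarrow> card W \<le> card U"
    using ex_has_least_nat[of P V card] by blast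
  have Ws: "subgroup W G" "W \<subseteq> V" "W \<noteq> {\<one>}" "\<And>e w. e \<in> E \<Longrightarrow> w \<in> W \<Longrightarrow> cj e w \<in> W" using W by (auto simp: P_def)
  have W1: "\<one> \<in> W" using subgroup.one_closed[OF Ws(1)] .
  have rW: "r dvd card W"
  proof -
    obtain w where w: "w \<in> W" "w \<noteq> \<one>" using Ws(3) W1 by blast
    then have wV: "w \<in> V" using Ws(2) by blast
    have "ord w = r" using prime_order[OF V_carrier[OF wV] r(2)[OF wV] r(1) w(2)] .
    then show ?thesis using pow_card_one[OF Ws(1) w(1)] pow_eq_id[OF V_carrier[OF wV]] by blast
  qed
  have fixed: "e \<otimes> w = w \<otimes> e" if e: "e \<in> E" and w: "w \<in> W" for e w
  proof -
    have "\<exists>c \<in> W. c \<noteq> \<one> \<and> cj e c = c"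
    proof (rule exists_other_fixed_point[OF finite_subgroup[OF Ws(1)] r(1) _ _ rW W1])
      show "(cj e ^^ r) c = c" if "c \<in> W" for c
      proof -
        have "c \<in> V" using that Ws by blast
        then show ?thesis
          using q(2)[OF e] qr Ec[OF e] V_carrier by (simp add: cj_funpow cj_fix_iff cent_def)
      qed
    qed (use e Ws Ec in auto)
    then obtain c where c: "c \<in> W" "c \<noteq> \<one>" "cj e c = c" by blast
    define C where "C = {w \<in> W. e \<otimes> w = w \<otimes> e}"
    have Cfix: "w \<in> C \<longleftrightarrow> w \<in> W \<and> cj e w = w" for w
      using cj_fix_iff[OF Ec[OF e], of w] V_carrier Ws(2) by (auto simp: C_def)
    have Wc: "w \<in> carrier G" if "w \<in> W" for w using that Ws(2) V_carrier by blast
    have "subgroup C G"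
    proof (rule subgroupI)
      show "inv a \<in> C" if "a \<in> C" for a
        using that Ws(1) Ec[OF e] Wc by (simp add: Cfix cj_inv subgroup.m_inv_closed)
      show "a \<otimes> b \<in> C" if "a \<in> C" "b \<in> C" for a b
        using that Ws(1) Ec[OF e] Wc by (simp add: Cfix cj_mult subgroup.m_closed)
    qed (use c Wc in \<open>auto simp: Cfix\<close>)
    moreover have "cj d w \<in> C" if d: "d \<in> E" and w: "w \<in> C" for d w
    proof -
      have wW: "w \<in> W" "cj e w = w" using w Cfix by auto
      \<comment> \<open>The commutator centralises \<open>V\<close>, so \<open>e\<close> and
        \<open>d\<close> commute as maps on \<open>V\<close> and \<open>d\<close> preserves the
        fixed points of \<open>e\<close>.\<close>
      let ?u = "e \<otimes> d \<otimes> inv (d \<otimes> e)"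
      have "e \<otimes> d = ?u \<otimes> (d \<otimes> e)" using Ec[OF e] Ec[OF d] by (simp add: m_assoc)
      then have "cj e (cj d w) = cj ?u (cj d (cj e w))"
        using Ec[OF e] Ec[OF d] Wc[OF wW(1)] by (simp add: cj_cj)
      also have "\<dots> = cj ?u (cj d w)" using wW by simp
      also have "\<dots> = cj d w"
      proof -
        have "cj d w \<in> V" using Ws(2,4) d wW by blast
        then have "?u \<otimes> cj d w = cj d w \<otimes> ?u" using comm[OF e d] by (auto simp: cent_def)
        then show ?thesis using cj_fix_iff[of ?u "cj d w"] Ec[OF e] Ec[OF d] Wc wW by simp
      qed
      finally show ?thesis using Ws(4)[OF d] wW Cfix by blast
    qed
    ultimately have "P C" using c Ws(2) by (auto simp: P_def Cfix)
    then have "card W \<le> card C" using W by blast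
    moreover have "C \<subseteq> W" by (auto simp: C_def)
    ultimately have "C = W" using finite_subgroup[OF Ws(1)] by (simp add: card_seteq)
    then show ?thesis using w by (auto simp: C_def)
  qed
  have Un: "V \<inter> cent E \<lhd> G" using normal_subgroup_intersect[OF Vn cent_normal[OF E(1)]] .
  have "W \<subseteq> V \<inter> cent E" using fixed Ws(2) V_carrier by (auto simp: cent_def)
  then have "V \<inter> cent E \<noteq> {\<one>}" using Ws(3) W1 by blast
  then have "V \<inter> cent E = V" using V Un unfolding min_normal_def by blast
  then have "V \<subseteq> cent E" by blast
  then have "e \<otimes> v = v \<otimes> e" if "e \<in> E" "v \<in> V" for e v
    using that by (auto simp: cent_def)
  then have "E \<subseteq> cent V" using Ec by (auto simp: cent_def)
  then show False using E by blast
qed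

end

section \<open>Structure of solvable Frobenius groups\<close>

context fin_group
begin

lemma prime_order_power_in_subgroup:
  assumes H: "subgroup H G" and h: "h \<in> H" "h \<noteq> \<one>"
  obtains p x where "prime (p::nat)" "x \<in> H" "x \<noteq> \<one>" "x [^] p = \<one>" "x \<otimes> h = h \<otimes> x"
proof -
  have hc: "h \<in> carrier G" using subgroup.mem_carrier[OF H h(1)] .
  obtain p k :: nat where pk: "prime p" "h [^] k \<noteq> \<one>" "(h [^] k) [^] p = \<one>"
    using prime_power_exists[OF hc h(2)] by blast
  show ?thesis using that[OF pk(1) pow_closed_subgroup[OF H h(1)] pk(2,3)] comm_pow[OF hc hc refl] by blast
qed

text \<open>Everything rests on \<open>clos\<close>: whatever commutes with a nontrivial element of
  \<open>H\<close> lies in \<open>H\<close>. It keeps \<open>V\<close> and its centraliser away from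
  \<open>H\<close>, makes \<open>H\<close> act on \<open>cent V\<close> without fixed points, and
  draws into \<open>H\<close> the elements of the section that commute with an element of
  \<open>H\<close>. Since \<open>V\<close> is chosen before \<open>H\<close>, the kernel does not
  depend on the complement.\<close>

lemma malnormal_structure:
  assumes sol: "solvable G" and V: "min_normal V r"
    and H: "subgroup H G" "H \<noteq> {\<one>}" "H \<noteq> carrier G"
    and mal: "\<And>g h. g \<in> carrier G \<Longrightarrow> h \<in> H \<Longrightarrow> h \<noteq> \<one> \<Longrightarrow> cj g h \<in> H \<Longrightarrow> g \<in> H"
  shows "cent V \<inter> H = {\<one>}"
    and "\<And>g. g \<in> carrier G \<Longrightarrow> \<exists>f \<in> cent V. \<exists>h \<in> H. g = f \<otimes> h"
    and "(carrier G - (\<Union>g \<in> carrier G. cj g ` H)) \<union> {\<one>} = cent V"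
    and "\<exists>t \<in> H. t \<noteq> \<one> \<and> (\<forall>h \<in> H. \<forall>p::nat. prime p \<longrightarrow> h [^] p = \<one> \<longrightarrow> h \<otimes> t = t \<otimes> h)"
    and "card H < card (cent V)"
    and "fpf H (cent V)"
proof -
  have Vn: "V \<lhd> G" and V1: "V \<noteq> {\<one>}" and ab: "\<And>v w. v \<in> V \<Longrightarrow> w \<in> V \<Longrightarrow> v \<otimes> w = w \<otimes> v"
    using V by (auto simp: min_normal_def)
  have Vs: "subgroup V G" using Vn normal_imp_subgroup by blast
  have V_carrier: "v \<in> carrier G" if "v \<in> V" for v using subgroup.mem_carrier[OF Vs that] .
  have H_carrier: "v \<in> carrier G" if "v \<in> H" for v using subgroup.mem_carrier[OF H(1) that] .
  let ?F = "cent V"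
  have Fn: "?F \<lhd> G" using cent_normal[OF Vn] .
  have Fs: "subgroup ?F G" using Fn normal_imp_subgroup by blast
  have F_carrier: "f \<in> carrier G" if "f \<in> ?F" for f using subgroup.mem_carrier[OF Fs that] .
  have VF: "V \<subseteq> ?F" using ab V_carrier by (auto simp: cent_def)
  have clos: "g \<in> H" if "g \<in> carrier G" "h \<in> H" "h \<noteq> \<one>" "g \<otimes> h = h \<otimes> g" for g h
    using mal[OF that(1-3)] cj_fix_iff[OF that(1) H_carrier[OF that(2)]] that by simp
  have VH: "v = \<one>" if "v \<in> V" "v \<in> H" for v
  proof (rule ccontr)
    assume v: "v \<noteq> \<one>"
    \<comment> \<open>An abelian \<open>V\<close> that meets \<open>H\<close> lies in
      \<open>H\<close>; being normal, it then forces all of \<open>G\<close> into \<open>H\<close>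
      by malnormality.\<close>
    have "V \<subseteq> H" using clos[OF V_carrier that(2) v] ab that(1) by blast
    then have "carrier G \<subseteq> H" using mal[OF _ that(2) v] cj_normal[OF Vn _ that(1)] by blast
    then show False using H(1,3) subgroup.subset by blast
  qed
  have FH: "f = \<one>" if "f \<in> ?F" "f \<in> H" for f
  proof (rule ccontr)
    assume f: "f \<noteq> \<one>"
    obtain v where v: "v \<in> V" "v \<noteq> \<one>" using V1 subgroup.one_closed[OF Vs] by blast
    have "v \<otimes> f = f \<otimes> v" using that(1) v by (simp add: cent_def)
    then show False using clos[OF V_carrier[OF v(1)] that(2) f] VH v by blast
  qed
  then show a: "?F \<inter> H = {\<one>}" using subgroup.one_closed[OF Fs] subgroup.one_closed[OF H(1)] by blast
  show fpf: "fpf H ?F"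
    unfolding fpf_def using clos F_carrier FH by metis
  obtain h0 where "h0 \<in> H" "h0 \<noteq> \<one>" using H(2) subgroup.one_closed[OF H(1)] by blast
  then obtain p x where x: "prime (p::nat)" "x \<in> H" "x \<noteq> \<one>" "x [^] p = \<one>"
    using prime_order_power_in_subgroup[OF H(1)] by metis
  have Fne: "?F \<noteq> carrier G" using FH[of x] x H_carrier by blast
  obtain E q where E: "subgroup E G" "?F \<subseteq> E" "E \<subseteq> carrier G" "E \<noteq> ?F" "\<And>n e. n \<in> carrier G \<Longrightarrow> e \<in> E \<Longrightarrow> cj n e \<in> E"
    "prime (q::nat)" "\<And>e. e \<in> E \<Longrightarrow> e [^] q \<in> ?F" "\<And>d e. d \<in> E \<Longrightarrow> e \<in> E \<Longrightarrow> d \<otimes> e \<otimes> inv (e \<otimes> d) \<in> ?F"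
    by (rule elementary_abelian_section[OF sol subgroup_self Fs subgroup_self]) (use Fne F_carrier cj_normal[OF Fn] in auto)
  have En: "E \<lhd> G" using normal_invI[OF E(1)] E(5) by (simp add: cj_def)
  have qV: "\<not> q dvd card V" using min_normal_section_coprime[OF V En _ E(6,7,8)] E(2,4) by blast
  have sec: "\<exists>t. t \<in> E \<and> t \<in> H \<and> t \<notin> ?F \<and> t [^] q = \<one> \<and> t \<otimes> y = y \<otimes> t \<and> (\<forall>e \<in> E. \<exists>f \<in> ?F. \<exists>i::nat. e = f \<otimes> t [^] i)"
    if y: "y \<in> H" "y \<noteq> \<one>" "prime (l::nat)" "y [^] l = \<one>" for y l
  proof -
    have zH: "z \<in> H" if "z \<in> E" "z \<otimes> y = y \<otimes> z" for z using clos[OF _ y(1,2) that(2)] that E(3) by blast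
    show ?thesis
    proof (rule cyclic_section[OF Vn ab V1 E(1,2,4,8,6,7) qV, of y l])
      show "f = \<one>" if "f \<in> ?F" "y \<otimes> f = f \<otimes> y" for f using fpfD[OF fpf y(1) that(1) y(2) that(2)] .
      show "fpf {z \<in> E. z \<otimes> y = y \<otimes> z} ?F" by (rule fpf_mono[OF fpf _ order_refl], clarify, rule zH)
      show "cj y e \<in> E" if "e \<in> E" for e using E(5)[OF H_carrier[OF y(1)] that] .
      fix t assume "t \<in> E" "t \<notin> ?F" "t [^] q = \<one>" "t \<otimes> y = y \<otimes> t" "\<And>e. e \<in> E \<Longrightarrow> \<exists>f \<in> ?F. \<exists>i::nat. e = f \<otimes> t [^] i"
      then show ?thesis using zH by blast
    qed (use y H_carrier in auto)
  qed
  obtain t where t: "t \<in> E" "t \<in> H" "t \<notin> ?F" "t [^] q = \<one>" "\<And>e. e \<in> E \<Longrightarrow> \<exists>f \<in> ?F. \<exists>i::nat. e = f \<otimes> t [^] i"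
    using sec[OF x(2,3,1,4)] by blast
  have t1: "t \<noteq> \<one>" using t(3) subgroup.one_closed[OF Fs] by blast
  show b: "\<exists>f \<in> ?F. \<exists>h \<in> H. g = f \<otimes> h" if g: "g \<in> carrier G" for g
  proof -
    obtain f i where fi: "f \<in> ?F" "cj g t = f \<otimes> t [^] (i::nat)" using t(5)[OF E(5)[OF g t(1)]] by blast
    obtain k where k: "k \<in> ?F" "cj g t = cj k (t [^] i)" "t [^] i \<noteq> \<one>"
      using frattini_prime_order[OF subgroup_self Fs _ _ H_carrier[OF t(2)] t(4) E(6) t1 _ g fi(2,1)] F_carrier cj_normal[OF Fn]
        fpfD[OF fpf t(2) _ t1] by blast
    \<comment> \<open>\<open>inv k\<close> times \<open>g\<close> carries \<open>t\<close> to a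
      power of \<open>t\<close>, so malnormality puts it into \<open>H\<close>.\<close>
    have "cj (inv k \<otimes> g) t = cj (inv k) (cj g t)" using k(1) g H_carrier[OF t(2)] F_carrier by (simp add: cj_cj)
    also have "\<dots> = t [^] i" using k F_carrier H_carrier[OF t(2)] by simp
    finally have "inv k \<otimes> g \<in> H"
      using mal[OF _ t(2) t1, of "inv k \<otimes> g"] pow_closed_subgroup[OF H(1) t(2)] k(1) F_carrier g by simp
    moreover have "g = k \<otimes> (inv k \<otimes> g)" using k(1) F_carrier g by simp
    ultimately show ?thesis using k(1) by blast
  qed
  show "(carrier G - (\<Union>g \<in> carrier G. cj g ` H)) \<union> {\<one>} = ?F"
  proof (intro equalityI subsetI)
    fix g assume g: "g \<in> (carrier G - (\<Union>g \<in> carrier G. cj g ` H)) \<union> {\<one>}"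
    show "g \<in> ?F"
    proof (cases "g = \<one>")
      case False
      then have "g \<in> carrier G" using g by blast
      then obtain f h where fh: "f \<in> ?F" "h \<in> H" "g = f \<otimes> h" using b by blast
      have "h = \<one>"
      proof (rule ccontr)
        assume h: "h \<noteq> \<one>"
        obtain k where "k \<in> ?F" "f \<otimes> h = cj k h"
          using coset_conjugate[OF Fs H_carrier[OF fh(2)] _ _ fh(1)] cj_normal[OF Fn H_carrier[OF fh(2)]] fpfD[OF fpf fh(2) _ h] by blast
        then show False using fh g False F_carrier by blast
      qed
      then show ?thesis using fh F_carrier by simp
    qed (use subgroup.one_closed[OF Fs] in simp)
  next
    fix f assume f: "f \<in> ?F"
    have "f = \<one>" if "g \<in> carrier G" "h \<in> H" "f = cj g h" for g h
    proof -
      have "h = cj (inv g) f" using that H_carrier by simp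
      then have "h \<in> ?F" using cj_normal[OF Fn _ f, of "inv g"] that by simp
      then have "h = \<one>" using FH that by blast
      then show ?thesis using that by simp
    qed
    then show "f \<in> (carrier G - (\<Union>g \<in> carrier G. cj g ` H)) \<union> {\<one>}" using F_carrier[OF f] by blast
  qed
  show "\<exists>t \<in> H. t \<noteq> \<one> \<and> (\<forall>h \<in> H. \<forall>p::nat. prime p \<longrightarrow> h [^] p = \<one> \<longrightarrow> h \<otimes> t = t \<otimes> h)"
  proof (intro bexI[OF _ t(2)] conjI t1 ballI allI impI)
    fix h and l :: nat assume h: "h \<in> H" "prime l" "h [^] l = \<one>"
    show "h \<otimes> t = t \<otimes> h"
    proof (cases "h = \<one>")
      case False
      obtain s where s: "s \<in> E" "s \<in> H" "s \<notin> ?F" "s \<otimes> h = h \<otimes> s" using sec[OF h(1) False h(2,3)] by blast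
      \<comment> \<open>The part of \<open>s\<close> in \<open>?F\<close> lies in \<open>H\<close>
        as well, so it vanishes and \<open>s\<close> is a power of \<open>t\<close>. Commuting with
        \<open>s\<close> is then the same as commuting with \<open>t\<close>.\<close>
      obtain f i where fi: "f \<in> ?F" "s = f \<otimes> t [^] (i::nat)" using t(5)[OF s(1)] by blast
      have ti: "t [^] i \<in> H" using pow_closed_subgroup[OF H(1) t(2)] .
      have "f = s \<otimes> inv (t [^] i)" using fi F_carrier H_carrier[OF t(2)] by (simp add: m_assoc)
      then have "f \<in> H" using s(2) ti H(1) by (simp add: subgroup.m_closed subgroup.m_inv_closed)
      then have "f = \<one>" using FH[OF fi(1)] by blast
      then have "s = t [^] i" using fi H_carrier[OF ti] by simp
      moreover have "s \<noteq> \<one>" using s(3) subgroup.one_closed[OF Fs] by blast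
      ultimately show ?thesis using fpf_pow[OF H_carrier[OF t(2)] t(4) E(6), of i h] s(4) H_carrier[OF h(1)] by simp
    qed (use H_carrier[OF t(2)] in simp)
  qed
  obtain v where v: "v \<in> V" "v \<noteq> \<one>" using V1 subgroup.one_closed[OF Vs] by blast
  \<comment> \<open>The orbit of \<open>v\<close> under \<open>H\<close> is regular, and it lies in
    \<open>?F\<close> without the identity; this gives the strict inequality.\<close>
  have "inj_on (\<lambda>h. cj h v) H"
  proof (rule inj_onI)
    fix h k assume hk: "h \<in> H" "k \<in> H" "cj h v = cj k v"
    have kh: "inv k \<otimes> h \<in> H" using hk H(1) by (simp add: subgroup.m_closed subgroup.m_inv_closed)
    have "cj (inv k \<otimes> h) v = cj (inv k) (cj h v)" using hk(1,2) H_carrier V_carrier[OF v(1)] by (simp add: cj_cj)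
    also have "\<dots> = cj (inv k) (cj k v)" by (simp only: hk(3))
    also have "\<dots> = v" using hk(2) H_carrier V_carrier[OF v(1)] by simp
    finally have "inv k \<otimes> h = \<one>"
      using fpfD[OF fpf kh, of v] VF v cj_fix_iff[OF H_carrier[OF kh] V_carrier[OF v(1)]] by blast
    then show "h = k" using hk H_carrier by (metis inv_closed inv_equality inv_inv)
  qed
  moreover have "(\<lambda>h. cj h v) ` H \<subseteq> ?F - {\<one>}"
    using v VF cj_normal[OF Vn] H_carrier V_carrier by auto
  ultimately have "card H \<le> card (?F - {\<one>})" using finite_subgroup[OF Fs] card_inj_on_le finite_Diff by metis
  also have "\<dots> < card ?F" using finite_subgroup[OF Fs] subgroup.one_closed[OF Fs] by (rule card_Diff1_less)
  finally show "card H < card ?F" .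
qed

end

text \<open>\<open>S\<close> is \<open>G\<close> itself or the subgroup \<open>K <#> L\<close> of a
  2-Frobenius group, and \<open>\<H>\<close> holds all complements, since these will index the
  components. \<open>hub\<close> provides in each complement an element that commutes with all
  elements of prime order there; \<open>card\<close> later separates kernel and complements under
  automorphisms.\<close>

locale frobenius_subgroup = fin_group +
  fixes S F :: "'a set" and \<H> :: "'a set set"
  assumes S: "subgroup S G" and \<H>_def: "\<H> = {H. \<exists>K. frobenius_with (G\<lparr>carrier := S\<rparr>) K H}" and \<H>_nonempty: "\<H> \<noteq> {}"
    and F: "subgroup F G" "F \<subseteq> S" and center: "\<exists>v \<in> F. v \<noteq> \<one> \<and> (\<forall>f \<in> F. f \<otimes> v = v \<otimes> f)"
    and kernel: "\<And>K H. frobenius_with (G\<lparr>carrier := S\<rparr>) K H \<Longrightarrow> K = F"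
    and FH: "\<And>H. H \<in> \<H> \<Longrightarrow> F \<inter> H = {\<one>}" and fpf: "\<And>H. H \<in> \<H> \<Longrightarrow> fpf H F"
    and card: "\<And>H. H \<in> \<H> \<Longrightarrow> card H < card F"
    and factor: "\<And>H g. H \<in> \<H> \<Longrightarrow> g \<in> S \<Longrightarrow> \<exists>f \<in> F. \<exists>h \<in> H. g = f \<otimes> h"
    and hub: "\<And>H. H \<in> \<H> \<Longrightarrow> \<exists>t \<in> H. t \<noteq> \<one> \<and> (\<forall>h \<in> H. \<forall>p::nat. prime p \<longrightarrow> h [^] p = \<one> \<longrightarrow> h \<otimes> t = t \<otimes> h)"

text \<open>\<open>F\<close> is the centraliser in \<open>S\<close> of a minimal normal subgroup of
  \<open>S\<close>. As it is chosen without reference to a complement, all kernels coincide with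
  it.\<close>

lemma (in fin_group) frobenius_subgroup_exists:
  assumes sol: "solvable G" and S: "subgroup S G" and frob: "frobenius_with (G\<lparr>carrier := S\<rparr>) K0 H0"
  shows "\<exists>F. frobenius_subgroup G S F {H. \<exists>K. frobenius_with (G\<lparr>carrier := S\<rparr>) K H}"
proof -
  let ?S = "G\<lparr>carrier := S\<rparr>"
  have S_carrier: "s \<in> carrier G" if "s \<in> S" for s using subgroup.mem_carrier[OF S that] .
  interpret S: fin_group ?S
    using subgroup_imp_group[OF S] finite_subgroup[OF S] by (simp add: fin_group_def fin_group_axioms_def)
  have solS: "solvable ?S"
    by (rule group_hom.inj_hom_imp_solvable[OF canonical_inj_is_hom[OF S] _ sol]) simp
  have H0: "subgroup H0 G" "H0 \<subseteq> S" "H0 \<noteq> {\<one>}" using frob unfolding frobenius_with_iff[OF S] by blast+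
  then have "carrier ?S \<noteq> {\<one>\<^bsub>?S\<^esub>}" using subgroup.one_closed[OF H0(1)] by auto
  then obtain V r where V: "S.min_normal V r" using S.min_normal_exists[OF solS] by blast
  have Vn: "V \<lhd> ?S" and V1: "V \<noteq> {\<one>}" using V by (auto simp: S.min_normal_def)
  define F where "F = S.cent V"
  have VS: "V \<subseteq> S" using subgroup.subset[OF normal_imp_subgroup[OF Vn]] by simp
  have Fs: "subgroup F ?S" unfolding F_def using S.cent_subgroup VS by simp
  have cj: "S.cj g x = cj g x" if "g \<in> S" for g x using that S unfolding S.cj_def cj_def by simp
  have st: "subgroup H ?S \<and> H \<noteq> {\<one>\<^bsub>?S\<^esub>} \<and> H \<noteq> carrier ?S \<and>
      (\<forall>g \<in> carrier ?S. \<forall>h \<in> H. h \<noteq> \<one>\<^bsub>?S\<^esub> \<longrightarrow> S.cj g h \<in> H \<longrightarrow> g \<in> H) \<and> K = (S - (\<Union>g \<in> S. cj g ` H)) \<union> {\<one>}"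
    if "frobenius_with ?S K H" for K H
    using that frobenius_with_iff[OF S] cj subgroup_incl[OF _ S] by simp
  have "frobenius_subgroup G S F {H. \<exists>K. frobenius_with ?S K H}"
  proof (intro frobenius_subgroup.intro fin_group_axioms frobenius_subgroup_axioms.intro)
    show "subgroup F G" using incl_subgroup[OF S Fs] .
    show "F \<subseteq> S" using subgroup.subset[OF Fs] by simp
    show "\<exists>v\<in>F. v \<noteq> \<one> \<and> (\<forall>f\<in>F. f \<otimes> v = v \<otimes> f)"
    proof -
      obtain v where v: "v \<in> V" "v \<noteq> \<one>" using V1 subgroup.one_closed[OF normal_imp_subgroup[OF Vn]] by auto
      have "v \<in> F" using V v VS by (auto simp: F_def S.cent_def S.min_normal_def)
      moreover have "f \<otimes> v = v \<otimes> f" if "f \<in> F" for f using that v by (simp add: F_def S.cent_def)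
      ultimately show ?thesis using v by blast
    qed
  next
    fix K H assume KH: "frobenius_with ?S K H"
    have "(carrier ?S - (\<Union>g \<in> carrier ?S. S.cj g ` H)) \<union> {\<one>\<^bsub>?S\<^esub>} = S.cent V"
      by (rule S.malnormal_structure(3)[OF solS V, of H]) (use st[OF KH] in auto)
    then show "K = F" using st[OF KH] cj by (simp add: F_def)
  next
    fix H assume "H \<in> {H. \<exists>K. frobenius_with ?S K H}"
    then obtain K where KH: "frobenius_with ?S K H" by blast
    have *: "subgroup H ?S" "H \<noteq> {\<one>\<^bsub>?S\<^esub>}" "H \<noteq> carrier ?S"
      "\<And>g h. g \<in> carrier ?S \<Longrightarrow> h \<in> H \<Longrightarrow> h \<noteq> \<one>\<^bsub>?S\<^esub> \<Longrightarrow> S.cj g h \<in> H \<Longrightarrow> g \<in> H"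
      using st[OF KH] by blast+
    note mal = S.malnormal_structure[OF solS V *(1-3)]
    have "S.cent V \<inter> H = {\<one>\<^bsub>?S\<^esub>}" by (rule mal(1)) (rule *(4))
    then show "F \<inter> H = {\<one>}" by (simp add: F_def)
    have "S.fpf H (S.cent V)" by (rule mal(6)) (rule *(4))
    then show "fpf H F" by (simp add: F_def fpf_def S.fpf_def)
    have "card H < card (S.cent V)" by (rule mal(5)) (rule *(4))
    then show "card H < card F" by (simp add: F_def)
    show "\<exists>f \<in> F. \<exists>h \<in> H. g = f \<otimes> h" if "g \<in> S" for g
    proof -
      have "\<exists>f \<in> S.cent V. \<exists>h \<in> H. g = f \<otimes>\<^bsub>?S\<^esub> h" by (rule mal(2)) (rule *(4), use that in simp_all)
      then show ?thesis by (simp add: F_def)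
    qed
    have "\<exists>t \<in> H. t \<noteq> \<one>\<^bsub>?S\<^esub> \<and> (\<forall>h \<in> H. \<forall>p::nat. prime p \<longrightarrow> h [^]\<^bsub>?S\<^esub> p = \<one>\<^bsub>?S\<^esub> \<longrightarrow> h \<otimes>\<^bsub>?S\<^esub> t = t \<otimes>\<^bsub>?S\<^esub> h)"
      by (rule mal(4)) (rule *(4))
    then show "\<exists>t \<in> H. t \<noteq> \<one> \<and> (\<forall>h \<in> H. \<forall>p::nat. prime p \<longrightarrow> h [^] p = \<one> \<longrightarrow> h \<otimes> t = t \<otimes> h)"
      by (simp flip: nat_pow_consistent)
  qed (use S frob in auto)
  then show ?thesis by blast
qed

context frobenius_subgroup
begin

lemma S_carrier: "s \<in> S \<Longrightarrow> s \<in> carrier G"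
  using subgroup.mem_carrier[OF S] .

lemma F_carrier: "s \<in> F \<Longrightarrow> s \<in> carrier G"
  using subgroup.mem_carrier[OF F(1)] .

lemma \<H>D:
  assumes "H \<in> \<H>"
  shows "subgroup H G" "H \<subseteq> S" "H \<noteq> {\<one>}" "H \<noteq> S" "\<And>g h. g \<in> S \<Longrightarrow> h \<in> H \<Longrightarrow> h \<noteq> \<one> \<Longrightarrow> cj g h \<in> H \<Longrightarrow> g \<in> H"
    "F = (S - (\<Union>g \<in> S. cj g ` H)) \<union> {\<one>}"
proof -
  obtain K where K: "frobenius_with (G\<lparr>carrier := S\<rparr>) K H" using assms \<H>_def by blast
  then have "K = F" by (rule kernel)
  then show "subgroup H G" "H \<subseteq> S" "H \<noteq> {\<one>}" "H \<noteq> S" "\<And>g h. g \<in> S \<Longrightarrow> h \<in> H \<Longrightarrow> h \<noteq> \<one> \<Longrightarrow> cj g h \<in> H \<Longrightarrow> g \<in> H"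
    "F = (S - (\<Union>g \<in> S. cj g ` H)) \<union> {\<one>}"
    using K unfolding frobenius_with_iff[OF S] by blast+
qed

lemma H_carrier: "H \<in> \<H> \<Longrightarrow> h \<in> H \<Longrightarrow> h \<in> carrier G"
  using subgroup.mem_carrier[OF \<H>D(1)] .

lemma commuting_in_complement:
  assumes "H \<in> \<H>" "g \<in> S" "h \<in> H" "h \<noteq> \<one>" "g \<otimes> h = h \<otimes> g"
  shows "g \<in> H"
  using \<H>D(5)[OF assms(1-4)] cj_fix_iff[OF S_carrier[OF assms(2)] H_carrier[OF assms(1,3)]] assms by simp

lemma conj_complement:
  assumes H: "H \<in> \<H>" and s: "s \<in> S"
  shows "cj s ` H \<in> \<H>"
proof -
  have sc: "s \<in> carrier G" using S_carrier s .
  have si: "inv s \<in> S" using s S subgroup.m_inv_closed by metis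
  have sub: "cj s ` H \<subseteq> S"
  proof clarify
    fix h assume "h \<in> H"
    then show "cj s h \<in> S" using \<H>D(2)[OF H] s cj_closed_subgroup[OF S] by blast
  qed
  have "frobenius_with (G\<lparr>carrier := S\<rparr>) ((S - (\<Union>g \<in> S. cj g ` cj s ` H)) \<union> {\<one>}) (cj s ` H)"
    unfolding frobenius_with_iff[OF S]
  proof (intro conjI ballI impI refl)
    show "subgroup (cj s ` H) G"
    proof (rule subgroupI)
      show "inv a \<in> cj s ` H" if "a \<in> cj s ` H" for a
        using that H_carrier[OF H] sc subgroup.m_inv_closed[OF \<H>D(1)[OF H]] by (auto simp flip: cj_inv)
      show "a \<otimes> b \<in> cj s ` H" if "a \<in> cj s ` H" "b \<in> cj s ` H" for a b
        using that H_carrier[OF H] sc subgroup.m_closed[OF \<H>D(1)[OF H]] by (auto simp flip: cj_mult)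
    qed (use subgroup.one_closed[OF \<H>D(1)[OF H]] sub S_carrier in auto)
    have eqH: "cj (inv s) ` cj s ` H = H" using H_carrier[OF H] sc by (force simp: image_image)
    show "cj s ` H \<noteq> {\<one>}"
    proof
      assume "cj s ` H = {\<one>}"
      then show False using eqH sc \<H>D(3)[OF H] by simp
    qed
    show "cj s ` H \<noteq> S"
    proof
      assume eq: "cj s ` H = S"
      have "S \<subseteq> H"
      proof
        fix x assume "x \<in> S"
        then have "cj s x \<in> cj s ` H" using cj_closed_subgroup[OF S s] eq by simp
        then show "x \<in> H" using sc S_carrier[OF \<open>x \<in> S\<close>] H_carrier[OF H] by auto
      qed
      then show False using \<H>D(2,4)[OF H] by blast
    qed
    fix g h assume g: "g \<in> S" and h: "h \<in> cj s ` H" "h \<noteq> \<one>" "cj g h \<in> cj s ` H"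
    obtain k where k: "k \<in> H" "h = cj s k" using h by blast
    have "cj (inv s \<otimes> g \<otimes> s) k = cj (inv s) (cj g h)" using k H_carrier[OF H] sc S_carrier[OF g] by (simp add: cj_cj m_assoc)
    also have "\<dots> \<in> H" using h(3) eqH by blast
    finally have "inv s \<otimes> g \<otimes> s \<in> H"
      using \<H>D(5)[OF H _ k(1), of "inv s \<otimes> g \<otimes> s"] k h(2) sc S g s si cj_eq_one_iff[OF sc H_carrier[OF H k(1)]]
      by (auto simp: subgroup.m_closed)
    moreover have "g = cj s (inv s \<otimes> g \<otimes> s)" using sc S_carrier[OF g] by (simp add: cj_def m_assoc)
    ultimately show "g \<in> cj s ` H" by blast
  qed (use sub in auto)
  then show ?thesis unfolding \<H>_def by blast
qed

text \<open>The kernel is what the conjugates of one complement leave over, and these conjugates are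
  complements.\<close>

lemma cover: "s \<in> S \<Longrightarrow> s \<in> F \<or> (\<exists>H \<in> \<H>. s \<in> H)"
proof -
  assume s: "s \<in> S"
  obtain H where H: "H \<in> \<H>" using \<H>_nonempty by blast
  then show ?thesis using \<H>D(6)[OF H] conj_complement[OF H] s by blast
qed

text \<open>\<open>x\<close> is a power of \<open>h\<close> of prime order.\<close>

lemma hub_path:
  assumes H: "H \<in> \<H>" and t: "t \<in> H" "\<forall>h \<in> H. \<forall>p::nat. prime p \<longrightarrow> h [^] p = \<one> \<longrightarrow> h \<otimes> t = t \<otimes> h"
    and h: "h \<in> H" "h \<noteq> \<one>"
  obtains x where "x \<in> H" "x \<noteq> \<one>" "x \<otimes> h = h \<otimes> x" "x \<otimes> t = t \<otimes> x"
  using prime_order_power_in_subgroup[OF \<H>D(1)[OF H] h] t by metis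

text \<open>Nontrivial elements of \<open>H\<close> are linked through the hub by a chain
  \<open>x, a, t, b, h\<close> of commuting neighbours, and \<open>H'\<close> contains with each
  nontrivial element everything in \<open>S\<close> that commutes with it.\<close>

lemma complement_unique:
  assumes H: "H \<in> \<H>" "H' \<in> \<H>" and x: "x \<in> H" "x \<in> H'" "x \<noteq> \<one>"
  shows "H = H'"
proof -
  have "H \<subseteq> H'" if H: "H \<in> \<H>" "H' \<in> \<H>" and x: "x \<in> H" "x \<in> H'" for H H'
  proof
    fix h assume h: "h \<in> H"
    obtain t where t: "t \<in> H" "t \<noteq> \<one>" "\<forall>h \<in> H. \<forall>p::nat. prime p \<longrightarrow> h [^] p = \<one> \<longrightarrow> h \<otimes> t = t \<otimes> h"
      using hub[OF H(1)] by blast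
    note HS = \<H>D(2)[OF H(1)]
    note step = commuting_in_complement[OF H(2)]
    show "h \<in> H'"
    proof (cases "h = \<one>")
      case False
      obtain a where a: "a \<in> H" "a \<noteq> \<one>" "a \<otimes> x = x \<otimes> a" "a \<otimes> t = t \<otimes> a" using hub_path[OF H(1) t(1,3) x(1) assms(5)] .
      obtain b where b: "b \<in> H" "b \<noteq> \<one>" "b \<otimes> h = h \<otimes> b" "b \<otimes> t = t \<otimes> b" using hub_path[OF H(1) t(1,3) h False] .
      have "a \<in> H'" using step[OF _ x(2) assms(5) a(3)] a HS by blast
      then have "t \<in> H'" using step[OF _ _ a(2), of t] a t HS by auto
      then have "b \<in> H'" using step[OF _ _ t(2), of b] b HS by auto
      then show ?thesis using step[OF _ _ b(2), of h] b h HS by auto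
    qed (use subgroup.one_closed[OF \<H>D(1)[OF H(2)]] in simp)
  qed
  then show ?thesis using assms by blast
qed

end

section \<open>Components for Frobenius and 2-Frobenius groups\<close>

context group
begin

text \<open>Reflexive on nontrivial elements, so walks may pause, and a path of length at most
  \<open>n\<close> counts as a walk of length exactly \<open>n\<close>.\<close>

definition gstep :: "'a \<Rightarrow> 'a \<Rightarrow> bool" where
  "gstep x y \<longleftrightarrow> x \<in> carrier G \<and> y \<in> carrier G \<and> x \<noteq> \<one> \<and> y \<noteq> \<one> \<and> x \<otimes> y = y \<otimes> x"

abbreviation reach :: "'a \<Rightarrow> 'a \<Rightarrow> bool" where
  "reach \<equiv> gstep\<^sup>*\<^sup>*"

lemma gstep_sym: "gstep x y \<Longrightarrow> gstep y x"
  unfolding gstep_def by metis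

lemma reach_sym: "reach x y \<Longrightarrow> reach y x"
  by (induction rule: rtranclp_induct) (auto intro: converse_rtranclp_into_rtranclp gstep_sym)

lemma reach_closed:
  assumes "reach x y" "x \<in> T" "\<And>x y. x \<in> T \<Longrightarrow> gstep x y \<Longrightarrow> y \<in> T"
  shows "y \<in> T"
  using assms by (induction) auto

text \<open>\<open>R\<close> is the component that contains the kernel; each \<open>H\<close>
  without the identity is another one. The bound on \<open>card H\<close> keeps automorphisms from
  mapping \<open>R\<close> into a complement.\<close>

definition component_system :: "'a set set \<Rightarrow> 'a set \<Rightarrow> bool" where
  "component_system \<H> R \<longleftrightarrow> \<H> \<noteq> {} \<and> R \<noteq> {} \<and> R \<subseteq> carrier G - {\<one>} \<and> carrier G - {\<one>} \<subseteq> R \<union> \<Union>\<H> \<and>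
    (\<forall>x \<in> R. \<forall>y. reach x y \<longleftrightarrow> y \<in> R) \<and>
    (\<forall>H \<in> \<H>. subgroup H G \<and> H \<noteq> {\<one>} \<and> card H \<le> card R \<and> (\<forall>x \<in> H - {\<one>}. \<forall>y. reach x y \<longleftrightarrow> y \<in> H - {\<one>}))"

end

context frobenius_subgroup
begin

lemma reach_in_complement:
  assumes H: "H \<in> \<H>" and xy: "x \<in> H" "x \<noteq> \<one>" "y \<in> H" "y \<noteq> \<one>"
  shows "reach x y"
proof -
  obtain t where t: "t \<in> H" "t \<noteq> \<one>" "\<forall>h \<in> H. \<forall>p::nat. prime p \<longrightarrow> h [^] p = \<one> \<longrightarrow> h \<otimes> t = t \<otimes> h"
    using hub[OF H] by blast
  have "reach h t" if h: "h \<in> H" "h \<noteq> \<one>" for h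
  proof -
    obtain a where a: "a \<in> H" "a \<noteq> \<one>" "a \<otimes> h = h \<otimes> a" "a \<otimes> t = t \<otimes> a"
      using hub_path[OF H t(1,3) h] .
    have "gstep a h" "gstep a t" using a t h H_carrier[OF H] unfolding gstep_def by blast+
    then show ?thesis using gstep_sym by (meson converse_rtranclp_into_rtranclp r_into_rtranclp)
  qed
  then show ?thesis using xy reach_sym by (meson rtranclp_trans)
qed

lemma reach_in_kernel:
  assumes "x \<in> F" "x \<noteq> \<one>" "y \<in> F" "y \<noteq> \<one>"
  shows "reach x y"
proof -
  obtain v where v: "v \<in> F" "v \<noteq> \<one>" "\<forall>f \<in> F. f \<otimes> v = v \<otimes> f" using center by blast
  then have "gstep x v" "gstep y v" using assms F_carrier unfolding gstep_def by blast+
  then show ?thesis using gstep_sym by (meson converse_rtranclp_into_rtranclp r_into_rtranclp)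
qed

text \<open>\<open>closed\<close> concerns centralisers in all of \<open>G\<close>, not just in
  \<open>S\<close>. It makes the complements closed under steps, and by symmetry of the relation
  also the set outside them.\<close>

lemma component_systemI:
  assumes closed: "\<And>H g h. H \<in> \<H> \<Longrightarrow> g \<in> carrier G \<Longrightarrow> h \<in> H \<Longrightarrow> h \<noteq> \<one> \<Longrightarrow> g \<otimes> h = h \<otimes> g \<Longrightarrow> g \<in> H"
    and conn: "\<And>g. g \<in> carrier G \<Longrightarrow> \<forall>H \<in> \<H>. g \<notin> H \<Longrightarrow> \<exists>f \<in> F. f \<noteq> \<one> \<and> reach g f"
  shows "component_system \<H> (carrier G - \<Union>\<H>)"
proof -
  let ?R = "carrier G - \<Union>\<H>"
  have one: "\<one> \<in> H" if "H \<in> \<H>" for H using subgroup.one_closed[OF \<H>D(1)[OF that]] .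
  have FR: "F - {\<one>} \<subseteq> ?R" using FH F_carrier by blast
  have Rclosed: "y \<in> ?R" if "x \<in> ?R" "gstep x y" for x y
    using that closed[of _ x y] unfolding gstep_def by blast
  have Rreach: "reach x y" if xy: "x \<in> ?R" "y \<in> ?R" for x y
  proof -
    obtain f g where "f \<in> F" "f \<noteq> \<one>" "reach x f" "g \<in> F" "g \<noteq> \<one>" "reach y g"
      using conn[of x] conn[of y] xy by blast
    then show ?thesis using reach_in_kernel[of f g] reach_sym[of y g] by (meson rtranclp_trans)
  qed
  obtain v where v: "v \<in> F" "v \<noteq> \<one>" using center by blast
  show ?thesis unfolding component_system_def
  proof (intro conjI ballI allI)
    show "\<H> \<noteq> {}" by (rule \<H>_nonempty)
    show "?R \<noteq> {}" using v FR by blast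
    show "?R \<subseteq> carrier G - {\<one>}" using one \<H>_nonempty by blast
    show "carrier G - {\<one>} \<subseteq> ?R \<union> \<Union>\<H>" by blast
    show "reach x y \<longleftrightarrow> y \<in> ?R" if "x \<in> ?R" for x y
      using Rreach[OF that] reach_closed[OF _ that, of y] Rclosed by blast
    fix H assume H: "H \<in> \<H>"
    show "subgroup H G" "H \<noteq> {\<one>}" using \<H>D[OF H] by blast+
    \<comment> \<open>The strict inequality between \<open>H\<close> and \<open>F\<close> pays for
      the removed identity.\<close>
    have "card H \<le> card (F - {\<one>})"
      using card[OF H] subgroup.one_closed[OF F(1)] finite_subgroup[OF F(1)] by (simp add: card_Diff_singleton)
    also have "\<dots> \<le> card ?R" using FR fin by (intro card_mono) auto
    finally show "card H \<le> card ?R" .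
    show "reach x y \<longleftrightarrow> y \<in> H - {\<one>}" if x: "x \<in> H - {\<one>}" for x y
    proof
      assume "reach x y"
      then show "y \<in> H - {\<one>}"
      proof (rule reach_closed[OF _ x])
        fix a b assume "a \<in> H - {\<one>}" "gstep a b"
        then show "b \<in> H - {\<one>}" using closed[OF H, of b a] unfolding gstep_def by (metis Diff_iff singletonD)
      qed
    qed (use x reach_in_complement[OF H] in blast)
  qed
qed

end

context fin_group
begin

lemma frobenius_components:
  assumes sol: "solvable G" and frob: "frobenius_with G K H"
  shows "\<exists>R. component_system {H. \<exists>K. frobenius_with G K H} R"
proof -
  let ?H = "{H. \<exists>K. frobenius_with (G\<lparr>carrier := carrier G\<rparr>) K H}"
  have "frobenius_with (G\<lparr>carrier := carrier G\<rparr>) K H" using frob by simp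
  then obtain F where "frobenius_subgroup G (carrier G) F ?H"
    using frobenius_subgroup_exists[OF sol subgroup_self] by blast
  then interpret D: frobenius_subgroup G "carrier G" F ?H .
  have "component_system ?H (carrier G - \<Union>?H)"
  proof (rule D.component_systemI)
    fix g assume g: "g \<in> carrier G" "\<forall>H \<in> ?H. g \<notin> H"
    obtain H where "H \<in> ?H" using D.\<H>_nonempty by blast
    then have "g \<noteq> \<one>" using g subgroup.one_closed[OF D.\<H>D(1)] by metis
    moreover have "g \<in> F" using D.cover[OF g(1)] g(2) by blast
    ultimately show "\<exists>f \<in> F. f \<noteq> \<one> \<and> reach g f" by blast
  qed (rule D.commuting_in_complement)
  then show ?thesis by (metis (no_types) partial_object.surjective partial_object.update_convs(1))
qed

lemma cj_image_image:
  assumes "g \<in> carrier G" "h \<in> carrier G" "H \<subseteq> carrier G"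
  shows "cj g ` cj h ` H = cj (g \<otimes> h) ` H"
  using assms by (auto simp: image_image cj_cj subset_iff)

lemma cj_image_one: "H \<subseteq> carrier G \<Longrightarrow> cj \<one> ` H = H"
  by (force simp: subset_iff)

text \<open>Beyond the Frobenius group \<open>K <#> L\<close>, two things are needed: centralisers
  of nontrivial elements of \<open>L\<close> stay in \<open>L\<close>, and elements outside
  \<open>K <#> L\<close> reach the kernel. Both use that, in the Frobenius group
  \<open>L <#> M\<close>, a conjugate of a nontrivial element of \<open>M\<close> commutes with no
  nontrivial element of \<open>L\<close>.\<close>

lemma two_frobenius_components:
  assumes sol: "solvable G" and tf: "two_frobenius G K L M"
  shows "\<exists>R. component_system {H. \<exists>K'. frobenius_with (G\<lparr>carrier := K <#> L\<rparr>) K' H} R"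
proof -
  let ?S = "K <#> L" and ?T = "L <#> M"
  let ?H = "{H. \<exists>K'. frobenius_with (G\<lparr>carrier := ?S\<rparr>) K' H}"
  have Kn: "K \<lhd> G" and Sn: "?S \<lhd> G" and Ls: "subgroup L G" and Ms: "subgroup M G" and Ts: "subgroup ?T G"
    and car: "carrier G = ?S <#> M" and frob1: "frobenius_with (G\<lparr>carrier := ?S\<rparr>) K L"
    and frob2: "frobenius_with (G\<lparr>carrier := ?T\<rparr>) L M"
    using tf by (auto simp: two_frobenius_def)
  have Ks: "subgroup K G" and Ss: "subgroup ?S G" using Kn Sn normal_imp_subgroup by blast+
  obtain F where "frobenius_subgroup G ?S F ?H" using frobenius_subgroup_exists[OF sol Ss frob1] by blast
  then interpret D: frobenius_subgroup G ?S F ?H .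
  have KF: "K = F" using D.kernel[OF frob1] .
  have LH: "L \<in> ?H" using frob1 by blast
  have Kc: "k \<in> carrier G" if "k \<in> K" for k using subgroup.mem_carrier[OF Ks that] .
  have Lc: "k \<in> carrier G" if "k \<in> L" for k using subgroup.mem_carrier[OF Ls that] .
  have Mc: "k \<in> carrier G" if "k \<in> M" for k using subgroup.mem_carrier[OF Ms that] .
  have Tc: "k \<in> carrier G" if "k \<in> ?T" for k using subgroup.mem_carrier[OF Ts that] .
  have Lsub: "L \<subseteq> carrier G" using Lc by blast
  have KS: "K \<subseteq> ?S" using D.F KF by simp
  have KL: "k = \<one>" if "k \<in> K" "k \<in> L" for k using D.FH[OF LH] that KF by blast
  have Mt: "M \<noteq> {\<one>}" "M \<subseteq> ?T" "L = (?T - (\<Union>g \<in> ?T. cj g ` M)) \<union> {\<one>}"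
    and Mmal: "\<And>g h. g \<in> ?T \<Longrightarrow> h \<in> M \<Longrightarrow> h \<noteq> \<one> \<Longrightarrow> cj g h \<in> M \<Longrightarrow> g \<in> M"
    using frob2 unfolding frobenius_with_iff[OF Ts] by blast+
  have LT: "L \<subseteq> ?T" using Mt(3) subgroup.one_closed[OF Ts] by blast
  have fac: "\<exists>k \<in> K. \<exists>m \<in> ?T. g = k \<otimes> m" if g: "g \<in> carrier G" for g
  proof -
    obtain k l m where "k \<in> K" "l \<in> L" "m \<in> M" "g = k \<otimes> l \<otimes> m" using g car by (auto simp: set_mult_def)
    then show ?thesis using Kc Lc Mc by (auto simp: set_mult_def m_assoc)
  qed
  have LM: "l = \<one>" if "l \<in> L" "u \<in> ?T" "x \<in> M" "l = cj u x" for l u x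
    using that Mt(3) by blast
  \<comment> \<open>\<open>L\<close> is what the conjugates of \<open>M\<close> leave over in
    \<open>?T\<close>, a description that is invariant under \<open>?T\<close>.\<close>
  have Lnorm: "cj m l \<in> L" if m: "m \<in> ?T" and l: "l \<in> L" for m l
  proof (rule ccontr)
    assume n: "cj m l \<notin> L"
    have mc: "m \<in> carrier G" "l \<in> carrier G" using m l Tc Lc by auto
    have "cj m l \<in> ?T" using cj_closed_subgroup[OF Ts m] l LT by blast
    then obtain u x where ux: "u \<in> ?T" "x \<in> M" "cj m l = cj u x" using n Mt(3) by blast
    have "l = cj (inv m) (cj m l)" using mc by simp
    also have "\<dots> = cj (inv m \<otimes> u) x" unfolding ux(3) using ux(1,2) mc Tc Mc by (simp add: cj_cj)
    finally have "l = \<one>" using LM[OF l _ ux(2), of "inv m \<otimes> u"] ux m Ts by (simp add: subgroup.m_closed subgroup.m_inv_closed)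
    then show False using n mc subgroup.one_closed[OF Ls] by simp
  qed
  have Limg: "cj m ` L = L" if m: "m \<in> ?T" for m
  proof (rule card_subset_eq)
    show "card (cj m ` L) = card L" using Tc[OF m] Lc by (intro card_image) (auto simp: inj_on_def)
  qed (use finite_subgroup[OF Ls] Lnorm[OF m] in auto)
  have KL1: "k = \<one>" if "k \<in> K" "l \<in> L" "l \<noteq> \<one>" "cj k l \<in> L" for k l
    using D.\<H>D(5)[OF LH _ that(2,3,4)] that KS KL by blast
  \<comment> \<open>Malnormality of \<open>M\<close> puts \<open>l\<close> into the conjugate of
    \<open>M\<close> by \<open>u\<close>, and such conjugates meet \<open>L\<close>
    trivially.\<close>
  have MLcomm: "l = \<one>" if u: "u \<in> ?T" and x: "x \<in> M" "x \<noteq> \<one>" and l: "l \<in> L" "l \<otimes> cj u x = cj u x \<otimes> l" for u x l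
  proof -
    have c: "u \<in> carrier G" "x \<in> carrier G" "l \<in> carrier G" using u x l Tc Mc Lc by auto
    have "cj (inv u \<otimes> l \<otimes> u) x = cj (inv u) (cj l (cj u x))" using c by (simp add: cj_cj m_assoc)
    also have "cj l (cj u x) = cj u x" using cj_fix_iff[of l "cj u x"] c l(2) by simp
    also have "cj (inv u) (cj u x) = x" using c by simp
    finally have "inv u \<otimes> l \<otimes> u \<in> M"
      using Mmal[of "inv u \<otimes> l \<otimes> u" x] x u l LT Ts by (auto simp: subgroup.m_closed subgroup.m_inv_closed subset_iff)
    moreover have "l = cj u (inv u \<otimes> l \<otimes> u)" using c by (simp add: cj_def m_assoc)
    ultimately show ?thesis using LM[OF l(1) u] by blast
  qed
  \<comment> \<open>Write \<open>g = k m\<close>. Conjugation by \<open>m\<close> keeps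
    \<open>l\<close> in \<open>L\<close>, and only a trivial \<open>k\<close> can send the result
    back into \<open>L\<close>. So \<open>g\<close> lies in \<open>?T\<close>, and
    \<open>MLcomm\<close> excludes everything outside \<open>L\<close>.\<close>
  have clL: "g \<in> L" if g: "g \<in> carrier G" and l: "l \<in> L" "l \<noteq> \<one>" "g \<otimes> l = l \<otimes> g" for g l
  proof -
    obtain k m where km: "k \<in> K" "m \<in> ?T" "g = k \<otimes> m" using fac[OF g] by blast
    have c: "k \<in> carrier G" "m \<in> carrier G" "l \<in> carrier G" using km l Kc Tc Lc by auto
    have "cj k (cj m l) = l" using cj_fix_iff[OF g c(3)] l(3) km(3) c by (simp add: cj_cj)
    then have "k = \<one>" using KL1[OF km(1) Lnorm[OF km(2) l(1)]] l c by auto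
    then have gT: "g \<in> ?T" using km c by simp
    show ?thesis
    proof (rule ccontr)
      assume "g \<notin> L"
      then obtain u x where ux: "u \<in> ?T" "x \<in> M" "g = cj u x" using gT Mt(3) by blast
      have "x \<noteq> \<one>" using \<open>g \<notin> L\<close> subgroup.one_closed[OF Ls] ux Tc by auto
      then show False using MLcomm[OF ux(1,2) _ l(1)] l ux(3) by simp
    qed
  qed
  \<comment> \<open>Complements that share a nontrivial element coincide, so each complement is a
    conjugate of \<open>L\<close> and the claim is carried over from \<open>L\<close>.\<close>
  have closed: "g \<in> H" if H: "H \<in> ?H" and g: "g \<in> carrier G" and h: "h \<in> H" "h \<noteq> \<one>" "g \<otimes> h = h \<otimes> g" for H g h
  proof -
    have "h \<in> ?S" "h \<notin> F" using D.\<H>D(2)[OF H] D.FH[OF H] h by blast+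
    then obtain u where u: "u \<in> ?S" "h \<in> cj u ` L" using D.\<H>D(6)[OF LH] by blast
    have uc: "u \<in> carrier G" using D.S_carrier[OF u(1)] .
    have HL: "H = cj u ` L" using D.complement_unique[OF H D.conj_complement[OF LH u(1)] h(1) u(2) h(2)] .
    obtain l where l: "l \<in> L" "h = cj u l" using u by blast
    have lc: "l \<in> carrier G" using Lc l by blast
    have gu: "g = cj u (cj (inv u) g)" using uc g by simp
    have "cj (inv u) g \<otimes> l = l \<otimes> cj (inv u) g"
      using cj_comm_iff[of u "cj (inv u) g" l] uc g lc h(3) l(2) by simp
    moreover have "l \<noteq> \<one>" using h l uc by auto
    ultimately have "cj (inv u) g \<in> L" using clL[OF _ l(1)] uc g by simp
    then show ?thesis using gu HL by blast
  qed
  have fixK: "\<exists>f \<in> K. f \<noteq> \<one> \<and> y \<otimes> f = f \<otimes> y"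
    if y: "y \<in> carrier G" "y \<notin> ?S" "prime (s::nat)" "y [^] s = \<one>" for y s
  proof (cases "s dvd card K")
    case True
    have "\<exists>f \<in> K. f \<noteq> \<one> \<and> cj y f = f"
    proof (rule exists_other_fixed_point[OF finite_subgroup[OF Ks] y(3) _ _ True subgroup.one_closed[OF Ks]])
      show "(cj y ^^ s) f = f" if "f \<in> K" for f using that Kc y by (simp add: cj_funpow)
    qed (use cj_normal[OF Kn] y in auto)
    then show ?thesis using cj_fix_iff[OF y(1) Kc] by blast
  next
    case False
    have nonL: "\<exists>l \<in> L. l \<noteq> \<one>" using D.\<H>D(3)[OF LH] subgroup.one_closed[OF Ls] by blast
    \<comment> \<open>Only the identity of \<open>K\<close> normalises \<open>L\<close>, so there
      are \<open>card K\<close> of these conjugates. They are permuted by \<open>y\<close>, whose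
      prime \<open>s\<close> does not divide their number, so \<open>y\<close> fixes one of
      them.\<close>
    let ?C = "(\<lambda>k. cj k ` L) ` K"
    have keq: "k = \<one>" if "k \<in> K" "cj k ` L = L" for k using nonL KL1[OF that(1)] that(2) by blast
    have "inj_on (\<lambda>k. cj k ` L) K"
    proof (rule inj_onI)
      fix k k' assume k: "k \<in> K" "k' \<in> K" "cj k ` L = cj k' ` L"
      have "cj (inv k' \<otimes> k) ` L = cj (inv k') ` cj k ` L" using k(1,2) Kc Lsub by (simp add: cj_image_image)
      also have "\<dots> = cj (inv k') ` cj k' ` L" by (simp only: k(3))
      also have "\<dots> = L" using k(2) Kc Lsub by (simp add: cj_image_image cj_image_one)
      finally have "inv k' \<otimes> k = \<one>" using keq k Ks by (simp add: subgroup.m_closed subgroup.m_inv_closed)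
      then show "k = k'" using k Kc by (metis inv_closed inv_equality inv_inv)
    qed
    then have cardL: "\<not> s dvd card ?C" using False by (simp add: card_image)
    obtain k1 m1 where km1: "k1 \<in> K" "m1 \<in> ?T" "y = k1 \<otimes> m1" using fac[OF y(1)] by blast
    have "\<exists>Y \<in> ?C. image (cj y) Y = Y"
    proof (rule exists_fixed_point[OF _ y(3) _ _ cardL])
      show "finite ?C" using finite_subgroup[OF Ks] by simp
      show "image (cj y) ` ?C \<subseteq> ?C"
      proof clarify
        fix k assume k: "k \<in> K"
        have c: "k \<in> carrier G" "k1 \<in> carrier G" "m1 \<in> carrier G" using k km1 Kc Tc by auto
        have "y \<otimes> k = cj y k \<otimes> k1 \<otimes> m1" using c km1 by (simp add: cj_def m_assoc inv_mult_group)
        then have "cj y ` cj k ` L = cj (cj y k \<otimes> k1) ` cj m1 ` L"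
          using c y Lsub by (simp add: cj_image_image)
        also have "cj m1 ` L = L" using Limg km1 by blast
        finally have "cj y ` cj k ` L = cj (cj y k \<otimes> k1) ` L" .
        moreover have "cj y k \<otimes> k1 \<in> K" using cj_normal[OF Kn y(1) k] km1 Ks by (simp add: subgroup.m_closed)
        ultimately show "cj y ` cj k ` L \<in> ?C" by blast
      qed
      show "(image (cj y) ^^ s) Y = Y" if "Y \<in> ?C" for Y
      proof -
        have Yc: "Y \<subseteq> carrier G" using that Kc Lc by auto
        have "(image (cj y) ^^ n) Y = cj (y [^] n) ` Y" for n
          using Yc by (induction n) (auto simp: cj_image_image y simp flip: nat_pow_Suc2 intro!: image_eqI)
        then show ?thesis using y(4) Yc by (auto simp: subset_iff)
      qed
    qed
    then obtain k where k: "k \<in> K" "cj y ` cj k ` L = cj k ` L" by blast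
    have kc: "k \<in> carrier G" using Kc k by blast
    define y' where "y' = inv k \<otimes> y \<otimes> k"
    have y'c: "y' \<in> carrier G" using kc y by (simp add: y'_def)
    have yy': "y = cj k y'" using kc y by (simp add: y'_def cj_def m_assoc)
    have "cj (inv k) ` cj y ` cj k ` L = cj (inv k) ` cj k ` L" using k(2) by simp
    then have y'L: "cj y' ` L = L" using kc y(1) Lsub by (simp add: cj_image_image cj_image_one y'_def m_assoc)
    obtain k2 m2 where km2: "k2 \<in> K" "m2 \<in> ?T" "y' = k2 \<otimes> m2" using fac[OF y'c] by blast
    have "cj k2 ` cj m2 ` L = L" using y'L km2 Kc Tc Lsub by (simp add: cj_image_image)
    then have "k2 = \<one>" using Limg[OF km2(2)] keq[OF km2(1)] by simp
    then have y'T: "y' \<in> ?T" using km2 Tc by simp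
    have "y' \<notin> ?S" using yy' y(2) cj_normal[OF Sn kc] by blast
    then have "y' \<notin> L" using D.\<H>D(2)[OF LH] by blast
    then obtain u x where ux: "u \<in> ?T" "x \<in> M" "y' = cj u x" using y'T Mt(3) by blast
    have x1: "x \<noteq> \<one>" using \<open>y' \<notin> L\<close> subgroup.one_closed[OF Ls] ux Tc by auto
    obtain V where V: "subgroup V G" "V \<subseteq> K" "\<not> V \<subseteq> {\<one>}" "\<And>a b. a \<in> V \<Longrightarrow> b \<in> V \<Longrightarrow> a \<otimes> b \<otimes> inv (b \<otimes> a) \<in> {\<one>}"
      "\<And>n d. n \<in> carrier G \<Longrightarrow> cj n ` K \<subseteq> K \<Longrightarrow> d \<in> V \<Longrightarrow> cj n d \<in> V"
      by (rule abelian_section_of_normalised[OF sol Ks, of "{\<one>}"]) (use D.center KF in blast)+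
    obtain B where B: "subgroup B G" "B \<subseteq> L" "\<not> B \<subseteq> {\<one>}" "\<And>a b. a \<in> B \<Longrightarrow> b \<in> B \<Longrightarrow> a \<otimes> b \<otimes> inv (b \<otimes> a) \<in> {\<one>}"
      "\<And>n d. n \<in> carrier G \<Longrightarrow> cj n ` L \<subseteq> L \<Longrightarrow> d \<in> B \<Longrightarrow> cj n d \<in> B"
      by (rule abelian_section_of_normalised[OF sol Ls, of "{\<one>}"]) (use nonL in blast)+
    have Vn: "V \<lhd> G"
    proof (rule normal_invI[OF V(1)])
      show "n \<otimes> v \<otimes> inv n \<in> V" if "n \<in> carrier G" "v \<in> V" for n v
        using V(5)[OF that(1) _ that(2)] cj_normal[OF Kn that(1)] unfolding cj_def by blast
    qed
    have Vab: "a \<otimes> b = b \<otimes> a" if "a \<in> V" "b \<in> V" for a b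
      using V(4)[OF that] commutator_one_iff[of a b] that V(2) Kc by auto
    have Bab: "a \<otimes> b = b \<otimes> a" if "a \<in> B" "b \<in> B" for a b
      using B(4)[OF that] commutator_one_iff[of a b] that B(2) Lc by auto
    \<comment> \<open>Without fixed points on \<open>V\<close>, the element \<open>y'\<close> would
      commute with the abelian group \<open>B\<close> inside \<open>L\<close>; but \<open>y'\<close>
      is a conjugate of a nontrivial element of \<open>M\<close>.\<close>
    have "\<exists>v \<in> V. v \<noteq> \<one> \<and> y' \<otimes> v = v \<otimes> y'"
    proof (rule ccontr)
      assume n: "\<not> ?thesis"
      obtain b where b: "b \<in> B" "b \<noteq> \<one>" using B(3) by blast
      have "y' \<otimes> b = b \<otimes> y'"
      proof (rule commutes_if_fixed_point_free[OF Vn Vab _ B(1) Bab _ y'c _ y(3) _ _ b(1)])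
        show "V \<noteq> {\<one>}" using V(3) by blast
        show "fpf B V" using fpf_mono[OF D.fpf[OF LH] B(2)] V(2) KF by blast
        have "cj k (y' [^] s) = \<one>" using cj_pow[OF kc y'c, of s] yy' y(4) by simp
        then show "y' [^] s = \<one>" using kc y'c by simp
        show "v = \<one>" if "v \<in> V" "y' \<otimes> v = v \<otimes> y'" for v using n that by blast
        show "cj y' e \<in> B" if "e \<in> B" for e using B(5)[OF y'c _ that] y'L by blast
      qed
      then have "b = \<one>" using MLcomm[OF ux(1,2) x1, of b] b B(2) ux(3) by auto
      then show False using b by blast
    qed
    then obtain v where v: "v \<in> V" "v \<noteq> \<one>" "y' \<otimes> v = v \<otimes> y'" by blast
    have vK: "v \<in> K" using v V(2) by blast
    have "y \<otimes> cj k v = cj k v \<otimes> y" using cj_comm_iff[OF kc y'c Kc[OF vK]] v(3) yy' by simp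
    moreover have "cj k v \<noteq> \<one>" using v kc Kc[OF vK] by simp
    ultimately show ?thesis using cj_normal[OF Kn kc vK] by blast
  qed
  have "component_system ?H (carrier G - \<Union>?H)"
  proof (rule D.component_systemI[OF closed])
    fix g assume g: "g \<in> carrier G" "\<forall>H \<in> ?H. g \<notin> H"
    have g1: "g \<noteq> \<one>" using g(2) LH subgroup.one_closed[OF Ls] by blast
    show "\<exists>f \<in> F. f \<noteq> \<one> \<and> reach g f"
    proof (cases "g \<in> ?S")
      case True
      then show ?thesis using D.cover g g1 by blast
    next
      case False
      obtain s k :: nat where sk: "prime s" "g [^] k \<noteq> \<one>" "(g [^] k) [^] s = \<one>" using prime_power_exists[OF g(1) g1] by blast
      let ?y = "g [^] k"
      have comm: "?y \<otimes> g = g \<otimes> ?y" using comm_pow[OF g(1) g(1) refl] .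
      have yc: "?y \<in> carrier G" using g by simp
      have step: "gstep g ?y" using g g1 sk yc comm unfolding gstep_def by metis
      show ?thesis
      proof (cases "?y \<in> ?S")
        case True
        have "?y \<notin> H" if "H \<in> ?H" for H using closed[OF that g(1) _ sk(2) comm[symmetric]] g(2) that by blast
        then show ?thesis using D.cover[OF True] step sk(2) by blast
      next
        case False
        then obtain f where f: "f \<in> K" "f \<noteq> \<one>" "?y \<otimes> f = f \<otimes> ?y" using fixK[OF yc _ sk(1,3)] by blast
        then have "gstep ?y f" using yc Kc sk(2) unfolding gstep_def by blast
        then show ?thesis using step f KF by (meson converse_rtranclp_into_rtranclp r_into_rtranclp)
      qed
    qed
  qed
  then show ?thesis by blast
qed

end

section \<open>Cyclic normal subgroups\<close>

text \<open>Bezout represents \<open>gcd j s\<close>, which is a unit modulo \<open>n\<close>, so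
  some multiple of it reaches \<open>k\<close>. The summand \<open>n * t\<close> is the surplus of a
  congruence modulo \<open>n\<close> written in natural numbers.\<close>

lemma coprime_gcd_combination:
  fixes j s n k :: nat
  assumes c: "coprime (gcd j s) n" and n: "n > 0" and s: "s > 0"
  shows "\<exists>m i t. j * m + s * i = k + n * t"
proof -
  let ?g = "gcd j s"
  have "\<exists>m i t. j * m + s * i = ?g + n * t"
  proof (cases "j = 0")
    case True
    then show ?thesis by (intro exI[of _ 0] exI[of _ 1]) auto
  next
    case False
    then obtain m i where mi: "j * m = s * i + ?g" using bezout_nat[of j s] by blast
    \<comment> \<open>\<open>i * (n - 1)\<close> serves as \<open>-i\<close> modulo
      \<open>n\<close>.\<close>
    obtain n' where n': "n = Suc n'" using n by (cases n) auto
    have "j * m + s * (i * n') = ?g + n * (s * i)" using mi n' by (simp add: algebra_simps)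
    then show ?thesis by blast
  qed
  then obtain m i t where mit: "j * m + s * i = ?g + n * t" by blast
  have "?g \<noteq> 0" using s by simp
  from bezout_nat[OF this, of n] obtain x y where "?g * x = n * y + gcd ?g n" by blast
  then have x: "?g * x = n * y + 1" using c by simp
  have "j * (m * (x * k)) + s * (i * (x * k)) = (j * m + s * i) * (x * k)" by (simp add: algebra_simps)
  also have "\<dots> = (?g + n * t) * (x * k)" by (simp only: mit)
  also have "\<dots> = (?g * x) * k + n * (t * (x * k))" by (simp add: algebra_simps)
  also have "\<dots> = (n * y + 1) * k + n * (t * (x * k))" by (simp only: x)
  also have "\<dots> = k + n * (y * k + t * (x * k))" by (simp add: algebra_simps)
  finally show ?thesis by blast
qed

text \<open>Take for \<open>i\<close> the product of the primes that divide \<open>n\<close> but not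
  \<open>j\<close>. A prime divisor of \<open>n\<close> that divides \<open>j\<close> divides
  neither \<open>s\<close> nor \<open>i\<close>; any other one divides \<open>i\<close> but not
  \<open>j\<close>.\<close>

lemma coprime_in_progression:
  fixes j s n :: nat
  assumes c: "coprime (gcd j s) n" and n: "n > 0"
  shows "\<exists>i. coprime (j + s * i) n"
proof
  define P where "P = {l. prime l \<and> l dvd n \<and> \<not> l dvd j}"
  define i where "i = \<Prod>P"
  have finP: "finite P" using n by (intro finite_subset[of P "{..n}"]) (auto simp: P_def dvd_imp_le)
  show "coprime (j + s * i) n"
  proof (rule ccontr)
    assume "\<not> coprime (j + s * i) n"
    then have "gcd (j + s * i) n \<noteq> 1" by (simp add: coprime_iff_gcd_eq_1)
    then obtain l where "prime l" "l dvd gcd (j + s * i) n" using prime_factor_nat by blast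
    then have l: "prime l" "l dvd j + s * i" "l dvd n" by auto
    show False
    proof (cases "l dvd j")
      case True
      then have "l dvd s * i" using l(2) dvd_add_right_iff by blast
      moreover have "\<not> l dvd s"
      proof
        assume "l dvd s"
        then have "l dvd gcd j s" using True by simp
        then show False using c l by (meson coprime_common_divisor not_prime_unit)
      qed
      ultimately have "l dvd \<Prod>P" using l(1) prime_dvd_mult_iff unfolding i_def by blast
      then obtain l' where "l' \<in> P" "l dvd l'" using prime_dvd_prod_iff[OF finP l(1), of "\<lambda>x. x"] by auto
      then have "l = l'" using l(1) primes_dvd_imp_eq[of l l'] by (simp add: P_def)
      then show False using True \<open>l' \<in> P\<close> by (simp add: P_def)
    next
      case False
      then have "l dvd i" unfolding i_def using l finP by (intro dvd_prodI) (auto simp: P_def)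
      then show False using l(2) False dvd_add_left_iff by (metis dvd_mult)
    qed
  qed
qed

context group
begin

text \<open>\<open>c\<close> is the commutator that appears when \<open>y\<close> and
  \<open>z\<close> are exchanged. Sorting the \<open>k\<close>-fold product takes
  \<open>k * (k - 1) div 2\<close> exchanges.\<close>

lemma class_two_power:
  assumes y: "y \<in> carrier G" and z: "z \<in> carrier G" and c: "c \<in> carrier G"
    and yz: "y \<otimes> z = z \<otimes> y \<otimes> c" and cy: "c \<otimes> y = y \<otimes> c" and cz: "c \<otimes> z = z \<otimes> c"
  shows "y [^] (k::nat) \<otimes> z = z \<otimes> y [^] k \<otimes> c [^] k"
    and "(z \<otimes> y) [^] k = z [^] k \<otimes> y [^] k \<otimes> c [^] (k * (k - 1) div 2)"
proof -
  have *: "y [^] k \<otimes> z = z \<otimes> y [^] k \<otimes> c [^] k" for k :: nat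
  proof (induction k)
    case (Suc k)
    have ck: "c [^] k \<otimes> y = y \<otimes> c [^] k" using comm_pow[OF c y cy] .
    have "y [^] Suc k \<otimes> z = y [^] k \<otimes> (y \<otimes> z)" using y z by (simp add: m_assoc)
    also have "\<dots> = (y [^] k \<otimes> z) \<otimes> y \<otimes> c" using y z c by (simp add: yz m_assoc)
    also have "\<dots> = z \<otimes> y [^] k \<otimes> (c [^] k \<otimes> y) \<otimes> c" using y z c by (simp add: Suc m_assoc)
    also have "\<dots> = z \<otimes> y [^] Suc k \<otimes> c [^] Suc k" using y z c by (simp add: ck m_assoc)
    finally show ?case .
  qed (use y z c in simp)
  show "y [^] k \<otimes> z = z \<otimes> y [^] k \<otimes> c [^] k" by (rule *)
  show "(z \<otimes> y) [^] k = z [^] k \<otimes> y [^] k \<otimes> c [^] (k * (k - 1) div 2)"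
  proof (induction k)
    case (Suc k)
    let ?T = "k * (k - 1) div 2"
    have T: "Suc k * (Suc k - 1) div 2 = k + ?T"
      by (cases k) (auto simp: algebra_simps)
    have ct: "c [^] ?T \<otimes> z = z \<otimes> c [^] ?T" "c [^] (k + ?T) \<otimes> y = y \<otimes> c [^] (k + ?T)"
      using comm_pow[OF c z cz] comm_pow[OF c y cy] by blast+
    have "(z \<otimes> y) [^] Suc k = z [^] k \<otimes> y [^] k \<otimes> (c [^] ?T \<otimes> z) \<otimes> y" using y z c by (simp add: Suc m_assoc)
    also have "\<dots> = z [^] k \<otimes> (y [^] k \<otimes> z) \<otimes> c [^] ?T \<otimes> y"
      unfolding ct(1) using y z c by (simp add: m_assoc)
    also have "\<dots> = z [^] Suc k \<otimes> y [^] k \<otimes> (c [^] (k + ?T) \<otimes> y)"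
      using y z c by (simp add: * m_assoc nat_pow_mult[symmetric])
    also have "\<dots> = z [^] Suc k \<otimes> y [^] Suc k \<otimes> c [^] (Suc k * (Suc k - 1) div 2)"
      unfolding T ct(2) using y z c by (simp add: m_assoc)
    finally show ?case .
  qed (use y z c in simp)
qed

text \<open>Natural exponents suffice for the cyclic subgroup, because inverses are powers in a
  finite group.\<close>

definition powers :: "'a \<Rightarrow> 'a set" where
  "powers a = range (\<lambda>i::nat. a [^] i)"

lemma powersI [intro]: "a [^] (i::nat) \<in> powers a"
  by (simp add: powers_def)

end

context fin_group
begin

lemma powers_subgroup: "a \<in> carrier G \<Longrightarrow> subgroup (powers a) G"
proof (rule subgroupI)
  assume a: "a \<in> carrier G"
  show "powers a \<noteq> {}" by blast
  show "powers a \<subseteq> carrier G" using a by (auto simp: powers_def)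
  show "x \<otimes> y \<in> powers a" if "x \<in> powers a" "y \<in> powers a" for x y
    using that a by (auto simp: powers_def nat_pow_mult)
  fix x assume "x \<in> powers a"
  then obtain i :: nat where i: "x = a [^] i" by (auto simp: powers_def)
  have "inv x = x [^] (ord x - 1)"
    using inv_eq_pow[of x "ord x"] a i ord_ge_1[OF fin, of x] by (simp add: Suc_le_eq)
  then show "inv x \<in> powers a" using a i by (simp add: nat_pow_pow powers_def)
qed

lemma powers_self: "a \<in> carrier G \<Longrightarrow> a \<in> powers a"
  using powersI[of a 1] by simp

lemma powers_subset: "subgroup S G \<Longrightarrow> a \<in> S \<Longrightarrow> powers a \<subseteq> S"
  using pow_closed_subgroup by (auto simp: powers_def)

lemma coprime_power_generates:
  assumes "a \<in> carrier G" "coprime k (ord a)"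
  shows "a \<in> powers (a [^] (k::nat))"
proof (cases "k = 0")
  case True
  then have "ord a = 1" using assms by simp
  then show ?thesis using assms ord_eq_1 subgroup.one_closed[OF powers_subgroup] by (metis nat_pow_closed)
next
  case False
  from bezout_nat[OF this, of "ord a"] obtain e y where "k * e = ord a * y + gcd k (ord a)" by blast
  then have "(a [^] k) [^] e = a [^] (ord a * y) \<otimes> a" using assms by (simp add: nat_pow_pow)
  also have "a [^] (ord a * y) = \<one>" using assms(1) pow_eq_id by simp
  finally have "a = (a [^] k) [^] e" using assms by simp
  then show ?thesis using powersI by metis
qed

text \<open>As \<open>L\<close> has nilpotency class two, raising to the power \<open>s\<close> is a homomorphism into the odd cyclic group \<open>\<langle>a\<rangle>\<close>,
  and its kernel has at most \<open>s\<close> elements because \<open>L\<close> acts without fixed points.\<close>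
lemma cyclic_extension:
  assumes V: "V \<lhd> G" "\<And>v w. v \<in> V \<Longrightarrow> w \<in> V \<Longrightarrow> v \<otimes> w = w \<otimes> v" "V \<noteq> {\<one>}"
    and L: "subgroup L G" "fpf L V" and a: "a \<in> L" "\<And>z. z \<in> L \<Longrightarrow> z \<otimes> a = a \<otimes> z" "odd (ord a)"
    and s: "prime (s::nat)" "\<And>z. z \<in> L \<Longrightarrow> z [^] s \<in> powers a"
    and comm: "\<And>y z. y \<in> L \<Longrightarrow> z \<in> L \<Longrightarrow> y \<otimes> z \<otimes> inv (z \<otimes> y) \<in> powers a"
  shows "\<exists>b \<in> L. L = powers b"
proof (cases "L \<subseteq> powers a")
  case True
  then show ?thesis using powers_subset[OF L(1) a(1)] a(1) by blast
next
  case False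
  then obtain u where u: "u \<in> L" "u \<notin> powers a" by blast
  have Lc: "z \<in> carrier G" if "z \<in> L" for z using subgroup.mem_carrier[OF L(1) that] .
  have ac: "a \<in> carrier G" and uc: "u \<in> carrier G" using a u Lc by blast+
  let ?n = "ord a"
  have n: "?n > 0" using ord_ge_1[OF fin ac] by simp
  have s0: "s > 0" "s > 1" using s(1) prime_gt_0_nat prime_gt_1_nat by blast+
  have apow: "a [^] i = a [^] (i + ?n * t)" for i t :: nat
  proof -
    have "a [^] (?n * t) = \<one>" using ac pow_eq_id by simp
    then show ?thesis using ac nat_pow_mult[of a i "?n * t"] by simp
  qed
  have pa: "powers a \<subseteq> L" "subgroup (powers a) G" using powers_subset[OF L(1) a(1)] powers_subgroup[OF ac] by blast+
  have apc: "z \<otimes> c = c \<otimes> z" if zc: "z \<in> L" "c \<in> powers a" for z c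
  proof -
    obtain i :: nat where "c = a [^] i" using zc by (auto simp: powers_def)
    then show ?thesis using comm_pow[OF ac Lc[OF zc(1)], of i] a(2)[OF zc(1)] by simp
  qed
  have ua: "(u [^] (m::nat) \<otimes> a [^] (i::nat)) [^] k = u [^] (m * k) \<otimes> a [^] (i * k)" for m i k :: nat
    using pow_mult_distrib[of "u [^] m" "a [^] i" k] apc[OF pow_closed_subgroup[OF L(1) u(1)] powersI] ac uc
    by (simp add: nat_pow_pow)
  obtain j :: nat where j: "u [^] s = a [^] j" using s(2)[OF u(1)] by (auto simp: powers_def)
  \<comment> \<open>If \<open>j\<close> is a multiple of \<open>s\<close> modulo \<open>?n\<close>,
    then \<open>u\<close> can be corrected by a power of \<open>a\<close> to an element of order
    \<open>s\<close> outside \<open>powers a\<close>.\<close>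
  have kill: "\<exists>d \<in> L. d \<noteq> \<one> \<and> d [^] s = \<one> \<and> d \<notin> powers a" if k: "s * k = j + ?n * t" for k t
  proof -
    let ?d = "u \<otimes> inv (a [^] k)"
    have "?d [^] s = u [^] s \<otimes> inv (a [^] (s * k))"
      using pow_mult_distrib[of u "inv (a [^] k)" s] apc[OF u(1), of "inv (a [^] k)"] pa(2) ac uc
      by (simp add: subgroup.m_inv_closed powersI nat_pow_inv nat_pow_pow mult.commute)
    also have "a [^] (s * k) = a [^] j" using apow[of j t] k by simp
    finally have "?d [^] s = \<one>" using j ac by simp
    moreover have "?d \<in> L" using u pa L(1) powersI by (metis subgroup.m_closed subgroup.m_inv_closed subset_iff)
    moreover have "?d \<notin> powers a"
    proof
      assume "?d \<in> powers a"
      then have "?d \<otimes> a [^] k \<in> powers a" using pa(2) powersI subgroup.m_closed by metis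
      then show False using u ac uc by (simp add: m_assoc)
    qed
    moreover have "\<one> \<in> powers a" using pa(2) subgroup.one_closed by blast
    ultimately show ?thesis by metis
  qed
  have unique: "w \<in> powers d" if "d \<in> L" "d \<noteq> \<one>" "d [^] s = \<one>" "w \<in> L" "w [^] s = \<one>" "d \<otimes> w = w \<otimes> d" for d w
    using power_if_fpf[OF V L that(1,4,6,3,5) s(1) that(2)] by (auto simp: powers_def)
  \<comment> \<open>A common prime divisor could only be \<open>s\<close>; then there would be
    elements of order \<open>s\<close> both inside and outside \<open>powers a\<close>, against
    \<open>unique\<close>.\<close>
  have cop: "coprime (gcd j s) ?n"
  proof (rule ccontr)
    assume "\<not> ?thesis"
    then have "gcd (gcd j s) ?n \<noteq> 1" by (simp add: coprime_iff_gcd_eq_1)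
    then obtain l where "prime l" "l dvd gcd (gcd j s) ?n" using prime_factor_nat by blast
    then have l: "prime l" "l dvd j" "l dvd s" "l dvd ?n" by auto
    then have ls: "l = s" using s(1) primes_dvd_imp_eq by blast
    obtain k where "j = s * k" using l ls by blast
    then obtain d where d: "d \<in> L" "d \<noteq> \<one>" "d [^] s = \<one>" "d \<notin> powers a" using kill[of k 0] by auto
    obtain m where m: "?n = s * m" using l ls by blast
    have "m < ?n" "m > 0" using m n s0 by auto
    then have "a [^] m \<noteq> \<one>" using ac pow_eq_id by (auto dest: nat_dvd_not_less)
    moreover have "(a [^] m) [^] s = \<one>" using ac m by (simp add: nat_pow_pow mult.commute pow_eq_id)
    ultimately have "d \<in> powers (a [^] m)"
      using unique[of "a [^] m" d] d apc[OF d(1) powersI, of m] pa(1) powersI by (metis subset_iff)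
    then show False using d(4) powers_subset[OF pa(2) powersI, of m] by blast
  qed
  \<comment> \<open>The products of powers of \<open>u\<close> and \<open>a\<close>, shown below to
    exhaust \<open>L\<close>.\<close>
  define U where "U = {u [^] m \<otimes> a [^] i | (m :: nat) (i :: nat). True}"
  have UI: "u [^] m \<otimes> a [^] i \<in> U" for m i :: nat unfolding U_def by blast
  have Uinv: "d \<in> U \<Longrightarrow> d [^] k \<in> U" for d and k :: nat unfolding U_def using ua by blast
  have UL: "U \<subseteq> L" unfolding U_def using u a pow_closed_subgroup[OF L(1)] subgroup.m_closed[OF L(1)] by blast
  have Umult: "d \<otimes> e \<in> U" if de: "d \<in> powers a \<or> d \<in> powers u" "e \<in> U" for d e
  proof -
    obtain m i :: nat where e: "e = u [^] m \<otimes> a [^] i" using de(2) by (auto simp: U_def)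
    from de(1) show ?thesis
    proof
      assume "d \<in> powers a"
      then obtain k :: nat where k: "d = a [^] k" by (auto simp: powers_def)
      have "d \<otimes> e = u [^] m \<otimes> (d \<otimes> a [^] i)"
        using apc[OF pow_closed_subgroup[OF L(1) u(1)] \<open>d \<in> powers a\<close>, of m] e k ac uc by (metis m_assoc nat_pow_closed)
      then show ?thesis using UI[of m "k + i"] k ac by (simp add: nat_pow_mult)
    next
      assume "d \<in> powers u"
      then obtain k :: nat where k: "d = u [^] k" by (auto simp: powers_def)
      then have "d \<otimes> e = u [^] (k + m) \<otimes> a [^] i" using e ac uc by (simp add: m_assoc flip: nat_pow_mult)
      then show ?thesis using UI by simp
    qed
  qed
  \<comment> \<open>\<open>z^s\<close> is a power of \<open>a\<close>, hence central in
    \<open>L\<close>; expanding its commutation with \<open>y\<close> leaves the \<open>s\<close>-th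
    power of the commutator.\<close>
  have commpow: "(y \<otimes> z \<otimes> inv (z \<otimes> y)) [^] s = \<one>" if yz: "y \<in> L" "z \<in> L" for y z
  proof -
    let ?d = "y \<otimes> z \<otimes> inv (z \<otimes> y)"
    have dp: "?d \<in> powers a" using comm yz by blast
    have zy: "z \<otimes> y \<in> L" "y \<otimes> z \<in> L" using yz subgroup.m_closed[OF L(1)] by simp_all
    have dc: "?d \<in> carrier G" using yz Lc by simp
    have "?d \<otimes> (z \<otimes> y) = y \<otimes> z" using yz Lc by (simp add: m_assoc)
    then have e: "y \<otimes> z = z \<otimes> y \<otimes> ?d" using apc[OF zy(1) dp] by simp
    have zs: "y \<otimes> z [^] s = z [^] s \<otimes> y" using apc[OF yz(1) s(2)[OF yz(2)]] .
    have e': "z \<otimes> y = y \<otimes> z \<otimes> inv ?d" using e yz Lc dc by (metis inv_solve_right m_closed)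
    have ip: "inv ?d \<in> powers a" using dp pa(2) subgroup.m_inv_closed by metis
    have eq: "z [^] s \<otimes> y = y \<otimes> z [^] s \<otimes> inv ?d [^] s"
      using class_two_power(1)[OF Lc[OF yz(2)] Lc[OF yz(1)] inv_closed[OF dc] e'
          apc[OF yz(2) ip, symmetric] apc[OF yz(1) ip, symmetric]] .
    have "y \<otimes> z [^] s \<otimes> inv ?d [^] s = y \<otimes> z [^] s" by (rule trans[OF eq[symmetric] zs[symmetric]])
    then have "inv ?d [^] s = \<one>"
      using l_cancel_one[of "y \<otimes> z [^] s" "inv ?d [^] s"] Lc[OF yz(1)] Lc[OF yz(2)] dc by blast
    then show ?thesis using dc by (simp add: nat_pow_inv)
  qed
  have powhom: "(z \<otimes> y) [^] s = z [^] s \<otimes> y [^] s" if yz: "y \<in> L" "z \<in> L" for y z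
  proof -
    let ?d = "y \<otimes> z \<otimes> inv (z \<otimes> y)"
    have dp: "?d \<in> powers a" using comm yz by blast
    have zy: "z \<otimes> y \<in> L" using yz subgroup.m_closed[OF L(1)] by simp
    have dc: "?d \<in> carrier G" using yz Lc by simp
    have "?d \<otimes> (z \<otimes> y) = y \<otimes> z" using yz Lc by (simp add: m_assoc)
    then have e: "y \<otimes> z = z \<otimes> y \<otimes> ?d" using apc[OF zy dp] by simp
    \<comment> \<open>For odd \<open>s\<close> the exponent is a multiple of \<open>s\<close>. For
      \<open>s = 2\<close> the order of the commutator divides both 2 and the odd number
      \<open>?n\<close>; this is what excludes quaternion groups.\<close>
    have "?d [^] (s * (s - 1) div 2) = \<one>"
    proof (cases "s = 2")
      case True
      obtain i :: nat where "?d = a [^] i" using dp by (auto simp: powers_def)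
      then have "?d [^] ?n = \<one>" using ac by (simp add: nat_pow_pow pow_eq_id)
      moreover have "coprime 2 ?n" using a(3) by simp
      ultimately have "?d = \<one>" using eq_one_if_coprime_pows[OF dc commpow[OF yz]] True by blast
      then show ?thesis by simp
    next
      case False
      then have "odd s" using s(1) prime_odd_nat s0 by (metis Suc_lessI One_nat_def numeral_2_eq_2)
      then have "s * (s - 1) div 2 = s * ((s - 1) div 2)" by (simp add: div_mult_swap)
      then show ?thesis using commpow[OF yz] dc by (metis nat_pow_one nat_pow_pow)
    qed
    then have "(z \<otimes> y) [^] s = z [^] s \<otimes> y [^] s \<otimes> \<one>"
      using class_two_power(2)[OF Lc[OF yz(1)] Lc[OF yz(2)] dc e apc[OF yz(1) dp, symmetric] apc[OF yz(2) dp, symmetric], of s]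
      by (simp only:)
    then show ?thesis using Lc[OF yz(1)] Lc[OF yz(2)] by simp
  qed
  have LU: "z \<in> U" if z: "z \<in> L" for z
  proof -
    obtain k :: nat where k: "z [^] s = a [^] k" using s(2)[OF z] by (auto simp: powers_def)
    \<comment> \<open>The element \<open>y\<close> of \<open>U\<close> is chosen to have the same
      \<open>s\<close>-th power as \<open>z\<close>, so that \<open>?w\<close> lies in the kernel of
      the power map.\<close>
    obtain m i t where mit: "j * m + s * i = k + ?n * t" using coprime_gcd_combination[OF cop n s0(1)] by blast
    define y where "y = u [^] m \<otimes> a [^] i"
    have yL: "y \<in> L" "y \<in> U" using UI UL by (auto simp: y_def)
    have "y [^] s = (u [^] s) [^] m \<otimes> a [^] (i * s)" using ua[of m i s] uc by (simp add: y_def nat_pow_pow mult.commute)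
    also have "\<dots> = a [^] (j * m + s * i)" using j ac by (simp add: nat_pow_pow nat_pow_mult mult.commute)
    also have "\<dots> = z [^] s" using k mit apow[of k t] by simp
    finally have ys: "y [^] s = z [^] s" .
    let ?w = "z \<otimes> inv y"
    have iy: "inv y \<in> L" using yL L(1) subgroup.m_inv_closed by metis
    have wL: "?w \<in> L" using z iy L(1) subgroup.m_closed by metis
    have ws: "?w [^] s = \<one>" using powhom[OF iy z] ys Lc[OF yL(1)] Lc[OF z] by (simp add: nat_pow_inv)
    have zw: "z = ?w \<otimes> y" using Lc[OF yL(1)] Lc[OF z] by (simp add: m_assoc)
    \<comment> \<open>The kernel consists of powers of a single element of order \<open>s\<close>.
      It is found in \<open>powers a\<close> if \<open>s\<close> divides \<open>?n\<close>, and as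
      \<open>u\<close> times a power of \<open>a\<close> otherwise.\<close>
    show ?thesis
    proof (cases "s dvd ?n")
      case True
      then obtain m where m: "?n = s * m" by blast
      have "m < ?n" "m > 0" using m n s0 by auto
      then have "a [^] m \<noteq> \<one>" using ac pow_eq_id by (auto dest: nat_dvd_not_less)
      moreover have "(a [^] m) [^] s = \<one>" using ac m by (simp add: nat_pow_pow mult.commute pow_eq_id)
      ultimately have "?w \<in> powers (a [^] m)"
        using unique[of "a [^] m" ?w] wL ws apc[OF wL powersI, of m] pa(1) powersI by (metis subset_iff)
      then have "?w \<in> powers a" using powers_subset[OF pa(2) powersI, of m] by blast
      then show ?thesis using Umult yL(2) zw by metis
    next
      case False
      then have sn: "coprime s ?n" using s(1) prime_imp_coprime by blast
      have ab: "y \<otimes> z = z \<otimes> y" if yz: "y \<in> L" "z \<in> L" for y z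
      proof -
        have dc: "y \<otimes> z \<otimes> inv (z \<otimes> y) \<in> carrier G" using yz Lc by simp
        obtain i :: nat where "y \<otimes> z \<otimes> inv (z \<otimes> y) = a [^] i" using comm[OF yz] by (auto simp: powers_def)
        then have "(y \<otimes> z \<otimes> inv (z \<otimes> y)) [^] ?n = \<one>" using ac by (simp add: nat_pow_pow pow_eq_id)
        then have "y \<otimes> z \<otimes> inv (z \<otimes> y) = \<one>" using eq_one_if_coprime_pows[OF dc commpow[OF yz] _ sn] by blast
        then show ?thesis using commutator_one_iff yz Lc by blast
      qed
      \<comment> \<open>The number \<open>?n * j - j\<close> represents \<open>-j\<close> modulo
        \<open>?n\<close>, so \<open>i'\<close> solves \<open>s * i' = -j\<close> modulo
        \<open>?n\<close>.\<close>
      have "coprime (gcd 0 s) ?n" using sn by simp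
      then obtain m' i' t' where mit': "0 * m' + s * i' = (?n * j - j) + ?n * t'"
        using coprime_gcd_combination[of 0 s ?n "?n * j - j"] n s0(1) by blast
      have "j \<le> ?n * j" using n by simp
      then have "s * i' + j = ?n * j + ?n * t'" using mit' by linarith
      then have mi': "s * i' + j = ?n * (j + t')" by (simp add: distrib_left)
      let ?d = "u [^] (1::nat) \<otimes> a [^] i'"
      have "?d [^] s = u [^] s \<otimes> a [^] (i' * s)" using ua[of 1 i' s] by simp
      also have "\<dots> = a [^] (s * i' + j)" using j ac by (simp add: nat_pow_mult add.commute mult.commute)
      also have "\<dots> = \<one>" using mi' ac pow_eq_id by simp
      finally have ds: "?d [^] s = \<one>" .
      have d1: "?d \<noteq> \<one>"
      proof
        assume "?d = \<one>"
        then have "u = inv (a [^] i')" using uc ac by (metis inv_equality inv_inv nat_pow_closed nat_pow_eone)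
        then show False using u(2) pa(2) subgroup.m_inv_closed powersI by metis
      qed
      have dL: "?d \<in> L" "?d \<in> U" using UI[of 1 i'] UL by auto
      have "?w \<in> powers ?d" using unique[OF dL(1) d1 ds wL ws ab[OF dL(1) wL]] .
      then have "?w \<in> U" using Uinv[OF dL(2)] by (auto simp: powers_def)
      then obtain m0 i0 :: nat where w: "?w = u [^] m0 \<otimes> a [^] i0" by (auto simp: U_def)
      have "z = u [^] m0 \<otimes> (a [^] i0 \<otimes> y)" using zw w uc ac Lc[OF yL(1)] by (metis m_assoc nat_pow_closed)
      then show ?thesis using Umult yL(2) powersI by metis
    qed
  qed
  \<comment> \<open>With this exponent prime to \<open>?n\<close>, the \<open>s\<close>-th power of
    \<open>b\<close> generates \<open>powers a\<close>, so both \<open>a\<close> and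
    \<open>u\<close> are powers of \<open>b\<close>.\<close>
  obtain i where i: "coprime (j + s * i) ?n" using coprime_in_progression[OF cop n] by blast
  define b where "b = u [^] (1::nat) \<otimes> a [^] i"
  have bL: "b \<in> L" unfolding b_def using UI UL by blast
  have bs: "subgroup (powers b) G" using powers_subgroup Lc bL by blast
  have "b [^] s = a [^] (j + s * i)"
    using ua[of 1 i s] j ac by (simp add: b_def nat_pow_mult mult.commute)
  then have "a \<in> powers (b [^] s)" using coprime_power_generates[OF ac i] by simp
  then have ab: "a \<in> powers b" using powers_subset[OF bs powersI, of s] by blast
  have "u = b \<otimes> inv (a [^] i)" using uc ac by (simp add: b_def m_assoc)
  then have ub: "u \<in> powers b"
    using powers_self[OF Lc[OF bL]] pow_closed_subgroup[OF bs ab] bs by (metis subgroup.m_closed subgroup.m_inv_closed)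
  have "U \<subseteq> powers b" unfolding U_def
    using pow_closed_subgroup[OF bs ab] pow_closed_subgroup[OF bs ub] subgroup.m_closed[OF bs] by blast
  then have "L = powers b" using LU powers_subset[OF L(1) bL] by blast
  then show ?thesis using bL by blast
qed

end

section \<open>Normalisers of subgroups of prime order\<close>

context fin_group
begin

text \<open>The normaliser of \<open>powers y\<close>: in a finite group it is enough that the
  generator is sent into the subgroup.\<close>

definition pnorm :: "'a \<Rightarrow> 'a set" where
  "pnorm y = {n \<in> carrier G. cj n y \<in> powers y}"

lemma cj_powers:
  assumes "y \<in> carrier G" "n \<in> pnorm y" "z \<in> powers y"
  shows "cj n z \<in> powers y"
proof -
  obtain i :: nat where "z = y [^] i" using assms(3) by (auto simp: powers_def)
  then show ?thesis
    using assms pow_closed_subgroup[OF powers_subgroup[OF assms(1)], of "cj n y" i] by (simp add: pnorm_def cj_pow)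
qed

lemma pnorm_subgroup:
  assumes y: "y \<in> carrier G"
  shows "subgroup (pnorm y) G"
proof (rule subgroupI)
  have pc: "z \<in> carrier G" if "z \<in> powers y" for z using subgroup.mem_carrier[OF powers_subgroup[OF y] that] .
  show "pnorm y \<subseteq> carrier G" by (auto simp: pnorm_def)
  show "pnorm y \<noteq> {}" using y powers_self by (auto simp: pnorm_def intro!: exI[of _ \<one>])
  show "a \<otimes> b \<in> pnorm y" if ab: "a \<in> pnorm y" "b \<in> pnorm y" for a b
    using cj_powers[OF y ab(1), of "cj b y"] ab y by (auto simp: pnorm_def cj_cj)
  fix a assume a: "a \<in> pnorm y"
  then have ac: "a \<in> carrier G" by (simp add: pnorm_def)
  have "cj a ` powers y = powers y"
  proof (rule endo_inj_surj)
    show "finite (powers y)" using finite_subgroup powers_subgroup y by blast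
    show "cj a ` powers y \<subseteq> powers y" using cj_powers[OF y a] by blast
    show "inj_on (cj a) (powers y)" using ac pc by (auto simp: inj_on_def)
  qed
  then obtain z where "z \<in> powers y" "y = cj a z" using powers_self[OF y] by (metis imageE)
  then have "cj (inv a) y \<in> powers y" using ac pc by simp
  then show "inv a \<in> pnorm y" using ac by (simp add: pnorm_def)
qed

lemma comm_in_pnorm: "n \<in> carrier G \<Longrightarrow> y \<in> carrier G \<Longrightarrow> n \<otimes> y = y \<otimes> n \<Longrightarrow> n \<in> pnorm y"
  using powers_self cj_fix_iff[of n y] by (simp add: pnorm_def)

lemma powers_commute: "y \<in> carrier G \<Longrightarrow> n \<in> carrier G \<Longrightarrow> n \<otimes> y = y \<otimes> n \<Longrightarrow> z \<in> powers y \<Longrightarrow> n \<otimes> z = z \<otimes> n"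
  using comm_pow[of y n] by (auto simp: powers_def)

lemma powers_abelian: "y \<in> carrier G \<Longrightarrow> w \<in> powers y \<Longrightarrow> z \<in> powers y \<Longrightarrow> w \<otimes> z = z \<otimes> w"
  using powers_commute[of y w z] powers_commute[of y y w] subgroup.mem_carrier[OF powers_subgroup] by metis

text \<open>A conjugate of \<open>t\<close> under \<open>N\<close> is a conjugate under
  \<open>F\<close> of a power of \<open>t\<close>, which gives the factors. For the intersection,
  \<open>[m, t]\<close> lies in \<open>F\<close> and in \<open>powers t\<close>, so it commutes with
  \<open>t\<close> and is trivial; then \<open>m\<close> itself commutes with
  \<open>t\<close>.\<close>

lemma frattini_factorisation:
  assumes N: "subgroup N G" and F: "subgroup F G" "F \<subseteq> N" "\<And>n f. n \<in> N \<Longrightarrow> f \<in> F \<Longrightarrow> cj n f \<in> F"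
    and t: "t \<in> N" "t [^] q = \<one>" "prime (q::nat)" "t \<noteq> \<one>"
    and free: "\<And>f. f \<in> F \<Longrightarrow> t \<otimes> f = f \<otimes> t \<Longrightarrow> f = \<one>"
    and conj: "\<And>n. n \<in> N \<Longrightarrow> \<exists>f \<in> F. \<exists>i::nat. cj n t = f \<otimes> t [^] i"
  shows "\<And>n. n \<in> N \<Longrightarrow> \<exists>k \<in> F. \<exists>m \<in> N \<inter> pnorm t. n = k \<otimes> m" and "F \<inter> pnorm t = {\<one>}"
proof -
  have N_carrier: "n \<in> carrier G" if "n \<in> N" for n using subgroup.mem_carrier[OF N that] .
  have tc: "t \<in> carrier G" using N_carrier t by blast
  show "\<exists>k \<in> F. \<exists>m \<in> N \<inter> pnorm t. n = k \<otimes> m" if n: "n \<in> N" for n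
  proof -
    obtain f i where fi: "f \<in> F" "cj n t = f \<otimes> t [^] (i::nat)" using conj[OF n] by blast
    obtain k where k: "k \<in> F" "cj n t = cj k (t [^] i)"
      using frattini_prime_order[OF N F t free n fi(2,1)] by blast
    have kc: "k \<in> carrier G" using k F N_carrier by blast
    have "cj (inv k \<otimes> n) t = cj (inv k) (cj n t)" using kc N_carrier n tc by (simp add: cj_cj)
    also have "\<dots> = t [^] i" using k(2) kc tc by simp
    finally have "inv k \<otimes> n \<in> pnorm t" using kc N_carrier n by (simp add: pnorm_def powersI)
    moreover have "inv k \<otimes> n \<in> N" using k(1) F(2) n N by (metis subgroup.m_closed subgroup.m_inv_closed subset_iff)
    moreover have "n = k \<otimes> (inv k \<otimes> n)" using kc N_carrier n by simp
    ultimately show ?thesis using k(1) by blast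
  qed
  have "m = \<one>" if m: "m \<in> F" "m \<in> pnorm t" for m
  proof -
    have mc: "m \<in> carrier G" using m F N_carrier by blast
    obtain i :: nat where i: "cj m t = t [^] i" using m(2) by (auto simp: pnorm_def powers_def)
    let ?z = "m \<otimes> cj t (inv m)"
    have zF: "?z \<in> F" using m(1) F t by (simp add: subgroup.m_closed subgroup.m_inv_closed)
    have "?z = cj m t \<otimes> inv t" using mc tc by (simp add: cj_def m_assoc)
    then have "?z \<in> powers t"
      using i powersI powers_self[OF tc] powers_subgroup[OF tc] by (metis subgroup.m_closed subgroup.m_inv_closed)
    then have "t \<otimes> ?z = ?z \<otimes> t" using powers_commute[OF tc tc refl] by blast
    then have "?z = \<one>" using free zF by blast
    then have "cj t m = m" using mc tc cj_inv by (metis cj_closed inv_closed inv_equality inv_inv)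
    then show ?thesis using free[OF m(1)] cj_fix_iff[OF tc mc] by blast
  qed
  moreover have "\<one> \<in> F" "\<one> \<in> pnorm t" using subgroup.one_closed F(1) pnorm_subgroup[OF tc] by blast+
  ultimately show "F \<inter> pnorm t = {\<one>}" by blast
qed

lemma split_frobenius:
  assumes F: "F \<lhd> G" and N: "subgroup N G" and FN: "F \<inter> N = {\<one>}" "\<And>g. g \<in> carrier G \<Longrightarrow> \<exists>k \<in> F. \<exists>n \<in> N. g = k \<otimes> n"
    and fpf: "fpf N F" and non: "F \<noteq> {\<one>}" "N \<noteq> {\<one>}"
  shows "frobenius_group G"
proof -
  have Fs: "subgroup F G" using F normal_imp_subgroup by blast
  have "F <#> N = carrier G"
  proof
    show "F <#> N \<subseteq> carrier G" using subgroup.subset[OF Fs] subgroup.subset[OF N] by (rule set_mult_closed)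
    show "carrier G \<subseteq> F <#> N" using FN(2) by (auto simp: set_mult_def)
  qed
  moreover have "frobenius_with (G\<lparr>carrier := F <#> N\<rparr>) F N"
  proof (rule frobenius_with_complement[OF Fs N _ FN(1) non fpf])
    show "cj h k \<in> F" if "h \<in> N" "k \<in> F" for h k using cj_normal[OF F subgroup.mem_carrier[OF N that(1)] that(2)] .
    show "subgroup (F <#> N) G" using \<open>F <#> N = carrier G\<close> subgroup_self by simp
  qed
  ultimately have "frobenius_with G F N" by simp
  then show ?thesis by (auto simp: frobenius_group_def)
qed

lemma cent_singleton: "cent {x} = {g \<in> carrier G. g \<otimes> x = x \<otimes> g}"
  by (auto simp: cent_def)

context
  fixes V F t N
  assumes sol: "solvable G" and V: "V \<lhd> G" and ab: "\<And>v w. v \<in> V \<Longrightarrow> w \<in> V \<Longrightarrow> v \<otimes> w = w \<otimes> v" and V1: "V \<noteq> {\<one>}"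
    and F: "F \<lhd> G" and VF: "V \<subseteq> F"
    and t: "t \<in> carrier G" "t \<noteq> \<one>" and N: "N = pnorm t"
    and fac: "\<And>g. g \<in> carrier G \<Longrightarrow> \<exists>k \<in> F. \<exists>n \<in> N. g = k \<otimes> n" and FN: "F \<inter> N = {\<one>}"
    and tV: "fpf (cent {t}) V" and nfrob: "\<not> frobenius_group G" and ntwo: "\<not> two_frobenius_group G"
begin

lemma N_subgroup: "subgroup N G"
  unfolding N using pnorm_subgroup t by blast

lemma N_carrier: "n \<in> N \<Longrightarrow> n \<in> carrier G"
  using subgroup.mem_carrier[OF N_subgroup] .

lemma F_non: "F \<noteq> {\<one>}"
  using VF V1 subgroup.one_closed[OF normal_imp_subgroup[OF V]] by blast

text \<open>Otherwise \<open>G\<close> would be a Frobenius group with kernel \<open>F\<close> and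
  complement \<open>N\<close>.\<close>

lemma N_not_fpf: "\<not> fpf N F"
proof
  assume "fpf N F"
  moreover have "N \<noteq> {\<one>}" using comm_in_pnorm[OF t(1) t(1) refl] t(2) N by blast
  ultimately show False using split_frobenius[OF F N_subgroup FN fac _ F_non] nfrob by blast
qed

text \<open>A largest cyclic normal subgroup \<open>A\<close> of \<open>N\<close> above
  \<open>t\<close> decides. In even order its involution is central in \<open>N\<close>. In odd
  order \<open>A\<close> is its own centraliser in \<open>N\<close> and absorbs \<open>x\<close> and
  all the \<open>u\<close> of the second alternative. Elements of prime order outside
  \<open>A\<close> then fix points of \<open>V\<close>; if one of them commutes with a nontrivial
  \<open>c\<close> of \<open>A\<close>, this is the second alternative, and if none does,
  \<open>G\<close> would be 2-Frobenius.\<close>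

lemma cyclic_normal_subgroup_analysis:
  assumes x: "x \<in> carrier G" "x \<noteq> \<one>" "x [^] p = \<one>" "prime (p::nat)" "x \<otimes> t = t \<otimes> x" "fpf (cent {x}) F"
  shows "(\<exists>i \<in> N. i \<noteq> \<one> \<and> (\<forall>m \<in> N. m \<otimes> i = i \<otimes> m)) \<or>
    (\<exists>c y v. c \<in> carrier G \<and> c \<noteq> \<one> \<and> y \<in> carrier G \<and> y \<noteq> \<one> \<and> v \<in> V \<and> v \<noteq> \<one> \<and> c \<otimes> y = y \<otimes> c \<and> y \<otimes> v = v \<otimes> y \<and>
      (\<forall>u l. u \<in> carrier G \<longrightarrow> u [^] l = \<one> \<longrightarrow> u \<noteq> \<one> \<longrightarrow> prime (l::nat) \<longrightarrow> u \<otimes> t = t \<otimes> u \<longrightarrow> fpf (cent {u}) F \<longrightarrow> u \<otimes> c = c \<otimes> u))"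
proof -
  have Fs: "subgroup F G" using F normal_imp_subgroup by blast
  have F_carrier: "f \<in> carrier G" if "f \<in> F" for f using subgroup.mem_carrier[OF Fs that] .
  have V_carrier: "f \<in> carrier G" if "f \<in> V" for f using that VF F_carrier by blast
  define P where "P a \<longleftrightarrow> a \<in> N \<and> N \<subseteq> pnorm a \<and> t \<in> powers a" for a
  have "P t" using comm_in_pnorm[OF t(1) t(1) refl] powers_self[OF t(1)] by (simp add: P_def N)
  moreover have "\<forall>y. P y \<longrightarrow> card (powers y) < Suc (card (carrier G))"
    using N_carrier subgroup.subset[OF powers_subgroup] fin by (auto simp: P_def less_Suc_eq_le intro: card_mono)
  ultimately obtain a where a: "P a" and max: "\<And>y. P y \<Longrightarrow> card (powers y) \<le> card (powers a)"
    using ex_has_greatest_nat[of P t "\<lambda>a. card (powers a)" "Suc (card (carrier G))"] by blast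
  have aN: "a \<in> N" "N \<subseteq> pnorm a" and ta: "t \<in> powers a" using a by (auto simp: P_def)
  have ac: "a \<in> carrier G" using N_carrier aN by blast
  define A where "A = powers a"
  have As: "subgroup A G" unfolding A_def using powers_subgroup ac by blast
  have Ac: "z \<in> carrier G" if "z \<in> A" for z using subgroup.mem_carrier[OF As that] .
  have AN: "A \<subseteq> N" unfolding A_def using powers_subset[OF N_subgroup aN(1)] .
  have aA: "a \<in> A" unfolding A_def using powers_self[OF ac] .
  have Aab: "w \<otimes> z = z \<otimes> w" if "w \<in> A" "z \<in> A" for w z using powers_abelian[OF ac] that by (simp add: A_def)
  have nA: "cj n z \<in> A" if "n \<in> N" "z \<in> A" for n z using cj_powers[OF ac] that aN by (auto simp: A_def)
  have At: "A \<subseteq> cent {t}" using Aab ta Ac by (auto simp: cent_singleton A_def)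
  have AV: "fpf A V" using fpf_mono[OF tV At order_refl] .
  have FA: "f = \<one>" if "f \<in> F" "f \<in> A" for f using that AN FN by blast
  show ?thesis
  proof (cases "even (ord a)")
    case True
    \<comment> \<open>The only involution of a cyclic group of even order is fixed by all its
      automorphisms.\<close>
    define i where "i = a [^] (ord a div 2)"
    have n0: "ord a > 0" using ord_ge_1[OF fin ac] by simp
    have i2: "i [^] (2::nat) = \<one>" using True ac by (simp add: i_def nat_pow_pow)
    have "ord a div 2 > 0" "ord a div 2 < ord a" using True n0 by (auto elim: evenE)
    then have "\<not> ord a dvd ord a div 2" using nat_dvd_not_less by blast
    then have i1: "i \<noteq> \<one>" unfolding i_def using pow_eq_id[OF ac] by simp
    have iA: "i \<in> A" unfolding i_def A_def by (rule powersI)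
    have "m \<otimes> i = i \<otimes> m" if m: "m \<in> N" for m
    proof -
      have mc: "m \<in> carrier G" using N_carrier m .
      obtain j :: nat where j: "cj m a = a [^] j" using nA[OF m aA] by (auto simp: A_def powers_def)
      have "cj m i = i [^] j" using j mc ac unfolding i_def by (simp add: cj_pow nat_pow_pow mult.commute)
      moreover have "i [^] j = (if even j then \<one> else i)"
      proof -
        have "i [^] j = i [^] (2 * (j div 2)) \<otimes> i [^] (j mod 2)" using Ac[OF iA] by (simp add: nat_pow_mult)
        also have "i [^] (2 * (j div 2)) = \<one>" using i2 Ac[OF iA] by (metis nat_pow_one nat_pow_pow)
        finally show ?thesis using Ac[OF iA] by (auto simp: odd_iff_mod_2_eq_one)
      qed
      ultimately have "cj m i = i" using i1 cj_eq_one_iff[OF mc Ac[OF iA]] by (auto split: if_splits)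
      then show ?thesis using cj_fix_iff[OF mc Ac[OF iA]] by blast
    qed
    then show ?thesis using i1 iA AN by blast
  next
    case False
    \<comment> \<open>A larger centraliser would contain an elementary abelian section
      \<open>L/A\<close>. As \<open>t\<close> is a power of \<open>a\<close>, \<open>L\<close>
      centralises \<open>t\<close> and acts on \<open>V\<close> without fixed points, so
      \<open>cyclic_extension\<close> makes it cyclic, against the choice of
      \<open>a\<close>.\<close>
    have selfcent: "z \<in> A" if z: "z \<in> N" "z \<otimes> a = a \<otimes> z" for z
    proof (rule ccontr)
      assume zA: "z \<notin> A"
      define W where "W = N \<inter> cent {a}"
      have Ws: "subgroup W G" unfolding W_def using subgroups_Inter_pair[OF N_subgroup cent_subgroup] ac by simp
      have AW: "A \<subseteq> W" using AN Aab aA Ac by (auto simp: W_def cent_singleton)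
      have zW: "z \<in> W" using z N_carrier by (simp add: W_def cent_singleton)
      obtain L s where L: "subgroup L G" "A \<subseteq> L" "L \<subseteq> W" "L \<noteq> A" "\<And>n e. n \<in> N \<Longrightarrow> e \<in> L \<Longrightarrow> cj n e \<in> L"
        "prime (s::nat)" "\<And>e. e \<in> L \<Longrightarrow> e [^] s \<in> A" "\<And>d e. d \<in> L \<Longrightarrow> e \<in> L \<Longrightarrow> d \<otimes> e \<otimes> inv (e \<otimes> d) \<in> A"
      proof (rule elementary_abelian_section[OF sol N_subgroup As Ws AW])
        show "W \<subseteq> N" by (simp add: W_def)
        show "A \<noteq> W" using zA zW by blast
        fix n w assume n: "n \<in> N" and w: "w \<in> W"
        have wN: "w \<in> N" "w \<otimes> a = a \<otimes> w" using w by (auto simp: W_def cent_singleton)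
        have ia: "cj (inv n) a \<in> A" using nA[OF subgroup.m_inv_closed[OF N_subgroup n] aA] .
        have "w \<otimes> cj (inv n) a = cj (inv n) a \<otimes> w"
          using powers_commute[OF ac N_carrier[OF wN(1)] wN(2)] ia by (simp add: A_def)
        then have "cj n w \<otimes> cj n (cj (inv n) a) = cj n (cj (inv n) a) \<otimes> cj n w"
          using cj_comm_iff[OF N_carrier[OF n] N_carrier[OF wN(1)] Ac[OF ia]] by blast
        then show "cj n w \<in> W"
          using cj_closed_subgroup[OF N_subgroup n wN(1)] N_carrier[OF n] N_carrier[OF wN(1)] ac by (simp add: W_def cent_singleton)
      qed (use nA in auto)
      have Lt: "L \<subseteq> cent {t}"
      proof
        fix w assume "w \<in> L"
        then have w: "w \<in> carrier G" "w \<otimes> a = a \<otimes> w" using L(3) by (auto simp: W_def cent_singleton)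
        then show "w \<in> cent {t}" using powers_commute[OF ac w ta] by (simp add: cent_singleton)
      qed
      have "\<exists>b \<in> L. L = powers b"
      proof (rule cyclic_extension[OF V ab V1 L(1) fpf_mono[OF tV Lt order_refl] _ _ False L(6)])
        show "w \<otimes> a = a \<otimes> w" if "w \<in> L" for w using that L(3) by (auto simp: W_def cent_singleton)
      qed (use L aA in \<open>auto simp: A_def\<close>)
      then obtain b where b: "b \<in> L" "L = powers b" by blast
      have "P b" unfolding P_def
      proof (intro conjI)
        show "b \<in> N" using b L(3) by (auto simp: W_def)
        show "N \<subseteq> pnorm b" using L(5)[OF _ b(1)] N_carrier b(2) by (auto simp: pnorm_def)
        show "t \<in> powers b" using ta L(2) b(2) by (auto simp: A_def)
      qed
      then have "card L \<le> card A" using max b by (simp add: A_def)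
      then show False using L(2,4) finite_subgroup[OF L(1)] by (metis card_seteq)
    qed
    \<comment> \<open>Such a \<open>u\<close> commutes with \<open>a\<close> because
      \<open>A\<close> is abelian and without fixed points on \<open>V\<close>; then
      \<open>selfcent\<close> applies.\<close>
    have inA: "u \<in> A" if u: "u \<in> N" "u [^] l = \<one>" "prime (l::nat)" and free: "\<And>v. v \<in> V \<Longrightarrow> u \<otimes> v = v \<otimes> u \<Longrightarrow> v = \<one>" for u l
      using commutes_if_fixed_point_free[OF V ab V1 As Aab AV N_carrier[OF u(1)] u(2,3) free nA[OF u(1)] aA] selfcent[OF u(1)] by blast
    have uA: "u \<in> A" if u: "u \<in> carrier G" "u [^] l = \<one>" "u \<noteq> \<one>" "prime (l::nat)" "u \<otimes> t = t \<otimes> u" "fpf (cent {u}) F" for u l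
    proof (rule inA[OF _ u(2,4)])
      show "u \<in> N" using comm_in_pnorm[OF u(1) t(1) u(5)] N by simp
      show "v = \<one>" if "v \<in> V" "u \<otimes> v = v \<otimes> u" for v
        using fpfD[OF u(6), of u v] that u(1,3) VF by (auto simp: cent_singleton)
    qed
    have xA: "x \<in> A" using uA[OF x(1,3,2,4,5,6)] .
    have "A \<subseteq> cent {x}" using Aab xA Ac by (auto simp: cent_singleton)
    then have AF: "fpf A F" using fpf_mono[OF x(6) _ order_refl] by blast
    define Y where "Y = {y \<in> N. y \<notin> A \<and> (\<exists>s::nat. prime s \<and> y [^] s = \<one>)}"
    \<comment> \<open>Otherwise every nontrivial element of \<open>N\<close> has a nontrivial power
      in \<open>A\<close>, and so no nontrivial fixed point in \<open>F\<close>.\<close>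
    have "Y \<noteq> {}"
    proof
      assume Y: "Y = {}"
      have "fpf N F" unfolding fpf_def
      proof (intro ballI impI)
        fix n f assume n: "n \<in> N" "n \<noteq> \<one>" and f: "f \<in> F" "n \<otimes> f = f \<otimes> n"
        obtain s k :: nat where sk: "prime s" "n [^] k \<noteq> \<one>" "(n [^] k) [^] s = \<one>"
          using prime_power_exists[OF N_carrier[OF n(1)] n(2)] by blast
        have "n [^] k \<in> A" using Y sk pow_closed_subgroup[OF N_subgroup n(1)] by (auto simp: Y_def)
        then show "f = \<one>" using fpfD[OF AF _ f(1) sk(2)] comm_pow[OF N_carrier[OF n(1)] F_carrier[OF f(1)] f(2)] by blast
      qed
      then show False using N_not_fpf by blast
    qed
    show ?thesis
    proof (cases "\<exists>y \<in> Y. \<exists>c \<in> A. c \<noteq> \<one> \<and> c \<otimes> y = y \<otimes> c")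
      case True
      then obtain y c where yc: "y \<in> Y" "c \<in> A" "c \<noteq> \<one>" "c \<otimes> y = y \<otimes> c" by blast
      obtain s :: nat where y: "y \<in> N" "y \<notin> A" "prime s" "y [^] s = \<one>" using yc(1) by (auto simp: Y_def)
      \<comment> \<open>By \<open>inA\<close>, an element of prime order outside \<open>A\<close>
        must have a nontrivial fixed point in \<open>V\<close>.\<close>
      obtain v where v: "v \<in> V" "y \<otimes> v = v \<otimes> y" "v \<noteq> \<one>" using inA[OF y(1,4,3)] y(2) by blast
      have "y \<noteq> \<one>" using y(2) subgroup.one_closed[OF As] by blast
      moreover have "u \<otimes> c = c \<otimes> u"
        if "u \<in> carrier G" "u [^] l = \<one>" "u \<noteq> \<one>" "prime (l::nat)" "u \<otimes> t = t \<otimes> u" "fpf (cent {u}) F" for u l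
        using Aab[OF uA[OF that] yc(2)] .
      ultimately show ?thesis using yc v y(1) N_carrier Ac by blast
    next
      case False
      then have YA: "c = \<one>" if "y \<in> Y" "c \<in> A" "y \<otimes> c = c \<otimes> y" for y c using that by metis
      obtain y where yY: "y \<in> Y" using \<open>Y \<noteq> {}\<close> by blast
      then obtain s :: nat where y: "y \<in> N" "y \<notin> A" "prime s" "y [^] s = \<one>" by (auto simp: Y_def)
      have yc: "y \<in> carrier G" using N_carrier y(1) .
      have y1: "y \<noteq> \<one>" using y(2) subgroup.one_closed[OF As] by blast
      \<comment> \<open>Automorphisms of a cyclic group commute, so \<open>[n, y]\<close>
        centralises \<open>a\<close> and lies in \<open>A\<close> by \<open>selfcent\<close>: all
        conjugates of \<open>y\<close> in \<open>N\<close> stay in the coset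
        \<open>A y\<close>.\<close>
      have conj: "\<exists>f \<in> A. \<exists>i::nat. cj n y = f \<otimes> y [^] i" if n: "n \<in> N" for n
      proof -
        have nc: "n \<in> carrier G" using N_carrier n .
        have nyN: "inv (y \<otimes> n) \<in> N" "n \<otimes> y \<in> N" using n y(1) N_subgroup by (simp_all add: subgroup.m_closed subgroup.m_inv_closed)
        obtain i j k :: nat where ij: "cj n a = a [^] i" "cj y a = a [^] j" "cj (inv (y \<otimes> n)) a = a [^] k"
          using nA[OF n aA] nA[OF y(1) aA] nA[OF nyN(1) aA] by (auto simp: A_def powers_def)
        have "cj (n \<otimes> y) a = cj (y \<otimes> n) a"
          using ij(1,2) nc yc ac by (simp add: cj_pow nat_pow_pow mult.commute flip: cj_cj)
        then have "cj (n \<otimes> y) (a [^] k) = cj (y \<otimes> n) (a [^] k)" using nc yc ac by (simp add: cj_pow)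
        also have "\<dots> = cj (y \<otimes> n) (cj (inv (y \<otimes> n)) a)" using ij(3) by simp
        also have "\<dots> = a" using nc yc ac by simp
        finally have "cj (n \<otimes> y) (cj (inv (y \<otimes> n)) a) = a" using ij(3) by simp
        then have fa: "cj (n \<otimes> y \<otimes> inv (y \<otimes> n)) a = a" using nc yc ac by (simp add: cj_cj)
        have "n \<otimes> y \<otimes> inv (y \<otimes> n) \<in> N" using nyN N_subgroup by (simp add: subgroup.m_closed)
        then have "n \<otimes> y \<otimes> inv (y \<otimes> n) \<in> A"
          using selfcent fa cj_fix_iff[of "n \<otimes> y \<otimes> inv (y \<otimes> n)" a] ac nc yc by simp
        moreover have "cj n y = n \<otimes> y \<otimes> inv (y \<otimes> n) \<otimes> y [^] (1::nat)" using nc yc by (simp add: cj_def m_assoc inv_mult_group)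
        ultimately show ?thesis by blast
      qed
      \<comment> \<open>The Frattini argument a second time, now for \<open>A\<close> and
        \<open>y\<close> inside \<open>N\<close>, makes \<open>M\<close> a complement of
        \<open>A\<close> in \<open>N\<close>.\<close>
      define M where "M = N \<inter> pnorm y"
      have Ms: "subgroup M G" unfolding M_def using subgroups_Inter_pair[OF N_subgroup pnorm_subgroup[OF yc]] .
      have Mc: "m \<in> carrier G" if "m \<in> M" for m using subgroup.mem_carrier[OF Ms that] .
      have facN: "\<exists>k \<in> A. \<exists>m \<in> M. n = k \<otimes> m" if "n \<in> N" for n
        unfolding M_def by (rule frattini_factorisation(1)[OF N_subgroup As AN _ y(1,4,3) y1 _ _ that])
          (erule (1) nA, erule (1) YA[OF yY], erule conj)
      have "A \<inter> pnorm y = {\<one>}"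
        by (rule frattini_factorisation(2)[OF N_subgroup As AN _ y(1,4,3) y1])
          (erule (1) nA, erule (1) YA[OF yY], erule conj)
      then have AM: "A \<inter> M = {\<one>}" using subgroup.one_closed[OF Ms] by (auto simp: M_def)
      have yM: "y \<in> M" using y(1) comm_in_pnorm[OF yc yc refl] by (simp add: M_def)
      have MA: "fpf M A" unfolding fpf_def
      proof (intro ballI impI)
        fix m c assume m: "m \<in> M" "m \<noteq> \<one>" and c: "c \<in> A" "m \<otimes> c = c \<otimes> m"
        obtain l k :: nat where lk: "prime l" "m [^] k \<noteq> \<one>" "(m [^] k) [^] l = \<one>"
          using prime_power_exists[OF Mc[OF m(1)] m(2)] by blast
        have "m [^] k \<in> M" using pow_closed_subgroup[OF Ms m(1)] .
        then have "m [^] k \<in> Y" using lk AM by (auto simp: Y_def M_def)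
        then show "c = \<one>" using YA[OF _ c(1)] comm_pow[OF Mc[OF m(1)] Ac[OF c(1)] c(2)] by blast
      qed
      have AMN: "A <#> M = N"
      proof
        show "A <#> M \<subseteq> N" using AN subgroup.m_closed[OF N_subgroup] by (auto simp: set_mult_def M_def)
        show "N \<subseteq> A <#> M" using facN by (auto simp: set_mult_def)
      qed
      have FAn: "F <#> A \<lhd> G"
      proof (rule normal_invI)
        show sFA: "subgroup (F <#> A) G"
        proof (rule subgroupI)
          show "F <#> A \<subseteq> carrier G" using set_mult_closed[OF subgroup.subset[OF Fs] subgroup.subset[OF As]] .
          show "F <#> A \<noteq> {}" using subgroup.one_closed[OF Fs] aA by (auto simp: set_mult_def)
          fix w assume "w \<in> F <#> A"
          then obtain f d where fd: "f \<in> F" "d \<in> A" "w = f \<otimes> d" by (auto simp: set_mult_def)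
          have "inv w = cj (inv d) (inv f) \<otimes> inv d" using fd F_carrier Ac by (simp add: cj_def inv_mult_group m_assoc)
          moreover have "cj (inv d) (inv f) \<in> F" using cj_normal[OF F, of "inv d" "inv f"] fd Ac Fs by (simp add: subgroup.m_inv_closed)
          moreover have "inv d \<in> A" using fd As subgroup.m_inv_closed by metis
          ultimately show "inv w \<in> F <#> A" by (auto simp: set_mult_def)
          fix w' assume "w' \<in> F <#> A"
          then obtain f' d' where fd': "f' \<in> F" "d' \<in> A" "w' = f' \<otimes> d'" by (auto simp: set_mult_def)
          have "w \<otimes> w' = (f \<otimes> cj d f') \<otimes> (d \<otimes> d')" using fd fd' F_carrier Ac by (simp add: cj_def m_assoc)
          moreover have "f \<otimes> cj d f' \<in> F" using cj_normal[OF F Ac[OF fd(2)] fd'(1)] fd(1) Fs by (simp add: subgroup.m_closed)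
          moreover have "d \<otimes> d' \<in> A" using fd fd' As by (simp add: subgroup.m_closed)
          ultimately show "w \<otimes> w' \<in> F <#> A" by (auto simp: set_mult_def)
        qed
        fix g w assume g: "g \<in> carrier G" and "w \<in> F <#> A"
        then obtain f d where fd: "f \<in> F" "d \<in> A" "w = f \<otimes> d" by (auto simp: set_mult_def)
        obtain k n where kn: "k \<in> F" "n \<in> N" "g = k \<otimes> n" using fac[OF g] by blast
        let ?d = "cj n d"
        have dA: "?d \<in> A" using nA kn fd by blast
        have "g \<otimes> w \<otimes> inv g = cj g f \<otimes> cj k ?d" using g kn fd F_carrier Ac N_carrier by (simp add: cj_def m_assoc inv_mult_group)
        also have "cj k ?d = (k \<otimes> cj ?d (inv k)) \<otimes> ?d" using kn F_carrier Ac[OF dA] by (simp add: cj_def[of k] cj_def[of ?d] m_assoc)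
        finally have "g \<otimes> w \<otimes> inv g = (cj g f \<otimes> (k \<otimes> cj ?d (inv k))) \<otimes> ?d"
          using g kn F_carrier[OF fd(1)] F_carrier[OF kn(1)] Ac[OF dA] by (simp add: m_assoc)
        moreover have "cj g f \<otimes> (k \<otimes> cj ?d (inv k)) \<in> F"
          using cj_normal[OF F g fd(1)] kn(1) cj_normal[OF F Ac[OF dA], of "inv k"] Fs by (simp add: subgroup.m_closed subgroup.m_inv_closed)
        ultimately show "g \<otimes> w \<otimes> inv g \<in> F <#> A" using dA by (auto simp: set_mult_def)
      qed
      have A1: "A \<noteq> {\<one>}" using xA x(2) by blast
      have M1: "M \<noteq> {\<one>}" using yM y1 by blast
      have "two_frobenius G F A M"
        unfolding two_frobenius_def
      proof (intro conjI F FAn As Ms)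
        show "subgroup (A <#> M) G" using AMN N_subgroup by simp
        show "carrier G = F <#> A <#> M"
        proof
          show "F <#> A <#> M \<subseteq> carrier G"
            using set_mult_closed[OF subgroup.subset[OF normal_imp_subgroup[OF FAn]] subgroup.subset[OF Ms]] .
          show "carrier G \<subseteq> F <#> A <#> M"
          proof
            fix g assume "g \<in> carrier G"
            then obtain k n where kn: "k \<in> F" "n \<in> N" "g = k \<otimes> n" using fac by blast
            then obtain d m where dm: "d \<in> A" "m \<in> M" "n = d \<otimes> m" using facN by blast
            have "g = (k \<otimes> d) \<otimes> m" using kn dm F_carrier Ac Mc by (simp add: m_assoc)
            then show "g \<in> F <#> A <#> M" using kn dm by (auto simp: set_mult_def)
          qed
        qed
        show "frobenius_with (G\<lparr>carrier := F <#> A\<rparr>) F A"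
        proof (rule frobenius_with_complement[OF Fs As _ _ F_non A1 AF normal_imp_subgroup[OF FAn]])
          show "cj h k \<in> F" if "h \<in> A" "k \<in> F" for h k using cj_normal[OF F Ac[OF that(1)] that(2)] .
          show "F \<inter> A = {\<one>}" using FA subgroup.one_closed[OF Fs] subgroup.one_closed[OF As] by blast
        qed
        show "frobenius_with (G\<lparr>carrier := A <#> M\<rparr>) A M"
        proof (rule frobenius_with_complement[OF As Ms _ AM A1 M1 MA])
          show "cj h k \<in> A" if "h \<in> M" "k \<in> A" for h k using nA that by (auto simp: M_def)
          show "subgroup (A <#> M) G" using AMN N_subgroup by simp
        qed
      qed
      then show ?thesis using ntwo by (auto simp: two_frobenius_group_def)
    qed
  qed
qed

end

end

section \<open>A common vertex at distance four\<close>

context group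
begin

lemma gstep_refl: "x \<in> carrier G \<Longrightarrow> x \<noteq> \<one> \<Longrightarrow> gstep x x"
  by (simp add: gstep_def)

lemma walk4: "gstep x a \<Longrightarrow> gstep a b \<Longrightarrow> gstep b c \<Longrightarrow> gstep c v \<Longrightarrow> (gstep ^^ 4) x v"
  by (auto simp: numeral_eq_Suc intro!: relcomppI)

lemma walk_sym: "(gstep ^^ n) x y \<Longrightarrow> (gstep ^^ n) y x"
proof (induction n arbitrary: x y)
  case (Suc n)
  then show ?case by (metis gstep_sym relpowp_Suc_E relpowp_Suc_I2)
qed simp

end

context fin_group
begin

text \<open>Elements close to \<open>F\<close> can be led to any nontrivial element of
  \<open>V\<close>, so only the far ones dictate \<open>v\<close>. One chain \<open>c, y, v\<close>
  serves all of them because conjugation by \<open>F\<close> adapts its start and keeps its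
  end.\<close>

lemma common_neighbourhood:
  assumes sol: "solvable G" and non: "carrier G \<noteq> {\<one>}"
    and nfrob: "\<not> frobenius_group G" and ntwo: "\<not> two_frobenius_group G"
  shows "\<exists>v. \<forall>x \<in> carrier G - {\<one>}. (gstep ^^ 4) x v"
proof -
  obtain V r where minV: "min_normal V r" using min_normal_exists[OF sol non] by blast
  have V: "V \<lhd> G" and V1: "V \<noteq> {\<one>}" and ab: "\<And>v w. v \<in> V \<Longrightarrow> w \<in> V \<Longrightarrow> v \<otimes> w = w \<otimes> v"
    using minV by (auto simp: min_normal_def)
  define F where "F = cent V"
  have Fn: "F \<lhd> G" unfolding F_def using cent_normal[OF V] .
  have Vs: "subgroup V G" and Fs: "subgroup F G" using V Fn normal_imp_subgroup by blast+
  have V_carrier: "v \<in> carrier G" if "v \<in> V" for v using subgroup.mem_carrier[OF Vs that] .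
  have F_carrier: "v \<in> carrier G" if "v \<in> F" for v using subgroup.mem_carrier[OF Fs that] .
  have VF: "V \<subseteq> F" using ab V_carrier by (auto simp: F_def cent_def)
  have Fv: "f \<otimes> v = v \<otimes> f" if "f \<in> F" "v \<in> V" for f v using that by (simp add: F_def cent_def)
  \<comment> \<open>Because \<open>gstep\<close> is reflexive this covers all distances up to three;
    it also makes \<open>f\<close> nontrivial.\<close>
  define near where "near x \<longleftrightarrow> (\<exists>a b f. f \<in> F \<and> gstep x a \<and> gstep a b \<and> gstep b f)" for x
  have near_walk: "(gstep ^^ 4) x v" if x: "near x" and v: "v \<in> V" "v \<noteq> \<one>" for x v
  proof -
    obtain a b f where f: "f \<in> F" "gstep x a" "gstep a b" "gstep b f" using x by (auto simp: near_def)
    have "gstep f v" using f(4) v V_carrier Fv[OF f(1) v(1)] unfolding gstep_def by metis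
    then show ?thesis using walk4 f by blast
  qed
  show ?thesis
  proof (cases "\<forall>x \<in> carrier G - {\<one>}. near x")
    case True
    obtain v where "v \<in> V" "v \<noteq> \<one>" using V1 subgroup.one_closed[OF Vs] by blast
    then show ?thesis using near_walk True by blast
  next
    case False
    define bad where "bad x \<longleftrightarrow> x \<in> carrier G \<and> x \<noteq> \<one> \<and> \<not> near x" for x
    obtain x0 where x0: "bad x0" using False by (auto simp: bad_def)
    then have x0c: "x0 \<in> carrier G" and x01: "x0 \<noteq> \<one>" by (auto simp: bad_def)
    have Fne: "F \<noteq> carrier G"
    proof
      assume "F = carrier G"
      then have "near x0" using gstep_refl[OF x0c x01] x0c by (auto simp: near_def)
      then show False using x0 by (simp add: bad_def)
    qed
    obtain E q where E: "subgroup E G" "F \<subseteq> E" "E \<subseteq> carrier G" "E \<noteq> F" "\<And>n e. n \<in> carrier G \<Longrightarrow> e \<in> E \<Longrightarrow> cj n e \<in> E"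
      "prime (q::nat)" "\<And>e. e \<in> E \<Longrightarrow> e [^] q \<in> F" "\<And>d e. d \<in> E \<Longrightarrow> e \<in> E \<Longrightarrow> d \<otimes> e \<otimes> inv (e \<otimes> d) \<in> F"
      by (rule elementary_abelian_section[OF sol subgroup_self Fs subgroup_self]) (use Fne F_carrier cj_normal[OF Fn] in auto)
    have Ec: "e \<in> carrier G" if "e \<in> E" for e using that E(3) by blast
    have En: "E \<lhd> G" using normal_invI[OF E(1)] E(5) by (simp add: cj_def)
    have qV: "\<not> q dvd card V"
      using min_normal_section_coprime[OF minV En _ E(6)] E(2,4,7,8) unfolding F_def by blast
    \<comment> \<open>A violation \<open>z\<close>, \<open>f\<close> would complete the walk
      \<open>w, u, z, f\<close> into \<open>F\<close>.\<close>
    have far: "fpf (cent {u}) F" if w: "bad w" and u: "u \<in> carrier G" "u \<noteq> \<one>" "u \<otimes> w = w \<otimes> u" for u w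
      unfolding fpf_def
    proof (intro ballI impI)
      fix z f assume z: "z \<in> cent {u}" "z \<noteq> \<one>" and f: "f \<in> F" "z \<otimes> f = f \<otimes> z"
      have zu: "z \<in> carrier G" "z \<otimes> u = u \<otimes> z" using z by (auto simp: cent_singleton)
      show "f = \<one>"
      proof (rule ccontr)
        assume "f \<noteq> \<one>"
        then have "gstep w u" "gstep u z" "gstep z f" using w u z zu f F_carrier unfolding gstep_def bad_def by metis+
        then show False using w f(1) unfolding bad_def near_def by blast
      qed
    qed
    have sec: "\<exists>u p s. prime (p::nat) \<and> u \<in> carrier G \<and> u \<noteq> \<one> \<and> u [^] p = \<one> \<and> u \<otimes> w = w \<otimes> u \<and> fpf (cent {u}) F \<and>
        s \<in> E \<and> s \<notin> F \<and> s [^] q = \<one> \<and> s \<otimes> u = u \<otimes> s \<and> (\<forall>z \<in> E. z \<otimes> u = u \<otimes> z \<longrightarrow> z \<in> powers s) \<and>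
        (\<forall>e \<in> E. \<exists>f \<in> F. \<exists>i::nat. e = f \<otimes> s [^] i)" if w: "bad w" for w
    proof -
      have wc: "w \<in> carrier G" "w \<noteq> \<one>" using w by (auto simp: bad_def)
      obtain p k :: nat where pk: "prime p" "w [^] k \<noteq> \<one>" "(w [^] k) [^] p = \<one>" using prime_power_exists[OF wc] by blast
      define u where "u = w [^] k"
      have u: "u \<in> carrier G" "u \<noteq> \<one>" "u [^] p = \<one>" "u \<otimes> w = w \<otimes> u"
        using pk comm_pow[OF wc(1) wc(1) refl] wc by (auto simp: u_def)
      have fu: "fpf (cent {u}) F" using far[OF w u(1,2,4)] .
      show ?thesis
      proof (rule cyclic_section[OF V ab V1 E(1) _ _ _ E(6) _ qV u(1,3) pk(1), folded F_def])
        show "f = \<one>" if "f \<in> F" "u \<otimes> f = f \<otimes> u" for f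
          using fpfD[OF fu _ that(1) u(2) that(2)] u(1) by (simp add: cent_singleton)
        show "fpf {z \<in> E. z \<otimes> u = u \<otimes> z} F"
          using fpf_mono[OF fu _ order_refl] Ec by (simp add: cent_singleton subset_iff)
        show "cj u e \<in> E" if "e \<in> E" for e using E(5)[OF u(1) that] .
        fix s assume s: "s \<in> E" "s \<notin> F" "s [^] q = \<one>" "s \<otimes> u = u \<otimes> s"
          and gen: "\<And>z. z \<in> E \<Longrightarrow> z \<otimes> u = u \<otimes> z \<Longrightarrow> \<exists>i::nat. z = s [^] i"
          and Es: "\<And>e. e \<in> E \<Longrightarrow> \<exists>f \<in> F. \<exists>i::nat. e = f \<otimes> s [^] i"
        have "\<forall>z \<in> E. z \<otimes> u = u \<otimes> z \<longrightarrow> z \<in> powers s" using gen by (metis powersI)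
        then show ?thesis using pk(1) u fu s Es
          by (intro exI[of _ u] exI[of _ p] exI[of _ s] conjI ballI) simp_all
      qed (use E(1,2,4,7,8) in blast)+
    qed
    obtain x p t where x: "prime (p::nat)" "x \<in> carrier G" "x \<noteq> \<one>" "x [^] p = \<one>" "x \<otimes> x0 = x0 \<otimes> x" "fpf (cent {x}) F"
      and t: "t \<in> E" "t \<notin> F" "t [^] q = \<one>" "t \<otimes> x = x \<otimes> t" "\<And>z. z \<in> E \<Longrightarrow> z \<otimes> x = x \<otimes> z \<Longrightarrow> z \<in> powers t"
      and Et: "\<And>e. e \<in> E \<Longrightarrow> \<exists>f \<in> F. \<exists>i::nat. e = f \<otimes> t [^] i"
      using sec[OF x0] by blast
    have tc: "t \<in> carrier G" using Ec t(1) .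
    have t1: "t \<noteq> \<one>" using t(2) subgroup.one_closed[OF Fs] by blast
    have tF: "f = \<one>" if "f \<in> F" "t \<otimes> f = f \<otimes> t" for f
      using fpfD[OF x(6) _ that(1) t1 that(2)] tc t(4) by (simp add: cent_singleton)
    define N where "N = pnorm t"
    have fac: "\<exists>k \<in> F. \<exists>n \<in> N. g = k \<otimes> n" if g: "g \<in> carrier G" for g
    proof -
      have "\<exists>k \<in> F. \<exists>n \<in> carrier G \<inter> pnorm t. g = k \<otimes> n"
        by (rule frattini_factorisation(1)[OF subgroup_self Fs subgroup.subset[OF Fs] _ tc t(3) E(6) t1 _ _ g])
          (erule (1) cj_normal[OF Fn], erule (1) tF, rule Et, erule E(5), rule t(1))
      then show ?thesis by (auto simp: N_def)
    qed
    have FN: "F \<inter> N = {\<one>}" unfolding N_def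
      by (rule frattini_factorisation(2)[OF subgroup_self Fs subgroup.subset[OF Fs] _ tc t(3) E(6) t1])
        (erule (1) cj_normal[OF Fn], erule (1) tF, rule Et, erule E(5), rule t(1))
    \<comment> \<open>\<open>x0\<close> commutes with \<open>x\<close>, so it sends \<open>t\<close>
      to an element of \<open>E\<close> commuting with \<open>x\<close>, and these are all powers of
      \<open>t\<close>.\<close>
    have x0N: "x0 \<in> N"
    proof -
      have "cj x0 x = x" using x(5) cj_fix_iff[OF x0c x(2)] by simp
      then have "cj x0 t \<otimes> x = x \<otimes> cj x0 t" using cj_comm_iff[OF x0c tc x(2)] t(4) by simp
      then show ?thesis using t(5)[OF E(5)[OF x0c t(1)]] x0c by (simp add: N_def pnorm_def)
    qed
    have reduce: "\<exists>v. \<forall>x \<in> carrier G - {\<one>}. (gstep ^^ 4) x v"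
      if c: "c \<in> carrier G" "c \<noteq> \<one>" and y: "y \<in> carrier G" "y \<noteq> \<one>" and v: "v \<in> V" "v \<noteq> \<one>"
        and cy: "c \<otimes> y = y \<otimes> c" and yv: "y \<otimes> v = v \<otimes> y"
        and u: "\<And>u l. u \<in> carrier G \<Longrightarrow> u [^] l = \<one> \<Longrightarrow> u \<noteq> \<one> \<Longrightarrow> prime (l::nat) \<Longrightarrow> u \<otimes> t = t \<otimes> u \<Longrightarrow> fpf (cent {u}) F \<Longrightarrow> u \<otimes> c = c \<otimes> u"
      for c y v
    proof (intro exI ballI)
      fix w assume w: "w \<in> carrier G - {\<one>}"
      show "(gstep ^^ 4) w v"
      proof (cases "near w")
        case False
        then have bw: "bad w" using w by (simp add: bad_def)
        obtain u l s where ul: "prime (l::nat)" "u \<in> carrier G" "u \<noteq> \<one>" "u [^] l = \<one>" "u \<otimes> w = w \<otimes> u" "fpf (cent {u}) F"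
          "s \<in> E" "s \<notin> F" "s \<otimes> u = u \<otimes> s" using sec[OF bw] by blast
        obtain f i where fi: "f \<in> F" "s = f \<otimes> t [^] (i::nat)" using Et[OF ul(7)] by blast
        have ti: "t [^] i \<noteq> \<one>" using fi ul(8) F_carrier by auto
        have "\<exists>k \<in> F. f \<otimes> t [^] i = cj k (t [^] i)"
        proof (rule coset_conjugate[OF Fs _ _ _ fi(1)])
          show "g = \<one>" if "g \<in> F" "t [^] i \<otimes> g = g \<otimes> t [^] i" for g
            using tF[OF that(1)] fpf_pow[OF tc t(3) E(6) ti F_carrier[OF that(1)] that(2)] by blast
        qed (use tc cj_normal[OF Fn] in auto)
        \<comment> \<open>Conjugating by \<open>inv k\<close> turns \<open>u\<close> into an element
          commuting with \<open>t\<close>, to which the assumption on \<open>c\<close> applies.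
          Conjugating back attaches the chain to \<open>u\<close>, and \<open>v\<close> is not moved
          because \<open>k\<close> lies in \<open>F\<close>.\<close>
        then obtain k where k: "k \<in> F" "s = cj k (t [^] i)" using fi by auto
        have kc: "k \<in> carrier G" using F_carrier k(1) .
        define u' where "u' = cj (inv k) u"
        have u'c: "u' \<in> carrier G" using kc ul by (simp add: u'_def)
        have uu': "u = cj k u'" using kc ul by (simp add: u'_def)
        have "cj k (t [^] i) \<otimes> cj k u' = cj k u' \<otimes> cj k (t [^] i)" using ul(9) uu' k(2) by simp
        then have "t [^] i \<otimes> u' = u' \<otimes> t [^] i" using cj_comm_iff kc u'c tc by simp
        then have ut: "t \<otimes> u' = u' \<otimes> t" using fpf_pow[OF tc t(3) E(6) ti u'c] by blast
        have fu': "fpf (cent {u'}) F" unfolding fpf_def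
        proof (intro ballI impI)
          fix z f assume z: "z \<in> cent {u'}" "z \<noteq> \<one>" and f: "f \<in> F" "z \<otimes> f = f \<otimes> z"
          have zc: "z \<in> carrier G" "z \<otimes> u' = u' \<otimes> z" using z by (auto simp: cent_singleton)
          have "cj k z \<in> cent {u}" using zc cj_comm_iff[OF kc zc(1) u'c] kc uu' by (simp add: cent_singleton)
          moreover have "cj k z \<otimes> cj k f = cj k f \<otimes> cj k z" using cj_comm_iff[OF kc zc(1) F_carrier[OF f(1)]] f(2) by blast
          ultimately have "cj k f = \<one>" using fpfD[OF ul(6) _ cj_normal[OF Fn kc f(1)]] z zc kc by simp
          then show "f = \<one>" using kc F_carrier[OF f(1)] by simp
        qed
        have "u' [^] l = \<one>" "u' \<noteq> \<one>" using ul kc by (auto simp: u'_def simp flip: cj_pow)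
        then have "u' \<otimes> c = c \<otimes> u'" using u[OF u'c _ _ ul(1) ut[symmetric] fu'] by blast
        then have uc: "u \<otimes> cj k c = cj k c \<otimes> u" using cj_comm_iff[OF kc u'c c(1)] uu' by simp
        have "cj k v = v" using cj_fix_iff[OF kc V_carrier[OF v(1)]] Fv[OF k(1) v(1)] by blast
        then have yv': "cj k y \<otimes> v = v \<otimes> cj k y" using cj_comm_iff[OF kc y(1) V_carrier[OF v(1)]] yv by simp
        have cy': "cj k c \<otimes> cj k y = cj k y \<otimes> cj k c" using cj_comm_iff[OF kc c(1) y(1)] cy by blast
        have non: "cj k c \<noteq> \<one>" "cj k y \<noteq> \<one>" "cj k c \<in> carrier G" "cj k y \<in> carrier G" using kc c y by auto
        show ?thesis
        proof (rule walk4)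
          show "gstep w u" using w ul unfolding gstep_def by simp
          show "gstep u (cj k c)" using uc ul non unfolding gstep_def by simp
          show "gstep (cj k c) (cj k y)" using cy' non unfolding gstep_def by simp
          show "gstep (cj k y) v" using yv' non v V_carrier unfolding gstep_def by simp
        qed
      qed (use near_walk v in blast)
    qed
    show ?thesis
    proof (cases "fpf (cent {t}) V")
      case False
      then obtain y v where yv: "y \<in> cent {t}" "y \<noteq> \<one>" "v \<in> V" "v \<noteq> \<one>" "y \<otimes> v = v \<otimes> y" unfolding fpf_def by blast
      have y: "y \<in> carrier G" "y \<otimes> t = t \<otimes> y" using yv(1) by (auto simp: cent_singleton)
      \<comment> \<open>Here \<open>c\<close> is \<open>t\<close> itself, with which every
        \<open>u\<close> in question commutes by assumption.\<close>
      show ?thesis by (rule reduce[OF tc t1 y(1) yv(2-4) y(2)[symmetric] yv(5)])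
    next
      case True
      note analysis = cyclic_normal_subgroup_analysis[OF sol V ab V1 Fn VF tc t1 N_def fac FN True nfrob ntwo]
      have "\<not> fpf N F" by (rule N_not_fpf[OF sol V ab V1 Fn VF tc t1 N_def fac FN True nfrob ntwo])
      then obtain n f where nf: "n \<in> N" "n \<noteq> \<one>" "f \<in> F" "f \<noteq> \<one>" "n \<otimes> f = f \<otimes> n" unfolding fpf_def by blast
      have N_carrier: "n \<in> carrier G" if "n \<in> N" for n using that by (simp add: N_def pnorm_def)
      \<comment> \<open>A central \<open>i\<close> of \<open>N\<close> would give the walk
        \<open>x0, i, n, f\<close> into \<open>F\<close>, although \<open>x0\<close> is far from
        \<open>F\<close>.\<close>
      have "\<not> (\<exists>i \<in> N. i \<noteq> \<one> \<and> (\<forall>m \<in> N. m \<otimes> i = i \<otimes> m))"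
      proof
        assume "\<exists>i \<in> N. i \<noteq> \<one> \<and> (\<forall>m \<in> N. m \<otimes> i = i \<otimes> m)"
        then obtain i where i: "i \<in> N" "i \<noteq> \<one>" "\<And>m. m \<in> N \<Longrightarrow> m \<otimes> i = i \<otimes> m" by blast
        have "gstep x0 i" using x0c x01 N_carrier[OF i(1)] i(2) i(3)[OF x0N] unfolding gstep_def by simp
        moreover have "gstep i n" using N_carrier[OF nf(1)] nf(2) N_carrier[OF i(1)] i(2) i(3)[OF nf(1)] unfolding gstep_def by simp
        moreover have "gstep n f" using N_carrier[OF nf(1)] nf F_carrier unfolding gstep_def by simp
        ultimately show False using x0 nf(3) unfolding bad_def near_def by blast
      qed
      then obtain c y v where *: "c \<in> carrier G" "c \<noteq> \<one>" "y \<in> carrier G" "y \<noteq> \<one>" "v \<in> V" "v \<noteq> \<one>" "c \<otimes> y = y \<otimes> c" "y \<otimes> v = v \<otimes> y"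
        "\<forall>u l. u \<in> carrier G \<longrightarrow> u [^] l = \<one> \<longrightarrow> u \<noteq> \<one> \<longrightarrow> prime (l::nat) \<longrightarrow> u \<otimes> t = t \<otimes> u \<longrightarrow> fpf (cent {u}) F \<longrightarrow> u \<otimes> c = c \<otimes> u"
        using analysis[OF _ _ _ x(2,3,4,1) t(4)[symmetric] x(6)] by blast
      show ?thesis by (rule reduce[OF *(1-8)]) (use *(9) in blast)
    qed
  qed
qed

end

section \<open>The graph on orbits\<close>

text \<open>Both images are copies of the quotient of \<open>S\<close> by the same equivalence
  relation.\<close>

lemma card_image_eqI:
  assumes "\<And>x y. x \<in> S \<Longrightarrow> y \<in> S \<Longrightarrow> f x = f y \<Longrightarrow> g x = g y"
    and "\<And>x y. x \<in> S \<Longrightarrow> y \<in> S \<Longrightarrow> g x = g y \<Longrightarrow> f x = f y"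
  shows "card (f ` S) = card (g ` S)"
proof -
  define h where "h = (\<lambda>c. g (inv_into S f c))"
  have h: "h (f x) = g x" if "x \<in> S" for x
    unfolding h_def using that inv_into_into[of "f x" f S] f_inv_into_f[of "f x" f S] by (intro assms(1)) simp_all
  have "inj_on h (f ` S)"
  proof (rule inj_onI, clarify)
    fix x y assume "x \<in> S" "y \<in> S" "h (f x) = h (f y)"
    then show "f x = f y" by (intro assms(2)) (simp_all only: h)
  qed
  moreover have "h ` f ` S = g ` S" using h by (simp add: image_image)
  ultimately show ?thesis by (metis card_image)
qed

locale automorphism_action = fin_group G + A: group A
  for G (structure) and A :: "('b, 'd) monoid_scheme" +
  fixes \<phi> :: "'b \<Rightarrow> 'a \<Rightarrow> 'a"
  assumes action: "acts_by_automorphisms A G \<phi>"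
begin

lemma group_action_A: "group_action A (carrier G) \<phi>"
  using action by (simp add: acts_by_automorphisms_def)

lemma phi_hom: "a \<in> carrier A \<Longrightarrow> \<phi> a \<in> hom G G"
  using action by (simp add: acts_by_automorphisms_def)

lemma phi_closed [simp]: "a \<in> carrier A \<Longrightarrow> x \<in> carrier G \<Longrightarrow> \<phi> a x \<in> carrier G"
  using group_action.element_image[OF group_action_A] by blast

lemma phi_mult: "a \<in> carrier A \<Longrightarrow> x \<in> carrier G \<Longrightarrow> y \<in> carrier G \<Longrightarrow> \<phi> a (x \<otimes> y) = \<phi> a x \<otimes> \<phi> a y"
  using phi_hom by (simp add: hom_mult)

lemma phi_one: "a \<in> carrier A \<Longrightarrow> \<phi> a \<one> = \<one>"
  using phi_hom hom_one[OF _ is_group is_group] by blast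

lemma phi_id [simp]: "x \<in> carrier G \<Longrightarrow> \<phi> \<one>\<^bsub>A\<^esub> x = x"
  using group_action.id_eq_one[OF group_action_A] by (metis restrict_apply')

lemma phi_phi: "a \<in> carrier A \<Longrightarrow> b \<in> carrier A \<Longrightarrow> x \<in> carrier G \<Longrightarrow> \<phi> a (\<phi> b x) = \<phi> (a \<otimes>\<^bsub>A\<^esub> b) x"
  using group_action.composition_rule[OF group_action_A] by simp

lemma phi_inv [simp]: "a \<in> carrier A \<Longrightarrow> x \<in> carrier G \<Longrightarrow> \<phi> (inv\<^bsub>A\<^esub> a) (\<phi> a x) = x"
  by (simp add: phi_phi)

lemma phi_inv' [simp]: "a \<in> carrier A \<Longrightarrow> x \<in> carrier G \<Longrightarrow> \<phi> a (\<phi> (inv\<^bsub>A\<^esub> a) x) = x"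
  by (simp add: phi_phi)

lemma phi_inj: "a \<in> carrier A \<Longrightarrow> inj_on (\<phi> a) (carrier G)"
  by (metis inj_on_def phi_inv)

lemma phi_eq_one_iff: "a \<in> carrier A \<Longrightarrow> x \<in> carrier G \<Longrightarrow> \<phi> a x = \<one> \<longleftrightarrow> x = \<one>"
  by (metis A.inv_closed phi_inv phi_one)

abbreviation orb :: "'a \<Rightarrow> 'a set" where
  "orb \<equiv> orbit A \<phi>"

lemma orb_eq: 
  assumes "a \<in> carrier A" "x \<in> carrier G"
  shows "orb (\<phi> a x) = orb x"
proof (intro equalityI subsetI)
  fix y assume "y \<in> orb (\<phi> a x)"
  then obtain b where "b \<in> carrier A" "y = \<phi> b (\<phi> a x)" by (auto simp: orbit_def)
  then have "y = \<phi> (b \<otimes>\<^bsub>A\<^esub> a) x" using assms by (simp add: phi_phi)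
  then show "y \<in> orb x" using \<open>b \<in> carrier A\<close> assms by (auto simp: orbit_def)
next
  fix y assume "y \<in> orb x"
  then obtain b where b: "b \<in> carrier A" "y = \<phi> b x" by (auto simp: orbit_def)
  then have "y = \<phi> (b \<otimes>\<^bsub>A\<^esub> inv\<^bsub>A\<^esub> a) (\<phi> a x)" using assms by (simp flip: phi_phi)
  then show "y \<in> orb (\<phi> a x)" using b assms by (auto simp: orbit_def)
qed

lemma orb_self: "x \<in> carrier G \<Longrightarrow> x \<in> orb x"
  by (rule group_action.orbit_refl[OF group_action_A])

lemma orb_eqD:
  assumes "orb x = orb y" "x \<in> carrier G"
  shows "\<exists>a \<in> carrier A. x = \<phi> a y"
proof -
  have "x \<in> orb y" using orb_self[OF assms(2)] assms(1) by simp
  then show ?thesis by (auto simp: orbit_def)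
qed

abbreviation Vs :: "'a set set" where
  "Vs \<equiv> cg_vertices A G \<phi>"

abbreviation adj :: "'a set \<Rightarrow> 'a set \<Rightarrow> bool" where
  "adj \<equiv> cg_adj A G \<phi>"

lemma vertexI: "x \<in> carrier G \<Longrightarrow> x \<noteq> \<one> \<Longrightarrow> orb x \<in> Vs"
  by (auto simp: cg_vertices_def)

lemma vertexE:
  assumes "u \<in> Vs"
  obtains x where "x \<in> carrier G" "x \<noteq> \<one>" "u = orb x"
  using assms by (auto simp: cg_vertices_def)

lemma gstep_adj:
  assumes "gstep x y"
  shows "orb x = orb y \<or> adj (orb x) (orb y)"
proof -
  have xy: "x \<in> carrier G" "x \<noteq> \<one>" "y \<in> carrier G" "y \<noteq> \<one>" "x \<otimes> y = y \<otimes> x" using assms by (auto simp: gstep_def)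
  then have "x \<in> orb x" "y \<in> orb y" "orb x \<in> Vs" "orb y \<in> Vs" using orb_self vertexI by auto
  then show ?thesis using xy(5) unfolding cg_adj_def by blast
qed

text \<open>Steps within one orbit collapse, so the walk between orbits can only become
  shorter.\<close>

lemma walk_adj: "(gstep ^^ n) x y \<Longrightarrow> \<exists>m \<le> n. (adj ^^ m) (orb x) (orb y)"
proof (induction n arbitrary: y)
  case (Suc n)
  then obtain z where z: "(gstep ^^ n) x z" "gstep z y" by (meson relpowp_Suc_E)
  then obtain m where m: "m \<le> n" "(adj ^^ m) (orb x) (orb z)" using Suc.IH by blast
  from gstep_adj[OF z(2)] show ?case
  proof
    assume "orb z = orb y"
    then show ?thesis using m by (metis le_SucI)
  next
    assume "adj (orb z) (orb y)"
    then have "(adj ^^ Suc m) (orb x) (orb y)" using m(2) by (rule relpowp_Suc_I[rotated])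
    then show ?thesis using m(1) by (meson Suc_le_mono)
  qed
qed auto

lemma gstep_phi: "a \<in> carrier A \<Longrightarrow> gstep x y \<Longrightarrow> gstep (\<phi> a x) (\<phi> a y)"
  unfolding gstep_def using phi_eq_one_iff phi_closed phi_mult by metis

lemma reach_phi: "reach x y \<Longrightarrow> a \<in> carrier A \<Longrightarrow> reach (\<phi> a x) (\<phi> a y)"
  by (induction rule: rtranclp_induct) (auto intro: rtranclp.rtrancl_into_rtrancl gstep_phi)

lemma reach_adj: "reach x y \<Longrightarrow> adj\<^sup>*\<^sup>* (orb x) (orb y)"
proof (induction rule: rtranclp_induct)
  case (step y z)
  then show ?case using gstep_adj[of y z] by (metis rtranclp.rtrancl_into_rtrancl)
qed simp

text \<open>An edge provides commuting representatives of two orbits. Applying an automorphism moves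
  the first of them to the current end of the walk, so paths lift with a prescribed start.\<close>

lemma adj_reach:
  assumes "adj\<^sup>*\<^sup>* (orb x) v" "x \<in> carrier G" "x \<noteq> \<one>"
  shows "\<exists>y. y \<in> carrier G \<and> v = orb y \<and> reach x y"
  using assms(1)
proof (induction rule: rtranclp_induct)
  case base
  then show ?case using assms by blast
next
  case (step v w)
  then obtain y where y: "y \<in> carrier G" "v = orb y" "reach x y" by blast
  obtain x1 y1 where xy: "x1 \<in> v" "y1 \<in> w" "x1 \<otimes> y1 = y1 \<otimes> x1" and vw: "v \<in> Vs" "w \<in> Vs"
    using step(2) by (auto simp: cg_adj_def)
  obtain a where a: "a \<in> carrier A" "x1 = \<phi> a y" using xy(1) y(2) by (auto simp: orbit_def)
  obtain w0 where w0: "w0 \<in> carrier G" "w0 \<noteq> \<one>" "w = orb w0" using vw(2) by (rule vertexE)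
  obtain b where b: "b \<in> carrier A" "y1 = \<phi> b w0" using xy(2) w0(3) by (auto simp: orbit_def)
  have y1: "y1 \<in> carrier G" "y1 \<noteq> \<one>" "w = orb y1" using b w0 phi_eq_one_iff orb_eq by auto
  have yn: "y \<noteq> \<one>" using reach_closed[OF y(3), of "- {\<one>}"] assms(3) by (auto simp: gstep_def)
  have "gstep x1 y1" using a y(1) yn y1 xy(3) phi_eq_one_iff unfolding gstep_def by simp
  then have "gstep (\<phi> (inv\<^bsub>A\<^esub> a) x1) (\<phi> (inv\<^bsub>A\<^esub> a) y1)" using gstep_phi a(1) by simp
  then have "gstep y (\<phi> (inv\<^bsub>A\<^esub> a) y1)" using a y(1) by simp
  then have "reach x (\<phi> (inv\<^bsub>A\<^esub> a) y1)" using y(3) by (rule rtranclp.rtrancl_into_rtrancl[rotated])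
  moreover have "w = orb (\<phi> (inv\<^bsub>A\<^esub> a) y1)" using orb_eq[of "inv\<^bsub>A\<^esub> a" y1] a(1) y1 by simp
  ultimately show ?case using a(1) y1(1) by (intro exI[of _ "\<phi> (inv\<^bsub>A\<^esub> a) y1"]) simp
qed

context
  fixes \<H> R
  assumes cs: "component_system \<H> R"
begin

lemma R_component: "R \<noteq> {}" "R \<subseteq> carrier G - {\<one>}" "x \<in> R \<Longrightarrow> reach x y \<longleftrightarrow> y \<in> R"
  and cover: "carrier G - {\<one>} \<subseteq> R \<union> \<Union>\<H>" and \<H>_nonempty: "\<H> \<noteq> {}"
  using cs by (auto simp: component_system_def)

lemma \<H>_component:
  assumes "H \<in> \<H>"
  shows "subgroup H G" "H \<noteq> {\<one>}" "card H \<le> card R" "x \<in> H - {\<one>} \<Longrightarrow> reach x y \<longleftrightarrow> y \<in> H - {\<one>}"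
  using cs assms by (auto simp: component_system_def)

lemma H_carrier: "H \<in> \<H> \<Longrightarrow> h \<in> H \<Longrightarrow> h \<in> carrier G"
  using subgroup.mem_carrier[OF \<H>_component(1)] .

lemma one_in: "H \<in> \<H> \<Longrightarrow> \<one> \<in> H"
  using subgroup.one_closed[OF \<H>_component(1)] .

lemma H_non: "H \<in> \<H> \<Longrightarrow> \<exists>h. h \<in> H - {\<one>}"
  using \<H>_component(2) one_in by blast

lemma card_less: "H \<in> \<H> \<Longrightarrow> card (H - {\<one>}) < card R"
  using \<H>_component(3) card_Diff1_less[OF finite_subgroup[OF \<H>_component(1)] one_in] by (meson order_less_le_trans)

lemma \<H>_eq: "H \<in> \<H> \<Longrightarrow> H' \<in> \<H> \<Longrightarrow> h \<in> H - {\<one>} \<Longrightarrow> h \<in> H' \<Longrightarrow> H = H'"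
  using \<H>_component(4)[of H h] \<H>_component(4)[of H' h] one_in by blast

text \<open>If one element of \<open>R\<close> were sent into a complement \<open>H\<close>, the
  whole component would follow injectively, but \<open>H\<close> without the identity has fewer
  elements than \<open>R\<close>.\<close>

lemma phi_R:
  assumes a: "a \<in> carrier A" and x: "x \<in> R"
  shows "\<phi> a x \<in> R"
proof (rule ccontr)
  assume n: "\<phi> a x \<notin> R"
  have xc: "x \<in> carrier G" "x \<noteq> \<one>" using x R_component(2) by auto
  then have "\<phi> a x \<in> carrier G - {\<one>}" using a phi_eq_one_iff by simp
  then obtain H where H: "H \<in> \<H>" "\<phi> a x \<in> H - {\<one>}" using n cover by blast
  have "\<phi> a ` R \<subseteq> H - {\<one>}"
  proof clarify
    fix y assume "y \<in> R"
    then have "reach (\<phi> a x) (\<phi> a y)" using R_component(3)[OF x] reach_phi a by blast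
    then show "\<phi> a y \<in> H - {\<one>}" using \<H>_component(4)[OF H] by blast
  qed
  moreover have "inj_on (\<phi> a) R" using phi_inj[OF a] R_component(2) by (meson Diff_subset inj_on_subset subset_trans)
  ultimately have "card R \<le> card (H - {\<one>})"
    using finite_subgroup[OF \<H>_component(1)[OF H(1)]] by (intro card_inj_on_le) auto
  then show False using card_less[OF H(1)] by simp
qed

lemma R_disjoint:
  assumes "H \<in> \<H>" "h \<in> H - {\<one>}"
  shows "h \<notin> R"
proof
  assume "h \<in> R"
  then have "R = H - {\<one>}" using R_component(3) \<H>_component(4)[OF assms] by blast
  then show False using card_less[OF assms(1)] by simp
qed

text \<open>Automorphisms permute components and preserve \<open>R\<close>, so they permute the
  remaining ones.\<close>

lemma phi_\<H>:
  assumes a: "a \<in> carrier A" and H: "H \<in> \<H>"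
  shows "\<phi> a ` H \<in> \<H>"
proof -
  obtain h where h: "h \<in> H - {\<one>}" using H_non[OF H] by blast
  then have hc: "h \<in> carrier G" "h \<noteq> \<one>" using H_carrier[OF H] by auto
  have "\<phi> a h \<notin> R" using phi_R[of "inv\<^bsub>A\<^esub> a" "\<phi> a h"] R_disjoint[OF H h] a hc by auto
  moreover have "\<phi> a h \<in> carrier G - {\<one>}" using a hc phi_eq_one_iff by simp
  ultimately obtain H' where H': "H' \<in> \<H>" "\<phi> a h \<in> H' - {\<one>}" using cover by blast
  have "\<phi> a ` H = H'"
  proof (intro equalityI subsetI)
    fix y assume "y \<in> \<phi> a ` H"
    then obtain k where k: "k \<in> H" "y = \<phi> a k" by blast
    show "y \<in> H'"
    proof (cases "k = \<one>")
      case False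
      then have "reach (\<phi> a h) (\<phi> a k)" using k \<H>_component(4)[OF H h] reach_phi a by blast
      then show ?thesis using \<H>_component(4)[OF H'] k by blast
    qed (use k a phi_one one_in[OF H'(1)] in simp)
  next
    fix y assume y: "y \<in> H'"
    have yc: "y \<in> carrier G" using H_carrier[OF H'(1) y] .
    show "y \<in> \<phi> a ` H"
    proof (cases "y = \<one>")
      case False
      then have "reach (\<phi> a h) y" using \<H>_component(4)[OF H'] y by blast
      then have "reach h (\<phi> (inv\<^bsub>A\<^esub> a) y)" using reach_phi[of "\<phi> a h" y "inv\<^bsub>A\<^esub> a"] a hc by simp
      then have "\<phi> (inv\<^bsub>A\<^esub> a) y \<in> H" using \<H>_component(4)[OF H h] by blast
      moreover have "y = \<phi> a (\<phi> (inv\<^bsub>A\<^esub> a) y)" using a yc by simp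
      ultimately show ?thesis by blast
    qed (use a phi_one one_in[OF H] in \<open>auto intro!: image_eqI[of _ _ \<one>]\<close>)
  qed
  then show ?thesis using H'(1) by simp
qed

lemma not_connected: "\<not> cg_connected A G \<phi>"
proof
  assume con: "cg_connected A G \<phi>"
  obtain x where x: "x \<in> R" using R_component(1) by blast
  obtain H h where h: "H \<in> \<H>" "h \<in> H - {\<one>}" using \<H>_nonempty H_non by blast
  have c: "x \<in> carrier G" "x \<noteq> \<one>" "h \<in> carrier G" "h \<noteq> \<one>" using x R_component(2) h H_carrier by auto
  then have "adj\<^sup>*\<^sup>* (orb x) (orb h)" using con vertexI by (simp add: cg_connected_def)
  then obtain y where y: "y \<in> carrier G" "orb h = orb y" "reach x y" using adj_reach c by blast
  then obtain a where "a \<in> carrier A" "h = \<phi> a y" using orb_eqD c(3) by blast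
  then have "h \<in> R" using phi_R y(3) R_component(3)[OF x] by blast
  then show False using R_disjoint h by blast
qed

text \<open>\<open>R\<close> gives one component, the source of the summand 1. Two complements give
  the same component exactly when an automorphism from \<open>A\<close> maps one to the other,
  because a complement is determined by any of its nontrivial elements.\<close>

lemma num_components:
  "cg_num_components A G \<phi> = card ((\<lambda>H. (\<lambda>a. \<phi> a ` H) ` carrier A) ` \<H>) + 1"
proof -
  define rel where "rel = {(u, v). u \<in> Vs \<and> v \<in> Vs \<and> adj\<^sup>*\<^sup>* u v}"
  have cls: "rel `` {orb x} = orb ` {y. reach x y}" if x: "x \<in> carrier G" "x \<noteq> \<one>" for x
  proof (intro equalityI subsetI)
    fix v assume "v \<in> rel `` {orb x}"
    then have "adj\<^sup>*\<^sup>* (orb x) v" by (simp add: rel_def)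
    then show "v \<in> orb ` {y. reach x y}" using adj_reach x by blast
  next
    fix v assume "v \<in> orb ` {y. reach x y}"
    then obtain y where y: "reach x y" "v = orb y" by blast
    have "y \<in> carrier G - {\<one>}" using reach_closed[OF y(1), of "carrier G - {\<one>}"] x by (auto simp: gstep_def)
    then show "v \<in> rel `` {orb x}" using y reach_adj vertexI x by (auto simp: rel_def)
  qed
  let ?f = "\<lambda>H. orb ` (H - {\<one>})" and ?g = "\<lambda>H. (\<lambda>a. \<phi> a ` H) ` carrier A"
  have clsR: "rel `` {orb x} = orb ` R" if "x \<in> R" for x
  proof -
    have "{y. reach x y} = R" using R_component(3)[OF that] by blast
    then show ?thesis using cls[of x] R_component(2) that by auto
  qed
  have clsH: "rel `` {orb x} = ?f H" if "H \<in> \<H>" "x \<in> H - {\<one>}" for x H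
  proof -
    have "{y. reach x y} = H - {\<one>}" using \<H>_component(4)[OF that] by blast
    then show ?thesis using cls[of x] H_carrier[OF that(1)] that(2) by auto
  qed
  have "Vs // rel = insert (orb ` R) (?f ` \<H>)"
  proof (intro equalityI subsetI)
    fix C assume "C \<in> Vs // rel"
    then obtain x where x: "x \<in> carrier G" "x \<noteq> \<one>" "C = rel `` {orb x}" by (auto simp: quotient_def elim!: vertexE)
    then consider "x \<in> R" | H where "H \<in> \<H>" "x \<in> H - {\<one>}" using cover by blast
    then show "C \<in> insert (orb ` R) (?f ` \<H>)" by cases (use x(3) clsR clsH in auto)
  next
    fix C assume "C \<in> insert (orb ` R) (?f ` \<H>)"
    then consider "C = orb ` R" | H where "H \<in> \<H>" "C = ?f H" by blast
    then show "C \<in> Vs // rel"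
    proof cases
      case 1
      obtain x where x: "x \<in> R" using R_component(1) by blast
      then have "orb x \<in> Vs" using R_component(2) vertexI by auto
      then show ?thesis using quotientI[of "orb x" Vs rel] clsR[OF x] 1 by simp
    next
      case 2
      obtain x where x: "x \<in> H - {\<one>}" using H_non[OF 2(1)] by blast
      then have "orb x \<in> Vs" using H_carrier[OF 2(1)] vertexI by auto
      then show ?thesis using quotientI[of "orb x" Vs rel] clsH[OF 2(1) x] 2 by simp
    qed
  qed
  moreover have "orb ` R \<notin> ?f ` \<H>"
  proof
    assume "orb ` R \<in> ?f ` \<H>"
    then obtain H where H: "H \<in> \<H>" "orb ` R = ?f H" by blast
    obtain h where h: "h \<in> H - {\<one>}" using H_non[OF H(1)] by blast
    then obtain x where x: "x \<in> R" "orb h = orb x" using H(2) by blast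
    obtain a where "a \<in> carrier A" "h = \<phi> a x" using orb_eqD[OF x(2)] h H_carrier[OF H(1)] by blast
    then show False using phi_R x(1) R_disjoint[OF H(1) h] by blast
  qed
  moreover have "finite (?f ` \<H>)"
  proof -
    have "\<H> \<subseteq> Pow (carrier G)" using H_carrier by blast
    then show ?thesis using fin finite_subset by blast
  qed
  ultimately have "cg_num_components A G \<phi> = card (?f ` \<H>) + 1"
    by (simp add: cg_num_components_def rel_def)
  also have "card (?f ` \<H>) = card (?g ` \<H>)"
  proof -
    have fg: "?g H = ?g H'" if H: "H \<in> \<H>" "H' \<in> \<H>" "?f H = ?f H'" for H H'
    proof -
      obtain h where h: "h \<in> H - {\<one>}" using H_non[OF H(1)] by blast
      then obtain h' where h': "h' \<in> H' - {\<one>}" "orb h = orb h'" using H(3) by blast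
      obtain a where a: "a \<in> carrier A" "h = \<phi> a h'" using orb_eqD[OF h'(2)] h H_carrier[OF H(1)] by blast
      have eq: "H = \<phi> a ` H'" using \<H>_eq[OF H(1) phi_\<H>[OF a(1) H(2)] h] a h' by blast
      have "\<phi> b ` H = \<phi> (b \<otimes>\<^bsub>A\<^esub> a) ` H'" if "b \<in> carrier A" for b
        unfolding eq image_image using that a(1) H_carrier[OF H(2)] by (intro image_cong) (auto simp: phi_phi)
      then have 1: "?g H \<subseteq> ?g H'" using a(1) by auto
      have eq': "H' = \<phi> (inv\<^bsub>A\<^esub> a) ` H" unfolding eq image_image using a(1) H_carrier[OF H(2)] by simp
      have "\<phi> b ` H' = \<phi> (b \<otimes>\<^bsub>A\<^esub> inv\<^bsub>A\<^esub> a) ` H" if "b \<in> carrier A" for b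
      proof -
        have "\<phi> b ` H' = \<phi> b ` \<phi> (inv\<^bsub>A\<^esub> a) ` H" using eq' by simp
        also have "\<dots> = \<phi> (b \<otimes>\<^bsub>A\<^esub> inv\<^bsub>A\<^esub> a) ` H"
          unfolding image_image using that a(1) H_carrier[OF H(1)] by (intro image_cong) (auto simp: phi_phi)
        finally show ?thesis .
      qed
      then have "?g H' \<subseteq> ?g H" using a(1) by auto
      then show ?thesis using 1 by blast
    qed
    have gf: "?f H = ?f H'" if H: "H \<in> \<H>" "H' \<in> \<H>" "?g H = ?g H'" for H H'
    proof -
      have "\<phi> \<one>\<^bsub>A\<^esub> ` H = H" using H_carrier[OF H(1)] by simp
      then have "H \<in> ?g H" by (metis A.one_closed image_eqI)
      then obtain a where a: "a \<in> carrier A" "H = \<phi> a ` H'" using H(3) by auto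
      have "H - {\<one>} = \<phi> a ` (H' - {\<one>})"
      proof (intro equalityI subsetI)
        fix k assume "k \<in> H - {\<one>}"
        then obtain k' where "k' \<in> H'" "k = \<phi> a k'" "k \<noteq> \<one>" using a(2) by blast
        then show "k \<in> \<phi> a ` (H' - {\<one>})" using phi_one[OF a(1)] by blast
      next
        fix k assume "k \<in> \<phi> a ` (H' - {\<one>})"
        then obtain k' where k': "k' \<in> H'" "k = \<phi> a k'" "k' \<noteq> \<one>" by blast
        have "k \<in> H" unfolding a(2) k'(2) using k'(1) by (rule imageI)
        moreover have "k \<noteq> \<one>" using phi_eq_one_iff[OF a(1) H_carrier[OF H(2) k'(1)]] k'(2,3) by simp
        ultimately show "k \<in> H - {\<one>}" by simp
      qed
      then show ?thesis using orb_eq[OF a(1)] H_carrier[OF H(2)] by (auto simp: image_image)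
    qed
    show ?thesis by (rule card_image_eqI[OF fg gf])
  qed
  finally show ?thesis .
qed

end

text \<open>Eight is twice four: both ends reach the common element in four steps.\<close>

lemma close_vertices:
  assumes sol: "solvable G" and nfrob: "\<not> frobenius_group G" and ntwo: "\<not> two_frobenius_group G"
    and uv: "u \<in> Vs" "v \<in> Vs"
  shows "\<exists>m \<le> 8. (adj ^^ m) u v"
proof -
  obtain x y where x: "x \<in> carrier G" "x \<noteq> \<one>" "u = orb x" and y: "y \<in> carrier G" "y \<noteq> \<one>" "v = orb y"
    using uv by (metis vertexE)
  then have "carrier G \<noteq> {\<one>}" by blast
  then obtain z where "\<forall>x \<in> carrier G - {\<one>}. (gstep ^^ 4) x z"
    using common_neighbourhood[OF sol _ nfrob ntwo] by blast
  then have "(gstep ^^ 4) x z" "(gstep ^^ 4) z y" using x y walk_sym by auto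
  then have "(gstep ^^ (4 + 4)) x y" unfolding relpowp_add by blast
  then show ?thesis using walk_adj[of 8 x y] x y by simp
qed

end

theorem theorem2p2:
  fixes G :: "('a, 'c) monoid_scheme" and A :: "('b, 'd) monoid_scheme"
    and \<phi> :: "'b \<Rightarrow> 'a \<Rightarrow> 'a"
  assumes "group G" and "finite (carrier G)" and "solvable G"
    and "group A" and "finite (carrier A)"
    and "acts_by_automorphisms A G \<phi>"
  shows "(\<not> cg_connected A G \<phi> \<longleftrightarrow> frobenius_group G \<or> two_frobenius_group G)
       \<and> (\<forall>K H. frobenius_with G K H \<longrightarrow>
              cg_num_components A G \<phi> = compl_orbit_count A G \<phi> (carrier G) + 1)
       \<and> (\<forall>K L M. two_frobenius G K L M \<longrightarrow>
              cg_num_components A G \<phi> = compl_orbit_count A G \<phi> (K <#>\<^bsub>G\<^esub> L) + 1)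
       \<and> (cg_connected A G \<phi> \<longrightarrow> cg_diameter A G \<phi> \<le> 8)"
proof -
  interpret automorphism_action G A \<phi>
    using assms by (simp add: automorphism_action_def automorphism_action_axioms_def fin_group_def fin_group_axioms_def)
  have frob: "\<not> cg_connected A G \<phi> \<and> cg_num_components A G \<phi> = compl_orbit_count A G \<phi> (carrier G) + 1"
    if KH: "frobenius_with G K H" for K H
  proof -
    obtain R where R: "component_system {H. \<exists>K. frobenius_with G K H} R"
      using frobenius_components[OF assms(3) KH] by blast
    then show ?thesis using not_connected[OF R] num_components[OF R] by (simp add: compl_orbit_count_def)
  qed
  have two: "\<not> cg_connected A G \<phi> \<and> cg_num_components A G \<phi> = compl_orbit_count A G \<phi> (K <#>\<^bsub>G\<^esub> L) + 1"
    if KLM: "two_frobenius G K L M" for K L M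
  proof -
    obtain R where R: "component_system {H. \<exists>K'. frobenius_with (G\<lparr>carrier := K <#>\<^bsub>G\<^esub> L\<rparr>) K' H} R"
      using two_frobenius_components[OF assms(3) KLM] by blast
    then show ?thesis using not_connected[OF R] num_components[OF R] by (simp add: compl_orbit_count_def)
  qed
  \<comment> \<open>This one bound yields both connectedness and the estimate of the
    diameter.\<close>
  have close: "\<exists>m \<le> 8. (adj ^^ m) u v" if "\<not> (frobenius_group G \<or> two_frobenius_group G)" "u \<in> Vs" "v \<in> Vs" for u v
    using close_vertices[OF assms(3)] that by blast
  have iff: "\<not> cg_connected A G \<phi> \<longleftrightarrow> frobenius_group G \<or> two_frobenius_group G"
  proof
    assume "frobenius_group G \<or> two_frobenius_group G"
    then show "\<not> cg_connected A G \<phi>" using frob two by (auto simp: frobenius_group_def two_frobenius_group_def)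
  next
    assume n: "\<not> cg_connected A G \<phi>"
    show "frobenius_group G \<or> two_frobenius_group G"
    proof (rule ccontr)
      assume "\<not> ?thesis"
      then have "adj\<^sup>*\<^sup>* u v" if "u \<in> Vs" "v \<in> Vs" for u v using close[OF _ that] relpowp_imp_rtranclp by metis
      then show False using n by (simp add: cg_connected_def)
    qed
  qed
  have "cg_diameter A G \<phi> \<le> 8" if con: "cg_connected A G \<phi>"
  proof -
    have "cg_dist A G \<phi> u v \<le> 8" if uv: "u \<in> Vs" "v \<in> Vs" for u v
    proof -
      obtain m where "m \<le> 8" "(adj ^^ m) u v" using close[OF _ uv] con iff by blast
      then show ?thesis unfolding cg_dist_def by (meson Least_le order_trans)
    qed
    moreover have "finite {cg_dist A G \<phi> u v | u v. u \<in> Vs \<and> v \<in> Vs}"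
    proof -
      have "Vs = orb ` (carrier G - {\<one>\<^bsub>G\<^esub>})" by (auto simp: cg_vertices_def)
      then have "finite Vs" using assms(2) by simp
      then have "finite ((\<lambda>(u, v). cg_dist A G \<phi> u v) ` (Vs \<times> Vs))" by simp
      then show ?thesis by (rule rev_finite_subset) auto
    qed
    ultimately show ?thesis unfolding cg_diameter_def by (subst Max_le_iff) auto
  qed
  then show ?thesis using iff frob two by blast
qed

end
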